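(* Let $(k,\lambda)$ be a pair of integers for which $k \geq 47$, $\lambda \in \{24,28\}$, and $k \geq 352$ whenever $\lambda = 24$. Let $G$ be a multigraph, and let $\ell: V(G)\to\{0,1,\dots,k-1\}$. If $(G,\ell)$ is minimal, then $\rho(G) \leq -k+1$ or $G$ is a $K_k$.
   Context: Multigraphs are finite, may have parallel edges, but no loops. $E_G(u,v)$ is the set of edges joining $u$ and $v$. A correspondence cover of a multigraph $G$ is a pair $(H,L)$ where $H$ is a multigraph, $L:V(G)\to 2^{V(H)}$, each $L(v)$ is independent in $H$, the sets $L(v)$ partition $V(H)$, and for each pair of distinct $u,v\in V(G)$, $H[L(u)\cup L(v)]$ is a union of $|E_G(u,v)|$ (possibly empty) matchings. An $(H,L)$-coloring of $G$ is a function $\phi:V(G)\to V(H)$ with $\phi(v)\in L(v)$ for each $v$ whose image is independent in $H$. For $\ell:V(G)\to\mathbb N\cup\{0\}$, an $\ell$-cover of $G$ is a correspondence cover with $|L(v)|=\ell(v)$ for each $v\in V(G)$. $(G,\ell)$ is minimal if $G$ has an $\ell$-cover $(H,L)$ for which $G$ has no $(H,L)$-coloring, but for every proper subgraph $G'$ of $G$ and every $\ell$-cover $(H',L')$ of $G'$ (with $\ell$ restricted to $V(G')$), $G'$ has an $(H',L')$-coloring. Potential: for $v\in V(G)$, $\rho(v)=(k-1)\lambda+1$ if $\ell(v)=k-1$, and $\rho(v)=\ell(v)(\lambda+1)-(k-1)$ if $0\le \ell(v)\le k-2$. Set $\mu=6$ and fix a total ordering on $E(G)$. For an edge $e$ with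 endpoints $u,v$, $\rho(e)=-2\lambda$ if $e$ is the first edge in the ordering joining $u$ and $v$, and $\rho(e)=-(2\lambda+\mu)$ otherwise. Then $\rho(G)=\sum_{v\in V(G)}\rho(v)+\sum_{e\in E(G)}\rho(e)$. *)

theory Defs
  imports Main "HOL-Library.Disjoint_Sets"
begin

record ('v, 'e) multigraph =
  verts :: "'v set"
  edges :: "'e set"
  ends :: "'e \<Rightarrow> 'v set"

text \<open>The value of \<open>ends\<close> outside \<open>edges\<close> carries no meaning; no definition below inspects it.\<close>

definition multigraph :: "('v, 'e) multigraph \<Rightarrow> bool" where
  "multigraph G \<longleftrightarrow> finite (verts G) \<and> finite (edges G) \<and>
     (\<forall>e\<in>edges G. ends G e \<subseteq> verts G \<and> card (ends G e) = 2)"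

definition edges_between :: "('v, 'e) multigraph \<Rightarrow> 'v \<Rightarrow> 'v \<Rightarrow> 'e set" where
  "edges_between G u v = {e \<in> edges G. ends G e = {u, v}}"

definition subgraph :: "('v, 'e) multigraph \<Rightarrow> ('v, 'e) multigraph \<Rightarrow> bool" where
  "subgraph G' G \<longleftrightarrow> multigraph G' \<and> verts G' \<subseteq> verts G \<and> edges G' \<subseteq> edges G \<and>
     (\<forall>e\<in>edges G'. ends G' e = ends G e)"

definition proper_subgraph :: "('v, 'e) multigraph \<Rightarrow> ('v, 'e) multigraph \<Rightarrow> bool" where
  "proper_subgraph G' G \<longleftrightarrow> subgraph G' G \<and> (verts G' \<noteq> verts G \<or> edges G' \<noteq> edges G)"

definition induced_subgraph :: "('v, 'e) multigraph \<Rightarrow> 'v set \<Rightarrow> ('v, 'e) multigraph" where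
  "induced_subgraph G S =
     \<lparr>verts = verts G \<inter> S, edges = {e \<in> edges G. ends G e \<subseteq> S}, ends = ends G\<rparr>"

definition independent :: "('v, 'e) multigraph \<Rightarrow> 'v set \<Rightarrow> bool" where
  "independent G S \<longleftrightarrow> S \<subseteq> verts G \<and> (\<forall>e\<in>edges G. \<not> ends G e \<subseteq> S)"

definition matching :: "('v, 'e) multigraph \<Rightarrow> 'e set \<Rightarrow> bool" where
  "matching G M \<longleftrightarrow> M \<subseteq> edges G \<and> (\<forall>e\<in>M. \<forall>f\<in>M. e \<noteq> f \<longrightarrow> ends G e \<inter> ends G f = {})"

definition union_of_matchings :: "('v, 'e) multigraph \<Rightarrow> nat \<Rightarrow> bool" where
  "union_of_matchings G m \<longleftrightarrow>
     (\<exists>M. (\<forall>i<m. matching G (M i)) \<and> edges G = (\<Union>i<m. M i))"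

text \<open>The parts \<open>L v\<close> may be empty, so the partition condition is disjointness together with
  covering.\<close>

definition correspondence_cover ::
  "('v, 'e) multigraph \<Rightarrow> ('h, 'f) multigraph \<Rightarrow> ('v \<Rightarrow> 'h set) \<Rightarrow> bool" where
  "correspondence_cover G H L \<longleftrightarrow> multigraph H \<and>
     (\<forall>v\<in>verts G. independent H (L v)) \<and>
     disjoint_family_on L (verts G) \<and> (\<Union>v\<in>verts G. L v) = verts H \<and>
     (\<forall>u\<in>verts G. \<forall>v\<in>verts G. u \<noteq> v \<longrightarrow>
        union_of_matchings (induced_subgraph H (L u \<union> L v)) (card (edges_between G u v)))"

definition ell_cover ::
  "('v, 'e) multigraph \<Rightarrow> ('v \<Rightarrow> nat) \<Rightarrow> ('h, 'f) multigraph \<Rightarrow> ('v \<Rightarrow> 'h set) \<Rightarrow> bool" where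
  "ell_cover G l H L \<longleftrightarrow> correspondence_cover G H L \<and> (\<forall>v\<in>verts G. card (L v) = l v)"

definition cover_coloring ::
  "('v, 'e) multigraph \<Rightarrow> ('h, 'f) multigraph \<Rightarrow> ('v \<Rightarrow> 'h set) \<Rightarrow> ('v \<Rightarrow> 'h) \<Rightarrow> bool" where
  "cover_coloring G H L \<phi> \<longleftrightarrow>
     (\<forall>v\<in>verts G. \<phi> v \<in> L v) \<and> independent H (\<phi> ` verts G)"

text \<open>A formula cannot quantify over the types of vertices and edges of the cover graphs, so they
  are taken to be \<open>nat\<close>. As multigraphs are finite, this loses no covers; see lemma
  \<open>ell_cover_nat\<close> below.\<close>

definition minimal :: "('v, 'e) multigraph \<Rightarrow> ('v \<Rightarrow> nat) \<Rightarrow> bool" where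
  "minimal G l \<longleftrightarrow>
     (\<exists>(H :: (nat, nat) multigraph) L. ell_cover G l H L \<and> (\<nexists>\<phi>. cover_coloring G H L \<phi>)) \<and>
     (\<forall>G'. proper_subgraph G' G \<longrightarrow>
        (\<forall>(H' :: (nat, nat) multigraph) L'. ell_cover G' l H' L' \<longrightarrow>
           (\<exists>\<phi>. cover_coloring G' H' L' \<phi>)))"

lemma ell_cover_nat:
  fixes G :: "('v, 'e) multigraph" and H :: "('h, 'f) multigraph"
  assumes cov: "ell_cover G l H L"
  shows "\<exists>(H' :: (nat, nat) multigraph) L'. ell_cover G l H' L' \<and>
           ((\<exists>\<phi>. cover_coloring G H' L' \<phi>) \<longleftrightarrow> (\<exists>\<phi>. cover_coloring G H L \<phi>))"
proof -
  have H: "multigraph H" and ind: "\<And>v. v \<in> verts G \<Longrightarrow> independent H (L v)"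
    and dis: "disjoint_family_on L (verts G)" and un: "(\<Union>v\<in>verts G. L v) = verts H"
    and mat: "\<And>u v. u \<in> verts G \<Longrightarrow> v \<in> verts G \<Longrightarrow> u \<noteq> v \<Longrightarrow>
        union_of_matchings (induced_subgraph H (L u \<union> L v)) (card (edges_between G u v))"
    and size: "\<And>v. v \<in> verts G \<Longrightarrow> card (L v) = l v"
    using cov unfolding ell_cover_def correspondence_cover_def by blast+
  obtain f :: "'h \<Rightarrow> nat" where f: "inj_on f (verts H)"
    using H finite_imp_inj_to_nat_seg unfolding multigraph_def by metis
  obtain g :: "'f \<Rightarrow> nat" where g: "inj_on g (edges H)"
    using H finite_imp_inj_to_nat_seg unfolding multigraph_def by metis
  define H' :: "(nat, nat) multigraph" where
    "H' = \<lparr>verts = f ` verts H, edges = g ` edges H,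
           ends = (\<lambda>x. f ` ends H (inv_into (edges H) g x))\<rparr>"
  define L' where "L' v = f ` L v" for v
  have V': "verts H' = f ` verts H" and E': "edges H' = g ` edges H" by (simp_all add: H'_def)
  have en: "ends H' (g e) = f ` ends H e" if "e \<in> edges H" for e
    using that g by (simp add: H'_def)
  have eH: "ends H e \<subseteq> verts H" "card (ends H e) = 2" if "e \<in> edges H" for e
    using H that by (auto simp: multigraph_def)
  have LH: "L v \<subseteq> verts H" if "v \<in> verts G" for v using un that by auto
  have img_sub: "f ` A \<subseteq> f ` B \<longleftrightarrow> A \<subseteq> B" if "A \<subseteq> verts H" "B \<subseteq> verts H" for A B
    using that inj_onD[OF f] by blast
  have indep: "independent H' (f ` S) \<longleftrightarrow> independent H S" if "S \<subseteq> verts H" for S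
    unfolding independent_def V' E' using that by (auto simp: en eH img_sub)
  have H'mg: "multigraph H'"
    unfolding multigraph_def V' E' using H eH
    by (auto simp: multigraph_def en card_image inj_on_subset[OF f])
  have dis': "disjoint_family_on L' (verts G)"
    unfolding disjoint_family_on_def L'_def
  proof (intro ballI impI)
    fix u v assume uv: "u \<in> verts G" "v \<in> verts G" "u \<noteq> v"
    have "f ` L u \<inter> f ` L v = f ` (L u \<inter> L v)"
      using inj_on_image_Int[OF f LH LH] uv by simp
    then show "f ` L u \<inter> f ` L v = {}" using dis uv by (simp add: disjoint_family_on_def)
  qed
  have mat': "union_of_matchings (induced_subgraph H' (L' u \<union> L' v)) (card (edges_between G u v))"
    if uv: "u \<in> verts G" "v \<in> verts G" "u \<noteq> v" for u v
  proof -
    let ?S = "L u \<union> L v" and ?m = "card (edges_between G u v)"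
    have S: "?S \<subseteq> verts H" using LH uv by auto
    obtain M where M: "\<And>i. i < ?m \<Longrightarrow> matching (induced_subgraph H ?S) (M i)"
      and MU: "{e \<in> edges H. ends H e \<subseteq> ?S} = (\<Union>i<?m. M i)"
    proof -
      have "edges (induced_subgraph H ?S) = {e \<in> edges H. ends H e \<subseteq> ?S}"
        by (simp add: induced_subgraph_def)
      then show thesis using mat[OF uv] that unfolding union_of_matchings_def by metis
    qed
    have edg: "{e \<in> edges H'. ends H' e \<subseteq> L' u \<union> L' v} = g ` {e \<in> edges H. ends H e \<subseteq> ?S}"
    proof -
      have "ends H' (g e) \<subseteq> L' u \<union> L' v \<longleftrightarrow> ends H e \<subseteq> ?S" if "e \<in> edges H" for e
        using img_sub[OF eH(1)[OF that] S] en[OF that] by (simp only: L'_def image_Un)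
      then show ?thesis unfolding E' by blast
    qed
    have "matching (induced_subgraph H' (L' u \<union> L' v)) (g ` M i)" if i: "i < ?m" for i
    proof -
      have sub: "M i \<subseteq> {e \<in> edges H. ends H e \<subseteq> ?S}"
        and d: "\<And>a b. a \<in> M i \<Longrightarrow> b \<in> M i \<Longrightarrow> a \<noteq> b \<Longrightarrow> ends H a \<inter> ends H b = {}"
        using M[OF i] by (auto simp: matching_def induced_subgraph_def)
      have "ends H' (g a) \<inter> ends H' (g b) = {}" if ab: "a \<in> M i" "b \<in> M i" "g a \<noteq> g b" for a b
      proof -
        have E: "a \<in> edges H" "b \<in> edges H" using ab sub by auto
        have "f ` ends H a \<inter> f ` ends H b = f ` (ends H a \<inter> ends H b)"
          using inj_on_image_Int[OF f] eH(1) E by metis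
        also have "\<dots> = {}" using d[OF ab(1,2)] ab(3) by auto
        finally show ?thesis using E by (simp add: en)
      qed
      moreover have "g ` M i \<subseteq> {e \<in> edges H'. ends H' e \<subseteq> L' u \<union> L' v}"
        unfolding edg using sub by blast
      ultimately show ?thesis unfolding matching_def by (auto simp: induced_subgraph_def)
    qed
    moreover have "edges (induced_subgraph H' (L' u \<union> L' v)) = (\<Union>i<?m. g ` M i)"
      using edg MU by (simp add: induced_subgraph_def image_UN)
    ultimately show ?thesis unfolding union_of_matchings_def
      by (intro exI[of _ "\<lambda>i. g ` M i"]) simp
  qed
  have "(\<Union>v\<in>verts G. L' v) = verts H'" unfolding V' un[symmetric] L'_def by (simp add: image_UN)
  moreover have "independent H' (L' v)" "card (L' v) = l v" if "v \<in> verts G" for v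
    using that indep LH ind size by (simp_all add: L'_def card_image inj_on_subset[OF f])
  ultimately have "ell_cover G l H' L'"
    unfolding ell_cover_def correspondence_cover_def using H'mg dis' mat' by simp
  moreover have "(\<exists>\<phi>. cover_coloring G H' L' \<phi>) \<longleftrightarrow> (\<exists>\<phi>. cover_coloring G H L \<phi>)"
  proof
    assume "\<exists>\<phi>. cover_coloring G H L \<phi>"
    then obtain \<phi> where p: "\<And>v. v \<in> verts G \<Longrightarrow> \<phi> v \<in> L v" "independent H (\<phi> ` verts G)"
      by (auto simp: cover_coloring_def)
    have "independent H' (f ` (\<phi> ` verts G))" using p indep independent_def by metis
    then have "cover_coloring G H' L' (f \<circ> \<phi>)"
      using p by (auto simp: cover_coloring_def L'_def image_comp)
    then show "\<exists>\<phi>. cover_coloring G H' L' \<phi>" by blast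
  next
    assume "\<exists>\<phi>. cover_coloring G H' L' \<phi>"
    then obtain \<psi> where p: "\<And>v. v \<in> verts G \<Longrightarrow> \<psi> v \<in> f ` L v" "independent H' (\<psi> ` verts G)"
      by (auto simp: cover_coloring_def L'_def)
    from p(1) obtain \<phi> where q: "\<And>v. v \<in> verts G \<Longrightarrow> \<phi> v \<in> L v \<and> \<psi> v = f (\<phi> v)"
      unfolding image_iff by metis
    have "\<psi> ` verts G = f ` (\<phi> ` verts G)" using q by (auto simp: image_image)
    moreover have "\<phi> ` verts G \<subseteq> verts H" using q LH by blast
    ultimately have "independent H (\<phi> ` verts G)" using p(2) indep by simp
    then show "\<exists>\<phi>. cover_coloring G H L \<phi>" using q by (auto simp: cover_coloring_def)
  qed
  ultimately show ?thesis by blast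
qed

definition complete_graph :: "nat \<Rightarrow> ('v, 'e) multigraph \<Rightarrow> bool" where
  "complete_graph k G \<longleftrightarrow> card (verts G) = k \<and>
     (\<forall>u\<in>verts G. \<forall>v\<in>verts G. u \<noteq> v \<longrightarrow> card (edges_between G u v) = 1)"

definition mu :: int where
  "mu = 6"

text \<open>The \<open>else\<close> branch of \<open>rho_vertex\<close> is meant for \<open>l v \<le> k - 2\<close> only.\<close>

definition rho_vertex :: "int \<Rightarrow> int \<Rightarrow> ('v \<Rightarrow> nat) \<Rightarrow> 'v \<Rightarrow> int" where
  "rho_vertex k lam l v =
     (if int (l v) = k - 1 then (k - 1) * lam + 1 else int (l v) * (lam + 1) - (k - 1))"

text \<open>\<open>r\<close> is a reflexive total order on the edges of \<open>G\<close>, with \<open>(e, f) \<in> r\<close> meaning that \<open>e\<close>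
  equals or precedes \<open>f\<close>.\<close>

definition rho_edge :: "int \<Rightarrow> ('v, 'e) multigraph \<Rightarrow> 'e rel \<Rightarrow> 'e \<Rightarrow> int" where
  "rho_edge lam G r e =
     (if \<forall>f\<in>edges G. ends G f = ends G e \<longrightarrow> (e, f) \<in> r then - (2 * lam) else - (2 * lam + mu))"

definition rho ::
  "int \<Rightarrow> int \<Rightarrow> ('v, 'e) multigraph \<Rightarrow> ('v \<Rightarrow> nat) \<Rightarrow> 'e rel \<Rightarrow> int" where
  "rho k lam G l r = (\<Sum>v\<in>verts G. rho_vertex k lam l v) + (\<Sum>e\<in>edges G. rho_edge lam G r e)"

end

theory Submission
  imports Defs
begin

text \<open>
  Write \<open>kap = k - 1\<close> and take a counterexample with as few vertices as possible, so that its
  potential exceeds \<open>- kap\<close>. The contradiction comes from three ideas.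

  \<^bold>\<open>A gap in the potential.\<close> Let \<open>S\<close> be a nonempty proper set of vertices. Color \<open>S\<close> in a cover
  without coloring, and shorten the list of each remaining vertex by the number of its edges to
  \<open>S\<close>. What remains has no coloring, so it contains a smaller critical pair on some \<open>W\<close>, whose
  potential is at most \<open>- kap\<close>. Restoring the lists costs at most \<open>lam + 2\<close> per edge between \<open>S\<close>
  and \<open>W\<close>, while each such edge contributes \<open>- 2 * lam\<close> to the potential of \<open>S \<union> W\<close>. If \<open>S\<close> has
  the least potential \<open>g\<close> among all nonempty proper sets, then \<open>S \<union> W\<close> must be everything, and
  \<open>g \<ge> 1 + (lam - 2) * c\<close> for the number \<open>c\<close> of edges leaving \<open>S\<close>. The same step with the
  complement of \<open>S\<close> gives \<open>(lam + 2) * c \<ge> kap + g\<close>. Together, \<open>g\<close> is larger than \<open>5 * kap\<close>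
  (\<open>potential_ge_gap\<close>). Hence a graph that arises by deleting vertices and adding few edges is
  still colorable: an uncolorable part of it would have too small a potential.

  \<^bold>\<open>Tight vertices.\<close> A vertex has at least as many edges as colors; call it tight in case of
  equality. By minimality, every connected set of tight vertices fails to be colorable from
  lists as long as the degrees inside the set. As in Gallai's theorem on list-critical graphs,
  this makes the blocks of such sets regular, and complete unless no vertex has more than two
  neighbors in its block. Let \<open>B\<close> be a large clique of tight vertices, with at most \<open>P\<close> edges
  leaving \<open>B\<close> at each vertex. If two vertices of \<open>B\<close> had different neighbors outside, then
  deleting \<open>B\<close> and adding a star with at most \<open>P\<close> edges would yield a graph each of whose
  colorings extends to \<open>B\<close>; by the gap it has colorings (\<open>clique_same_neighbors\<close>). So all
  vertices of \<open>B\<close> have the same outside neighbors. Two of these are not adjacent, since there is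
  no \<open>K_k\<close>, and making them block the same color shows that one of the common neighbors is rich,
  which means that its degree is far larger than its number of colors (\<open>clique_rich_neighbor\<close>).

  \<^bold>\<open>Discharging.\<close> Split the weight of each edge between its ends. Then tight vertices with \<open>kap\<close>
  colors and no parallel edges have charge \<open>1\<close>; all other charges are negative. Stripping leaf
  blocks off the graph of tight vertices shows that, on average, a vertex of charge \<open>1\<close> has \<open>P\<close>
  edges to vertices that are not tight, unless it has a rich neighbor (\<open>tight_degree_sum\<close>).
  Paying \<open>2 / P\<close> along every edge, and \<open>2\<close> more from rich vertices, brings all charges down to
  \<open>- 1\<close> on average. As there are more than \<open>kap\<close> vertices, the potential is below \<open>- kap\<close>.
  Graphs with at most \<open>kap\<close> vertices are settled by counting parallel edges (\<open>few_vertices\<close>).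

  The number \<open>P\<close> is the largest one for which a clique \<open>K_k\<close> that uses \<open>P\<close> added edges still has
  too small a potential: \<open>k + 2 * lam * P\<close> is less than the lower bound for \<open>g\<close>. Discharging
  needs \<open>2 * k \<le> (lam - 2) * P\<close>, which the lower bounds on \<open>k\<close> guarantee.
\<close>

section \<open>Conflict covers of weighted multigraphs\<close>

abbreviation partial_matching :: "(nat \<Rightarrow> nat \<Rightarrow> bool) \<Rightarrow> bool" where
  "partial_matching F \<equiv> (\<forall>a b c. F a b \<and> F a c \<longrightarrow> b = c) \<and> (\<forall>a b c. F b a \<and> F c a \<longrightarrow> b = c)"

text \<open>The bipartite graph of a cover between two lists, as a relation on colors. Parallel edges of the
  cover do not influence colorings, so a relation carries all that matters.\<close>

definition union_matchings :: "nat \<Rightarrow> (nat \<Rightarrow> nat \<Rightarrow> bool) \<Rightarrow> bool" where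
  "union_matchings n Q \<longleftrightarrow>
     (\<exists>M. (\<forall>i<n. partial_matching (M i)) \<and>
          (\<forall>a b. Q a b \<longleftrightarrow> (\<exists>i<n. M i a b)))"

text \<open>\<open>R u a v b\<close> says that color \<open>a\<close> of \<open>u\<close> and color \<open>b\<close> of \<open>v\<close> are adjacent in the cover. The lists
  of different vertices may share colors; it is the pair of vertex and color that plays the role
  of a vertex of the cover.\<close>

definition conflict_cover ::
  "'v set \<Rightarrow> ('v \<Rightarrow> 'v \<Rightarrow> nat) \<Rightarrow> ('v \<Rightarrow> nat set) \<Rightarrow> ('v \<Rightarrow> nat \<Rightarrow> 'v \<Rightarrow> nat \<Rightarrow> bool) \<Rightarrow> bool" where
  "conflict_cover V m L R \<longleftrightarrow> (\<forall>v\<in>V. finite (L v)) \<and> (\<forall>u a v b. R u a v b \<longrightarrow> R v b u a) \<and>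
     (\<forall>u\<in>V. \<forall>v\<in>V. u \<noteq> v \<longrightarrow> union_matchings (m u v) (\<lambda>a b. a \<in> L u \<and> b \<in> L v \<and> R u a v b))"

definition proper_coloring ::
  "'v set \<Rightarrow> ('v \<Rightarrow> nat set) \<Rightarrow> ('v \<Rightarrow> nat \<Rightarrow> 'v \<Rightarrow> nat \<Rightarrow> bool) \<Rightarrow> ('v \<Rightarrow> nat) \<Rightarrow> bool" where
  "proper_coloring S L R \<phi> \<longleftrightarrow> (\<forall>v\<in>S. \<phi> v \<in> L v) \<and>
     (\<forall>u\<in>S. \<forall>v\<in>S. u \<noteq> v \<longrightarrow> \<not> R u (\<phi> u) v (\<phi> v))"

definition residual ::
  "('v \<Rightarrow> nat set) \<Rightarrow> ('v \<Rightarrow> nat \<Rightarrow> 'v \<Rightarrow> nat \<Rightarrow> bool) \<Rightarrow> 'v set \<Rightarrow> ('v \<Rightarrow> nat) \<Rightarrow> 'v \<Rightarrow> nat set" where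
  "residual L R S \<phi> v = {a \<in> L v. \<forall>u\<in>S. \<not> R u (\<phi> u) v a}"

definition uncolorable :: "'v set \<Rightarrow> ('v \<Rightarrow> 'v \<Rightarrow> nat) \<Rightarrow> ('v \<Rightarrow> nat) \<Rightarrow> bool" where
  "uncolorable V m l \<longleftrightarrow>
     (\<exists>L R. conflict_cover V m L R \<and> (\<forall>v\<in>V. card (L v) = l v) \<and> (\<nexists>\<phi>. proper_coloring V L R \<phi>))"

text \<open>Up to the names of its edges, a loopless multigraph is given by the number of edges between any
  two vertices.\<close>

definition multiplicity :: "('v \<Rightarrow> 'v \<Rightarrow> nat) \<Rightarrow> bool" where
  "multiplicity m \<longleftrightarrow> (\<forall>u v. m u v = m v u) \<and> (\<forall>v. m v v = 0)"

definition critical :: "'v set \<Rightarrow> ('v \<Rightarrow> 'v \<Rightarrow> nat) \<Rightarrow> ('v \<Rightarrow> nat) \<Rightarrow> bool" where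
  "critical V m l \<longleftrightarrow> uncolorable V m l \<and>
     (\<forall>V' m'. V' \<subseteq> V \<and> multiplicity m' \<and> (\<forall>u v. m' u v \<le> m u v) \<and>
        (V' \<noteq> V \<or> (\<exists>u\<in>V. \<exists>v\<in>V. m' u v \<noteq> m u v)) \<longrightarrow> \<not> uncolorable V' m' l)"

definition degree :: "('v \<Rightarrow> 'v \<Rightarrow> nat) \<Rightarrow> 'v set \<Rightarrow> 'v \<Rightarrow> nat" where
  "degree m S v = (\<Sum>u\<in>S. m v u)"

lemma union_matchingsI:
  assumes "\<And>i a b c. i < n \<Longrightarrow> M i a b \<Longrightarrow> M i a c \<Longrightarrow> b = c"
    "\<And>i a b c. i < n \<Longrightarrow> M i b a \<Longrightarrow> M i c a \<Longrightarrow> b = c"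
    "\<And>a b. Q a b \<longleftrightarrow> (\<exists>i<n. M i a b)"
  shows "union_matchings n Q"
  unfolding union_matchings_def
proof (intro exI[of _ M] conjI allI impI)
  show "b = c" if "i < n" "M i a b \<and> M i a c" for i a b c using that(2) by (elim conjE) (rule assms(1)[OF that(1)])
  show "b = c" if "i < n" "M i b a \<and> M i c a" for i a b c using that(2) by (elim conjE) (rule assms(2)[OF that(1)])
qed (rule assms(3))

lemma union_matchings_mono:
  assumes "union_matchings n Q" "\<And>a b. Q' a b \<Longrightarrow> Q a b" "n \<le> n'"
  shows "union_matchings n' Q'"
proof -
  obtain M where M: "\<forall>i<n. partial_matching (M i)"
    "\<forall>a b. Q a b \<longleftrightarrow> (\<exists>i<n. M i a b)"
    using assms(1) unfolding union_matchings_def by blast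
  define N where "N i a b \<longleftrightarrow> i < n \<and> M i a b \<and> Q' a b" for i a b
  have "\<forall>i<n'. partial_matching (N i)"
    using M(1) unfolding N_def by blast
  moreover have "\<forall>a b. Q' a b \<longleftrightarrow> (\<exists>i<n'. N i a b)"
    using M(2) assms(2,3) unfolding N_def by (meson less_le_trans)
  ultimately show ?thesis unfolding union_matchings_def by blast
qed

lemma union_matchings_add:
  assumes "union_matchings n Q" "union_matchings n' Q'"
  shows "union_matchings (n + n') (\<lambda>a b. Q a b \<or> Q' a b)"
proof -
  obtain M where M: "\<forall>i<n. partial_matching (M i)"
    "\<forall>a b. Q a b \<longleftrightarrow> (\<exists>i<n. M i a b)"
    using assms(1) unfolding union_matchings_def by blast
  obtain N where N: "\<forall>i<n'. partial_matching (N i)"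
    "\<forall>a b. Q' a b \<longleftrightarrow> (\<exists>i<n'. N i a b)"
    using assms(2) unfolding union_matchings_def by blast
  define T where "T i = (if i < n then M i else N (i - n))" for i
  have "\<forall>i<n+n'. partial_matching (T i)"
  proof (intro allI impI)
    fix i assume "i < n + n'"
    then have "i < n \<or> (\<not> i < n \<and> i - n < n')" by auto
    then show "partial_matching (T i)"
    proof
      assume "i < n"
      then show ?thesis using M(1) by (simp add: T_def)
    next
      assume i: "\<not> i < n \<and> i - n < n'"
      then have "T i = N (i - n)" by (simp add: T_def)
      then show ?thesis using N(1) i by metis
    qed
  qed
  moreover have "\<forall>a b. (Q a b \<or> Q' a b) \<longleftrightarrow> (\<exists>i<n+n'. T i a b)"
  proof (intro allI iffI)
    fix a b assume "Q a b \<or> Q' a b"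
    then show "\<exists>i<n+n'. T i a b"
    proof
      assume "Q a b"
      then obtain i where "i < n" "M i a b" using M(2) by blast
      then show ?thesis by (intro exI[of _ i]) (simp add: T_def)
    next
      assume "Q' a b"
      then obtain i where "i < n'" "N i a b" using N(2) by blast
      then show ?thesis by (intro exI[of _ "n + i"]) (simp add: T_def)
    qed
  next
    fix a b assume "\<exists>i<n+n'. T i a b"
    then obtain i where i: "i < n + n'" "T i a b" by blast
    show "Q a b \<or> Q' a b"
    proof (cases "i < n")
      case True then show ?thesis using i M(2) by (auto simp: T_def)
    next
      case False
      then have "i - n < n'" "N (i - n) a b" using i by (auto simp: T_def)
      then show ?thesis using N(2) by blast
    qed
  qed
  ultimately show ?thesis unfolding union_matchings_def by blast
qed

lemma union_matchings_card:
  assumes "union_matchings n Q"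
  shows "finite {b. Q a b}" "card {b. Q a b} \<le> n"
proof -
  obtain M where M: "\<And>i a b c. i < n \<Longrightarrow> M i a b \<Longrightarrow> M i a c \<Longrightarrow> b = c"
    "\<And>a b. Q a b \<longleftrightarrow> (\<exists>i<n. M i a b)"
    using assms unfolding union_matchings_def by metis
  have sub: "{b. Q a b} \<subseteq> (\<lambda>i. SOME b. M i a b) ` {..<n}"
  proof
    fix b assume "b \<in> {b. Q a b}"
    then obtain i where i: "i < n" "M i a b" using M(2) by blast
    then have "(SOME b. M i a b) = b" using M(1) by (metis someI)
    then show "b \<in> (\<lambda>i. SOME b. M i a b) ` {..<n}" using i by force
  qed
  show "finite {b. Q a b}" using finite_subset[OF sub] by simp
  have "card {b. Q a b} \<le> card ((\<lambda>i. SOME b. M i a b) ` {..<n})" by (rule card_mono) (use sub in auto)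
  also have "\<dots> \<le> n" using card_image_le[of "{..<n}"] by simp
  finally show "card {b. Q a b} \<le> n" .
qed

lemma union_matchings_1:
  assumes "union_matchings 1 Q"
  shows "Q a b \<Longrightarrow> Q a c \<Longrightarrow> b = c" "Q b a \<Longrightarrow> Q c a \<Longrightarrow> b = c"
proof -
  obtain M where M: "\<forall>i<1::nat. partial_matching (M i)"
    "\<forall>a b. Q a b \<longleftrightarrow> (\<exists>i<1. M i a b)"
    using assms unfolding union_matchings_def by (elim exE conjE)
  have QM: "Q x y \<longleftrightarrow> M 0 x y" for x y using M(2) by simp
  show "Q a b \<Longrightarrow> Q a c \<Longrightarrow> b = c" "Q b a \<Longrightarrow> Q c a \<Longrightarrow> b = c"
    using M(1) unfolding QM by simp_all
qed

lemma union_matchings_swap: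
  assumes "union_matchings n Q"
  shows "union_matchings n (\<lambda>a b. Q b a)"
proof -
  obtain M where M: "\<forall>i<n. partial_matching (M i)"
    "\<forall>a b. Q a b \<longleftrightarrow> (\<exists>i<n. M i a b)"
    using assms unfolding union_matchings_def by (elim exE conjE)
  show ?thesis unfolding union_matchings_def
    by (rule exI[of _ "\<lambda>i a b. M i b a"]) (use M in simp)
qed

lemma union_matchings_comp:
  assumes "union_matchings n Q" "\<And>a c c'. G a c \<Longrightarrow> G a c' \<Longrightarrow> c = c'" "\<And>a a' c. G a c \<Longrightarrow> G a' c \<Longrightarrow> a = a'"
  shows "union_matchings n (\<lambda>a b. \<exists>c. G a c \<and> Q c b)"
proof -
  obtain M where M: "\<forall>i<n. partial_matching (M i)"
    "\<forall>a b. Q a b \<longleftrightarrow> (\<exists>i<n. M i a b)"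
    using assms(1) unfolding union_matchings_def by (elim exE conjE)
  define N where "N i a b \<longleftrightarrow> (\<exists>c. G a c \<and> M i c b)" for i a b
  have "b = c" if h: "i < n" "N i a b" "N i a c" for i a b c
  proof -
    obtain d d' where d: "G a d" "M i d b" "G a d'" "M i d' c" using h(2,3) unfolding N_def by auto
    have "d = d'" by (rule assms(2)[OF d(1,3)])
    then show ?thesis using M(1)[rule_format, OF h(1)] d(2,4) by metis
  qed
  moreover have "b = c" if h: "i < n" "N i b a" "N i c a" for i a b c
  proof -
    obtain d d' where d: "G b d" "M i d a" "G c d'" "M i d' a" using h(2,3) unfolding N_def by auto
    have "d = d'" using M(1)[rule_format, OF h(1)] d(2,4) by metis
    then show ?thesis using assms(3) d(1,3) by metis
  qed
  moreover have "(\<exists>c. G a c \<and> Q c b) \<longleftrightarrow> (\<exists>i<n. N i a b)" for a b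
    unfolding N_def using M(2) by auto
  ultimately show ?thesis by (rule union_matchingsI)
qed

text \<open>A color that one of the \<open>n\<close> matchings leaves unmatched has fewer than \<open>n\<close> conflicts. This is how
  a vertex with parallel edges comes to have a spare color.\<close>

lemma union_matchings_first:
  assumes "union_matchings n Q" "0 < n"
  obtains F where "\<forall>a b c. F a b \<longrightarrow> F a c \<longrightarrow> b = c" "\<forall>a b c. F b a \<longrightarrow> F c a \<longrightarrow> b = c"
    "\<forall>a b. F a b \<longrightarrow> Q a b" "\<forall>a. (\<nexists>b. F a b) \<longrightarrow> card {b. Q a b} < n"
proof -
  obtain M where M: "\<forall>i<n. partial_matching (M i)"
    "\<forall>a b. Q a b \<longleftrightarrow> (\<exists>i<n. M i a b)"
    using assms(1) unfolding union_matchings_def by (elim exE conjE)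
  have "card {b. Q a b} < n" if no: "\<nexists>b. M 0 a b" for a
  proof -
    let ?Q = "\<lambda>a' b. a' = a \<and> Q a b"
    have "(\<exists>i<n. M i a b) \<longleftrightarrow> (\<exists>i<n - 1. M (Suc i) a b)" for b
    proof
      assume "\<exists>i<n. M i a b"
      then obtain i where i: "i < n" "M i a b" by blast
      then have "i \<noteq> 0" using no by metis
      then show "\<exists>i<n - 1. M (Suc i) a b" using i by (intro exI[of _ "i - 1"]) auto
    next
      assume "\<exists>i<n - 1. M (Suc i) a b"
      then obtain i where i: "i < n - 1" "M (Suc i) a b" by blast
      then show "\<exists>i<n. M i a b" by (intro exI[of _ "Suc i"]) auto
    qed
    then have ex: "?Q a' b \<longleftrightarrow> (\<exists>i<n - 1. a' = a \<and> M (Suc i) a b)" for a' b using M(2) by auto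
    have "union_matchings (n - 1) ?Q" unfolding union_matchings_def
    proof (intro exI[of _ "\<lambda>i a' b. a' = a \<and> M (Suc i) a b"] conjI allI impI)
      fix i b c d assume "i < n - 1"
      then have "Suc i < n" by simp
      note inj = M(1)[rule_format, OF this]
      show "c = d" if "(b = a \<and> M (Suc i) a c) \<and> b = a \<and> M (Suc i) a d" using that inj by metis
      show "c = d" if "(c = a \<and> M (Suc i) a b) \<and> d = a \<and> M (Suc i) a b" using that by simp
    qed (rule ex)
    from union_matchings_card(2)[OF this, of a] show ?thesis using assms(2) by simp
  qed
  then have "\<forall>a. (\<nexists>b. M 0 a b) \<longrightarrow> card {b. Q a b} < n" by simp
  then show thesis using M assms(2) by (intro that[of "M 0"]) auto
qed

text \<open>Serves to identify the colors of two adjacent vertices, as far as their numbers permit, in a way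
  that contains all conflicts between them.\<close>

lemma extend_partial_matching:
  assumes "finite A" "finite A'" "\<And>a b. E a b \<Longrightarrow> a \<in> A \<and> b \<in> A'"
    "\<And>a b c. E a b \<Longrightarrow> E a c \<Longrightarrow> b = c" "\<And>a b c. E b a \<Longrightarrow> E c a \<Longrightarrow> b = c"
  obtains C \<pi> where "C \<subseteq> A" "card C = min (card A) (card A')" "inj_on \<pi> C" "\<pi> ` C \<subseteq> A'"
    "\<And>a b. E a b \<Longrightarrow> a \<in> C \<and> \<pi> a = b"
proof -
  define X where "X = {a \<in> A. \<exists>b. E a b}"
  define f where "f a = (THE b. E a b)" for a
  have f: "f a = b" if "E a b" for a b unfolding f_def by (rule the_equality) (use that assms(4) in auto)
  have EX: "a \<in> X \<and> f a = b" if "E a b" for a b using that f assms(3) unfolding X_def by blast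
  have Ef: "E a (f a)" if "a \<in> X" for a using that f unfolding X_def by auto
  have inj: "inj_on f X" using Ef assms(5) unfolding inj_on_def by metis
  have fX: "f ` X \<subseteq> A'" "X \<subseteq> A" using Ef assms(3) unfolding X_def by auto
  have finX: "finite X" using fX(2) assms(1) finite_subset by blast
  have cX: "card (f ` X) = card X" by (rule card_image[OF inj])
  have le: "card X \<le> card A" "card X \<le> card A'"
    using card_mono[OF assms(1) fX(2)] card_mono[OF assms(2) fX(1)] cX by auto
  let ?n = "min (card A) (card A') - card X"
  have "card (A - X) = card A - card X" using card_Diff_subset[OF finX fX(2)] .
  then have "?n \<le> card (A - X)" by simp
  then obtain C where C: "C \<subseteq> A - X" "card C = ?n" "finite C" by (rule obtain_subset_with_card_n)
  have "card (A' - f ` X) = card A' - card X" using card_Diff_subset[OF finite_imageI[OF finX] fX(1)] cX by simp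
  then have "?n \<le> card (A' - f ` X)" by simp
  then obtain C' where C': "C' \<subseteq> A' - f ` X" "card C' = ?n" "finite C'" by (rule obtain_subset_with_card_n)
  obtain h where h: "bij_betw h C C'" using finite_same_card_bij[OF C(3) C'(3)] C(2) C'(2) by auto
  define \<pi> where "\<pi> a = (if a \<in> X then f a else h a)" for a
  have pX: "\<pi> a = f a" if "a \<in> X" for a using that by (simp add: \<pi>_def)
  have pC: "\<pi> a = h a" if "a \<in> C" for a using that C(1) by (auto simp: \<pi>_def)
  have imX: "\<pi> ` X = f ` X" using pX by simp
  have imC: "\<pi> ` C = C'" using pC h by (simp add: bij_betw_def)
  have "inj_on \<pi> X" using inj pX by (simp add: inj_on_def)
  moreover have "inj_on \<pi> C" using h pC by (simp add: inj_on_def bij_betw_def)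
  moreover have "f ` X \<inter> C' = {}" using C'(1) by blast
  ultimately have inj_all: "inj_on \<pi> (X \<union> C)"
    using imX imC by (simp add: inj_on_Un) blast
  have "card (X \<union> C) = card X + card C" using C finX by (intro card_Un_disjoint) auto
  then have card: "card (X \<union> C) = min (card A) (card A')" using C(2) le by simp
  have sub: "X \<union> C \<subseteq> A" using C(1) fX(2) by blast
  have im: "\<pi> ` (X \<union> C) \<subseteq> A'" using imX imC C'(1) fX(1) by (auto simp: image_Un)
  have ext: "a \<in> X \<union> C \<and> \<pi> a = b" if "E a b" for a b using EX[OF that] pX by auto
  show thesis by (rule that[OF sub card inj_all im ext])
qed

lemma conflict_cover_finite: "conflict_cover V m L R \<Longrightarrow> v \<in> V \<Longrightarrow> finite (L v)"
  and conflict_cover_sym: "conflict_cover V m L R \<Longrightarrow> R u a v b \<Longrightarrow> R v b u a"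
  and conflict_cover_matchings: "conflict_cover V m L R \<Longrightarrow> u \<in> V \<Longrightarrow> v \<in> V \<Longrightarrow> u \<noteq> v \<Longrightarrow>
    union_matchings (m u v) (\<lambda>a b. a \<in> L u \<and> b \<in> L v \<and> R u a v b)"
  unfolding conflict_cover_def by blast+

lemma conflict_cover_subset:
  assumes "conflict_cover V m L R" "T \<subseteq> V" "\<And>v. v \<in> T \<Longrightarrow> L' v \<subseteq> L v"
  shows "conflict_cover T m L' R"
  unfolding conflict_cover_def
proof (intro conjI ballI impI)
  show "finite (L' v)" if "v \<in> T" for v
    using finite_subset[OF assms(3)[OF that] conflict_cover_finite[OF assms(1) subsetD[OF assms(2) that]]] .
  show "\<forall>u a v b. R u a v b \<longrightarrow> R v b u a" using assms(1) unfolding conflict_cover_def by blast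
  show "union_matchings (m u v) (\<lambda>a b. a \<in> L' u \<and> b \<in> L' v \<and> R u a v b)"
    if "u \<in> T" "v \<in> T" "u \<noteq> v" for u v
  proof (rule union_matchings_mono[OF _ _ order_refl])
    show "union_matchings (m u v) (\<lambda>a b. a \<in> L u \<and> b \<in> L v \<and> R u a v b)"
      using conflict_cover_matchings[OF assms(1)] that assms(2) by blast
  qed (use assms(3)[OF that(1)] assms(3)[OF that(2)] in blast)
qed

lemma conflict_card:
  assumes "conflict_cover V m L R" "u \<in> V" "v \<in> V" "u \<noteq> v" "a \<in> L u"
  shows "card {b \<in> L v. R u a v b} \<le> m u v"
proof -
  have "{b \<in> L v. R u a v b} = {b. a \<in> L u \<and> b \<in> L v \<and> R u a v b}" using assms(5) by auto
  moreover have "card {b. a \<in> L u \<and> b \<in> L v \<and> R u a v b} \<le> m u v"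
    by (rule union_matchings_card(2)[OF conflict_cover_matchings[OF assms(1-4)]])
  ultimately show ?thesis by metis
qed

lemma no_conflict_if_nonadjacent:
  assumes "conflict_cover V m L R" "u \<in> V" "v \<in> V" "u \<noteq> v" "m u v = 0" "a \<in> L u" "b \<in> L v"
  shows "\<not> R u a v b"
proof
  assume "R u a v b"
  then have "b \<in> {b \<in> L v. R u a v b}" using assms by simp
  moreover have "finite {b \<in> L v. R u a v b}" using conflict_cover_finite[OF assms(1,3)] by simp
  ultimately have "0 < card {b \<in> L v. R u a v b}" using card_gt_0_iff by blast
  then show False using conflict_card[OF assms(1-4,6)] assms(5) by simp
qed

lemma residual_subset: "residual L R S \<phi> v \<subseteq> L v"
  by (auto simp: residual_def)

lemma residual_card_kills:
  assumes "conflict_cover V m L R" "S \<subseteq> V" "finite S" "v \<in> V"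
  shows "card (L v) \<le> card (residual L R S \<phi> v) + (\<Sum>u\<in>S. card {b \<in> L v. R u (\<phi> u) v b})"
proof -
  have fin: "finite (L v)" by (rule conflict_cover_finite[OF assms(1,4)])
  have "L v \<subseteq> residual L R S \<phi> v \<union> (\<Union>u\<in>S. {b \<in> L v. R u (\<phi> u) v b})"
    by (auto simp: residual_def)
  then have "card (L v) \<le> card (residual L R S \<phi> v \<union> (\<Union>u\<in>S. {b \<in> L v. R u (\<phi> u) v b}))"
    by (rule card_mono[rotated]) (use fin assms(3) in \<open>auto simp: residual_def\<close>)
  also have "\<dots> \<le> card (residual L R S \<phi> v) + card (\<Union>u\<in>S. {b \<in> L v. R u (\<phi> u) v b})"
    by (rule card_Un_le)
  also have "card (\<Union>u\<in>S. {b \<in> L v. R u (\<phi> u) v b}) \<le> (\<Sum>u\<in>S. card {b \<in> L v. R u (\<phi> u) v b})"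
    by (rule card_UN_le[OF assms(3)])
  finally show ?thesis by simp
qed

lemma residual_card:
  assumes "conflict_cover V m L R" "multiplicity m" "S \<subseteq> V" "finite S" "v \<in> V - S"
    "proper_coloring S L R \<phi>"
  shows "card (L v) \<le> card (residual L R S \<phi> v) + degree m S v"
proof -
  have "(\<Sum>u\<in>S. card {b \<in> L v. R u (\<phi> u) v b}) \<le> (\<Sum>u\<in>S. m v u)"
  proof (rule sum_mono)
    fix u assume u: "u \<in> S"
    have "card {b \<in> L v. R u (\<phi> u) v b} \<le> m u v"
      by (rule conflict_card[OF assms(1)]) (use u assms in \<open>auto simp: proper_coloring_def\<close>)
    then show "card {b \<in> L v. R u (\<phi> u) v b} \<le> m v u" using assms(2) by (simp add: multiplicity_def)
  qed
  moreover have "card (L v) \<le> card (residual L R S \<phi> v) + (\<Sum>u\<in>S. card {b \<in> L v. R u (\<phi> u) v b})"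
    by (rule residual_card_kills[OF assms(1,3,4)]) (use assms in auto)
  ultimately show ?thesis unfolding degree_def by linarith
qed

lemma extend_coloring:
  assumes "proper_coloring S L R \<phi>" "proper_coloring T (residual L R S \<phi>) R \<psi>" "S \<inter> T = {}"
    "conflict_cover V m L R"
  shows "proper_coloring (S \<union> T) L R (\<lambda>v. if v \<in> S then \<phi> v else \<psi> v)"
  unfolding proper_coloring_def
proof (intro conjI ballI impI)
  fix v assume "v \<in> S \<union> T"
  then show "(if v \<in> S then \<phi> v else \<psi> v) \<in> L v"
    using assms(1,2) unfolding proper_coloring_def residual_def by auto
next
  fix u v assume uv: "u \<in> S \<union> T" "v \<in> S \<union> T" "u \<noteq> v"
  have ST: "\<not> R x (\<phi> x) y (\<psi> y)" if "x \<in> S" "y \<in> T" for x y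
    using assms(2) that unfolding proper_coloring_def residual_def by auto
  then have TS: "\<not> R y (\<psi> y) x (\<phi> x)" if "x \<in> S" "y \<in> T" for x y
    using that conflict_cover_sym[OF assms(4)] by blast
  show "\<not> R u (if u \<in> S then \<phi> u else \<psi> u) v (if v \<in> S then \<phi> v else \<psi> v)"
    using uv assms(1,2) ST TS unfolding proper_coloring_def by auto
qed

lemma residual_uncolorable:
  assumes "conflict_cover V m L R" "S \<subseteq> V" "proper_coloring S L R \<phi>" "\<nexists>\<phi>. proper_coloring V L R \<phi>"
  shows "\<nexists>\<psi>. proper_coloring (V - S) (residual L R S \<phi>) R \<psi>"
proof
  assume "\<exists>\<psi>. proper_coloring (V - S) (residual L R S \<phi>) R \<psi>"
  then obtain \<psi> where "proper_coloring (V - S) (residual L R S \<phi>) R \<psi>" ..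
  from extend_coloring[OF assms(3) this _ assms(1)] have "\<exists>\<phi>. proper_coloring (S \<union> (V - S)) L R \<phi>" by blast
  moreover have "S \<union> (V - S) = V" using assms(2) by blast
  ultimately show False using assms(4) by simp
qed

lemma degree_mono: "finite T \<Longrightarrow> S \<subseteq> T \<Longrightarrow> degree m S v \<le> degree m T v"
  unfolding degree_def by (rule sum_mono2) auto

lemma degree_Un: "finite S \<Longrightarrow> finite T \<Longrightarrow> S \<inter> T = {} \<Longrightarrow>
    degree m (S \<union> T) v = degree m S v + degree m T v"
  unfolding degree_def by (rule sum.union_disjoint)

lemma degree_Diff: "finite T \<Longrightarrow> S \<subseteq> T \<Longrightarrow>
    degree m T v = degree m S v + degree m (T - S) v"
  using degree_Un[of S "T - S" m v] by (simp add: Un_absorb1 finite_subset)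

lemma degree_remove: "finite T \<Longrightarrow> u \<in> T \<Longrightarrow> degree m T v = m v u + degree m (T - {u}) v"
  using degree_Diff[of T "{u}" m v] by (simp add: degree_def)

text \<open>Color last a vertex \<open>v\<close> that witnesses the assumption for the whole set.\<close>

lemma greedy_coloring:
  assumes "finite B" "conflict_cover B m L R" "multiplicity m"
    "\<And>X. X \<subseteq> B \<Longrightarrow> X \<noteq> {} \<Longrightarrow> \<exists>v\<in>X. degree m X v < card (L v)"
  shows "\<exists>\<phi>. proper_coloring B L R \<phi>"
  using assms
proof (induction "card B" arbitrary: B)
  case 0
  then show ?case by (auto simp: proper_coloring_def)
next
  case (Suc n)
  have "B \<noteq> {}" using Suc.hyps(2) by auto
  then obtain v where v: "v \<in> B" "degree m B v < card (L v)" using Suc.prems(4)[of B] by auto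
  let ?S = "B - {v}"
  have "\<exists>\<phi>. proper_coloring ?S L R \<phi>"
  proof (rule Suc.hyps(1))
    show "n = card ?S" using Suc.hyps(2) Suc.prems(1) v by simp
    show "conflict_cover ?S m L R" by (rule conflict_cover_subset[OF Suc.prems(2)]) auto
  qed (use Suc.prems in auto)
  then obtain \<phi> where \<phi>: "proper_coloring ?S L R \<phi>" by blast
  have "card (L v) \<le> card (residual L R ?S \<phi> v) + degree m ?S v"
    by (rule residual_card[OF Suc.prems(2,3)]) (use Suc.prems v \<phi> in auto)
  moreover have "degree m ?S v \<le> degree m B v" using Suc.prems(1) by (intro degree_mono) auto
  ultimately have "card (residual L R ?S \<phi> v) \<noteq> 0" using v by linarith
  then obtain a where a: "a \<in> residual L R ?S \<phi> v" by fastforce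
  have "proper_coloring {v} (residual L R ?S \<phi>) R (\<lambda>_. a)" using a by (simp add: proper_coloring_def)
  from extend_coloring[OF \<phi> this _ Suc.prems(2)] show ?case using v by (auto simp: insert_absorb)
qed

section \<open>Critical pairs\<close>

lemma critical_proper:
  assumes "critical V m l" "V' \<subseteq> V" "multiplicity m'" "\<forall>u v. m' u v \<le> m u v"
    "V' \<noteq> V \<or> (\<exists>u\<in>V. \<exists>v\<in>V. m' u v \<noteq> m u v)"
  shows "\<not> uncolorable V' m' l"
proof -
  have "\<forall>V' m'. V' \<subseteq> V \<and> multiplicity m' \<and> (\<forall>u v. m' u v \<le> m u v) \<and>
        (V' \<noteq> V \<or> (\<exists>u\<in>V. \<exists>v\<in>V. m' u v \<noteq> m u v)) \<longrightarrow> \<not> uncolorable V' m' l"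
    using assms(1) unfolding critical_def by (rule conjunct2)
  from this[rule_format, of V' m'] show ?thesis using assms(2-5) by argo
qed

lemma critical_degree:
  assumes "finite V" "multiplicity m" "critical V m l" "v \<in> V"
  shows "l v \<le> degree m V v"
proof (rule ccontr)
  assume lt: "\<not> l v \<le> degree m V v"
  have "uncolorable V m l" using assms(3) by (simp add: critical_def)
  then obtain L R where LR: "conflict_cover V m L R" "\<forall>v\<in>V. card (L v) = l v" "\<nexists>\<phi>. proper_coloring V L R \<phi>"
    unfolding uncolorable_def by (elim exE conjE)
  let ?S = "V - {v}"
  have S: "?S \<subseteq> V" "?S \<noteq> V" "finite ?S" "v \<in> V - ?S" using assms by auto
  have "\<not> uncolorable ?S m l" by (rule critical_proper[OF assms(3) S(1) assms(2)]) (use S in auto)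
  moreover have "conflict_cover ?S m L R" by (rule conflict_cover_subset[OF LR(1) S(1)]) simp
  moreover have "\<forall>v\<in>?S. card (L v) = l v" using LR(2) by simp
  ultimately obtain \<phi> where \<phi>: "proper_coloring ?S L R \<phi>" unfolding uncolorable_def by blast
  have "card (L v) \<le> card (residual L R ?S \<phi> v) + degree m ?S v"
    by (rule residual_card[OF LR(1) assms(2) S(1,3,4) \<phi>])
  moreover have "degree m ?S v \<le> degree m V v" by (rule degree_mono[OF assms(1) S(1)])
  ultimately have "card (residual L R ?S \<phi> v) \<noteq> 0" using lt LR(2) assms(4) by simp
  then obtain a where a: "a \<in> residual L R ?S \<phi> v" by fastforce
  have "proper_coloring {v} (residual L R ?S \<phi>) R (\<lambda>_. a)" using a by (simp add: proper_coloring_def)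
  moreover have "{v} = V - ?S" using assms(4) by blast
  ultimately show False using residual_uncolorable[OF LR(1) S(1) \<phi> LR(3)] by metis
qed

lemma uncolorable_trim:
  assumes "conflict_cover T m' L R" "\<And>v. v \<in> T \<Longrightarrow> l' v \<le> card (L v)" "\<nexists>\<phi>. proper_coloring T L R \<phi>"
  shows "uncolorable T m' l'"
proof -
  have "\<exists>A. A \<subseteq> L v \<and> card A = l' v" if "v \<in> T" for v
    using obtain_subset_with_card_n[OF assms(2)[OF that]] by metis
  then obtain A where A: "\<And>v. v \<in> T \<Longrightarrow> A v \<subseteq> L v \<and> card (A v) = l' v" by metis
  have "conflict_cover T m' A R" by (rule conflict_cover_subset[OF assms(1)]) (use A in auto)
  moreover have "\<not> proper_coloring T A R \<phi>" for \<phi>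
  proof
    assume "proper_coloring T A R \<phi>"
    then have "proper_coloring T L R \<phi>" using A unfolding proper_coloring_def by blast
    then show False using assms(3) by blast
  qed
  ultimately show ?thesis using A unfolding uncolorable_def by blast
qed

lemma uncolorable_cong:
  assumes "uncolorable V m l" "\<And>u v. u \<in> V \<Longrightarrow> v \<in> V \<Longrightarrow> m u v = m' u v"
  shows "uncolorable V m' l"
proof -
  obtain L R where LR: "conflict_cover V m L R" "\<forall>v\<in>V. card (L v) = l v" "\<nexists>\<phi>. proper_coloring V L R \<phi>"
    using assms(1) unfolding uncolorable_def by (elim exE conjE)
  have "conflict_cover V m' L R" using LR(1) assms(2) unfolding conflict_cover_def by simp
  then show ?thesis using LR unfolding uncolorable_def by blast
qed

lemma uncolorable_contains_critical:
  assumes "finite V" "multiplicity m" "uncolorable V m l"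
  shows "\<exists>W m'. W \<subseteq> V \<and> multiplicity m' \<and> (\<forall>u v. m' u v \<le> m u v) \<and> critical W m' l"
  using assms
proof (induction "card V + (\<Sum>u\<in>V. \<Sum>v\<in>V. m u v)" arbitrary: V m rule: less_induct)
  case less
  show ?case
  proof (cases "critical V m l")
    case True then show ?thesis using less.prems by blast
  next
    case False
    have "\<exists>V' m'. (V' \<subseteq> V \<and> multiplicity m' \<and> (\<forall>u v. m' u v \<le> m u v) \<and>
        (V' \<noteq> V \<or> (\<exists>u\<in>V. \<exists>v\<in>V. m' u v \<noteq> m u v))) \<and> uncolorable V' m' l"
    proof (rule ccontr)
      assume "\<not> ?thesis"
      then show False using False less.prems(3) unfolding critical_def by (simp only: not_ex de_Morgan_conj) blast
    qed
    then obtain V' m' where V': "V' \<subseteq> V" "multiplicity m'" "\<forall>u v. m' u v \<le> m u v"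
      "V' \<noteq> V \<or> (\<exists>u\<in>V. \<exists>v\<in>V. m' u v \<noteq> m u v)" "uncolorable V' m' l"
      by (elim exE conjE)
    have fin: "finite V'" using V'(1) less.prems(1) finite_subset by blast
    have le1: "(\<Sum>u\<in>V'. \<Sum>v\<in>V'. m' u v) \<le> (\<Sum>u\<in>V. \<Sum>v\<in>V. m' u v)"
    proof -
      have "(\<Sum>u\<in>V'. \<Sum>v\<in>V'. m' u v) \<le> (\<Sum>u\<in>V'. \<Sum>v\<in>V. m' u v)"
        by (intro sum_mono sum_mono2) (use V' less.prems in auto)
      also have "\<dots> \<le> (\<Sum>u\<in>V. \<Sum>v\<in>V. m' u v)"
        by (intro sum_mono2) (use V' less.prems in auto)
      finally show ?thesis .
    qed
    have le2: "(\<Sum>u\<in>V. \<Sum>v\<in>V. m' u v) \<le> (\<Sum>u\<in>V. \<Sum>v\<in>V. m u v)"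
      by (intro sum_mono) (use V'(3) in auto)
    have "card V' + (\<Sum>u\<in>V'. \<Sum>v\<in>V'. m' u v) < card V + (\<Sum>u\<in>V. \<Sum>v\<in>V. m u v)"
    proof (cases "V' = V")
      case False
      then have "card V' < card V" using V'(1) less.prems(1) psubset_card_mono by blast
      then show ?thesis using le1 le2 by linarith
    next
      case True
      then obtain u v where uv: "u \<in> V" "v \<in> V" "m' u v < m u v" using V'(3,4) le_neq_implies_less by blast
      have "(\<Sum>v\<in>V. m' u v) < (\<Sum>v\<in>V. m u v)"
        by (rule sum_strict_mono_ex1) (use uv V'(3) less.prems(1) in auto)
      then have "(\<Sum>u\<in>V. \<Sum>v\<in>V. m' u v) < (\<Sum>u\<in>V. \<Sum>v\<in>V. m u v)"
        by (intro sum_strict_mono_ex1) (use uv V'(3) less.prems(1) in \<open>auto intro: sum_mono\<close>)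
      then show ?thesis using True by simp
    qed
    from less.hyps[OF this fin V'(2,5)] obtain W m'' where W:
      "W \<subseteq> V'" "multiplicity m''" "\<forall>u v. m'' u v \<le> m' u v" "critical W m'' l" by (elim exE conjE)
    have "m'' u v \<le> m u v" for u v using W(3) V'(3) order_trans by blast
    then show ?thesis using W V'(1) by (intro exI[of _ W] exI[of _ m'']) auto
  qed
qed

text \<open>Let equal colors be in conflict. Then a coloring is an injection into \<open>kap\<close> colors.\<close>

lemma uncolorable_clique:
  assumes "finite W" "card W = kap + 1" "\<And>v. v \<in> W \<Longrightarrow> l v \<le> kap"
  shows "uncolorable W (\<lambda>u v. if u \<in> W \<and> v \<in> W \<and> u \<noteq> v then 1 else 0) l"
proof -
  let ?m = "\<lambda>u v. if u \<in> W \<and> v \<in> W \<and> u \<noteq> v then 1 else (0::nat)"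
  define L where "L v = {..<l v}" for v
  define R where "R u a v b \<longleftrightarrow> u \<noteq> v \<and> a = b" for u v :: 'a and a b :: nat
  have "conflict_cover W ?m L R" unfolding conflict_cover_def
  proof (intro conjI ballI impI)
    fix u v assume "u \<in> W" "v \<in> W" "u \<noteq> v"
    then show "union_matchings (?m u v) (\<lambda>a b. a \<in> L u \<and> b \<in> L v \<and> R u a v b)"
      unfolding union_matchings_def R_def
      by (intro exI[of _ "\<lambda>i a b. a \<in> L u \<and> b \<in> L v \<and> a = b"]) auto
  qed (auto simp: L_def R_def)
  moreover have "\<not> proper_coloring W L R \<phi>" for \<phi>
  proof
    assume p: "proper_coloring W L R \<phi>"
    then have "inj_on \<phi> W" unfolding proper_coloring_def R_def inj_on_def by blast
    then have "card W = card (\<phi> ` W)" by (simp add: card_image)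
    also have "\<phi> ` W \<subseteq> {..<kap}"
      using p assms(3) unfolding proper_coloring_def L_def by (fastforce dest: less_le_trans)
    then have "card (\<phi> ` W) \<le> kap" using card_mono[of "{..<kap}" "\<phi> ` W"] by simp
    finally show False using assms(2) by simp
  qed
  ultimately show ?thesis unfolding uncolorable_def L_def by (intro exI[of _ "\<lambda>v. {..<l v}"] exI[of _ R]) auto
qed

section \<open>Connectivity and forks\<close>

text \<open>Connectedness of the graph induced on \<open>B\<close>, stated through cuts rather than paths, because cuts
  are what greedy coloring needs.\<close>

definition linked :: "('v \<Rightarrow> 'v \<Rightarrow> nat) \<Rightarrow> 'v set \<Rightarrow> bool" where
  "linked m B \<longleftrightarrow> (\<forall>X\<subseteq>B. X \<noteq> {} \<and> X \<noteq> B \<longrightarrow> (\<exists>u\<in>X. \<exists>v\<in>B - X. 0 < m u v))"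

text \<open>A greedy coloring that ends at \<open>r\<close>: any other nonempty part \<open>X\<close> of \<open>B\<close> contains a vertex with an
  edge that leaves \<open>X\<close>, and this edge accounts for a spare color.\<close>

lemma linked_coloring:
  assumes "finite B" "conflict_cover B m L R" "multiplicity m" "linked m B"
    "\<And>v. v \<in> B \<Longrightarrow> degree m B v \<le> card (L v)" "r \<in> B" "degree m B r < card (L r)"
  shows "\<exists>\<phi>. proper_coloring B L R \<phi>"
proof (rule greedy_coloring[OF assms(1-3)])
  fix X assume X: "X \<subseteq> B" "X \<noteq> {}"
  show "\<exists>v\<in>X. degree m X v < card (L v)"
  proof (cases "X = B")
    case True then show ?thesis using assms(6,7) by blast
  next
    case False
    then obtain u v where uv: "u \<in> X" "v \<in> B - X" "0 < m u v" using assms(4) X unfolding linked_def by meson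
    have "degree m (insert v X) u \<le> degree m B u"
      using uv X assms(1) by (intro degree_mono) auto
    moreover have "degree m (insert v X) u = m u v + degree m X u"
      using uv X finite_subset[OF X(1) assms(1)] by (subst degree_remove[of _ v]) auto
    ultimately have "degree m X u < card (L u)" using uv X assms(5)[of u] by (auto simp: subset_iff)
    then show ?thesis using uv by blast
  qed
qed

lemma linkedD:
  assumes "linked m B" "X \<subseteq> B" "X \<noteq> {}" "X \<noteq> B"
  obtains u v where "u \<in> X" "v \<in> B - X" "0 < m u v"
proof -
  have "\<exists>u\<in>X. \<exists>v\<in>B - X. 0 < m u v" using assms unfolding linked_def by simp
  then show thesis using that by blast
qed

lemma not_linkedE:
  assumes "\<not> linked m S"
  obtains Z where "Z \<subseteq> S" "Z \<noteq> {}" "Z \<noteq> S" "\<forall>a\<in>Z. \<forall>b\<in>S - Z. m a b = 0"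
proof -
  have "\<exists>Z. Z \<subseteq> S \<and> (Z \<noteq> {} \<and> Z \<noteq> S) \<and> \<not> (\<exists>u\<in>Z. \<exists>v\<in>S - Z. 0 < m u v)"
    using assms unfolding linked_def not_all not_imp .
  then obtain Z where "Z \<subseteq> S" "Z \<noteq> {}" "Z \<noteq> S" "\<not> (\<exists>u\<in>Z. \<exists>v\<in>S - Z. 0 < m u v)"
    by (elim exE conjE)
  then show thesis using that[of Z] by simp
qed

lemma linked_insert:
  assumes "multiplicity m" "linked m S" "y \<in> S" "0 < m x y"
  shows "linked m (insert x S)"
  unfolding linked_def
proof (intro allI impI)
  fix X assume X: "X \<subseteq> insert x S" "X \<noteq> {} \<and> X \<noteq> insert x S"
  have yx: "0 < m y x" using assms(1,4) by (simp add: multiplicity_def)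
  show "\<exists>u\<in>X. \<exists>v\<in>insert x S - X. 0 < m u v"
  proof (cases "X - {x} = {} \<or> X - {x} = S - {x}")
    case True
    then show ?thesis
    proof
      assume "X - {x} = {}"
      then have "X = {x}" using X by auto
      then show ?thesis using assms X by (cases "x = y") (auto simp: multiplicity_def)
    next
      assume e: "X - {x} = S - {x}"
      then have "x \<notin> X" using X by auto
      then have "y \<in> X" "x \<in> insert x S - X" using e assms by (auto simp: multiplicity_def)
      then show ?thesis using yx by blast
    qed
  next
    case False
    show ?thesis
    proof (cases "x \<in> S")
      case True
      then show ?thesis using X assms(2) unfolding linked_def by (simp add: insert_absorb)
    next
      case xS: False
      then have "X - {x} \<subseteq> S" "X - {x} \<noteq> {}" "X - {x} \<noteq> S" using False X by auto
      then obtain u v where "u \<in> X - {x}" "v \<in> S - (X - {x})" "0 < m u v"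
        by (rule linkedD[OF assms(2)])
      then show ?thesis using xS by (intro bexI[of _ u] bexI[of _ v]) auto
    qed
  qed
qed

text \<open>A single vertex and a pair of adjacent vertices count as biconnected, so that leaf blocks of
  these sizes are covered as well.\<close>

definition biconnected :: "('v \<Rightarrow> 'v \<Rightarrow> nat) \<Rightarrow> 'v set \<Rightarrow> bool" where
  "biconnected m B \<longleftrightarrow> linked m B \<and> (\<forall>v\<in>B. linked m (B - {v}))"

lemma complete_linked:
  assumes "\<And>u v. u \<in> B \<Longrightarrow> v \<in> B \<Longrightarrow> u \<noteq> v \<Longrightarrow> 0 < m u v"
  shows "linked m B"
  unfolding linked_def
proof (intro allI impI)
  fix X assume X: "X \<subseteq> B" "X \<noteq> {} \<and> X \<noteq> B"
  then obtain u v where uv: "u \<in> X" "v \<in> B - X" by blast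
  have "0 < m u v" by (rule assms) (use uv X(1) in auto)
  then show "\<exists>u\<in>X. \<exists>v\<in>B - X. 0 < m u v" using uv by blast
qed

text \<open>\<open>K\<close> is a union of components of \<open>B - {x, y}\<close>, but not of all of them. Complements of such sets
  are of the same kind, which would fail for single components.\<close>

definition cut_off :: "('v \<Rightarrow> 'v \<Rightarrow> nat) \<Rightarrow> 'v set \<Rightarrow> 'v \<Rightarrow> 'v \<Rightarrow> 'v set \<Rightarrow> bool" where
  "cut_off m B x y K \<longleftrightarrow> y \<in> B - {x} \<and> K \<subseteq> B - {x, y} \<and> K \<noteq> {} \<and> K \<noteq> B - {x, y} \<and>
     (\<forall>u\<in>K. \<forall>v\<in>B - {x, y} - K. m u v = 0)"

lemma not_linked_cut_off:
  assumes "y \<in> B" "y \<noteq> x" "\<not> linked m (B - {x, y})"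
  shows "\<exists>K. cut_off m B x y K"
proof -
  obtain Z where "Z \<subseteq> B - {x, y}" "Z \<noteq> {}" "Z \<noteq> B - {x, y}"
    "\<forall>a\<in>Z. \<forall>b\<in>B - {x, y} - Z. m a b = 0"
    by (rule not_linkedE[OF assms(3)])
  then show ?thesis using assms(1,2) unfolding cut_off_def by (intro exI[of _ Z]) simp
qed

lemma cut_off_complement:
  assumes "multiplicity m" "cut_off m B x y K"
  shows "cut_off m B x y (B - {x, y} - K)"
proof -
  have sym: "m a b = m b a" for a b using assms(1) by (simp add: multiplicity_def)
  have K: "K \<subseteq> B - {x, y}" "K \<noteq> {}" "K \<noteq> B - {x, y}" "y \<in> B - {x}"
    "\<And>a b. a \<in> K \<Longrightarrow> b \<in> B - {x, y} - K \<Longrightarrow> m a b = 0"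
    using assms(2) unfolding cut_off_def by blast+
  have "m a b = 0" if "a \<in> B - {x, y} - K" "b \<in> B - {x, y} - (B - {x, y} - K)" for a b
    using K(5)[of b a] that sym[of a b] by auto
  moreover have "B - {x, y} - K \<noteq> {}" "B - {x, y} - K \<noteq> B - {x, y}" using K(1-3) by auto
  ultimately show ?thesis using K(4) unfolding cut_off_def by blast
qed

text \<open>If \<open>u\<close> disconnected \<open>B - {x}\<close>, consider a side of this separation that avoids \<open>y\<close>. Either it
  meets \<open>K\<close> in a smaller set that \<open>x\<close> and \<open>u\<close> cut off, or \<open>x\<close> alone separates it from the rest
  of \<open>B\<close>.\<close>

lemma minimal_cut_off_linked:
  assumes "multiplicity m" "biconnected m B" "x \<in> B" "cut_off m B x y K"
    and min: "\<And>z Z. cut_off m B x z Z \<Longrightarrow> \<not> Z \<subset> K" and "u \<in> K"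
  shows "linked m (B - {x, u})"
proof (rule ccontr)
  assume nl: "\<not> linked m (B - {x, u})"
  have sym: "m a b = m b a" for a b using assms(1) by (simp add: multiplicity_def)
  have K: "K \<subseteq> B - {x, y}" "y \<in> B - {x}" "\<And>a b. a \<in> K \<Longrightarrow> b \<in> B - {x, y} - K \<Longrightarrow> m a b = 0"
    using assms(4) unfolding cut_off_def by blast+
  have u: "u \<in> B" "u \<noteq> x" "u \<noteq> y" using assms(6) K by auto
  obtain Z0 where Z0: "cut_off m B x u Z0" using not_linked_cut_off[OF u(1,2) nl] by blast
  obtain Z where Z: "cut_off m B x u Z" "y \<notin> Z"
    using Z0 cut_off_complement[OF assms(1) Z0] by blast
  have Zc: "\<And>a b. a \<in> Z \<Longrightarrow> b \<in> B - {x, u} - Z \<Longrightarrow> m a b = 0" "Z \<subseteq> B - {x, u}" "Z \<noteq> {}"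
    using Z unfolding cut_off_def by blast+
  show False
  proof (cases "Z \<inter> K = {}")
    case True
    have "linked m (B - {x})" using assms(2,3) unfolding biconnected_def by blast
    then obtain a b where ab: "a \<in> Z" "b \<in> B - {x} - Z" "0 < m a b"
      using linkedD[of m "B - {x}" Z] Zc u by blast
    have "b = u" using ab Zc(1)[of a b] by auto
    moreover have "a \<in> B - {x, y} - K" using ab Zc(2) Z(2) True by auto
    ultimately show False using K(3)[OF assms(6), of a] sym[of a u] ab by simp
  next
    case False
    have "cut_off m B x u (Z \<inter> K)" unfolding cut_off_def
    proof (intro conjI ballI)
      fix a b assume a: "a \<in> Z \<inter> K" and b: "b \<in> B - {x, u} - Z \<inter> K"
      show "m a b = 0"
      proof (cases "b \<in> Z")
        case True
        then have "b \<in> B - {x, y} - K" using b Z(2) by auto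
        then show ?thesis using K(3) a by blast
      next
        case False then show ?thesis using Zc(1) a b by auto
      qed
    next
      show "Z \<inter> K \<noteq> B - {x, u}" using K u Z(2) by auto
    qed (use u Zc False in auto)
    moreover have "Z \<inter> K \<subset> K" using assms(6) Zc(2) by auto
    ultimately show False using min by blast
  qed
qed

lemma cut_off_neighbor:
  assumes "multiplicity m" "biconnected m B" "x \<in> B" "cut_off m B x y K"
  obtains u where "u \<in> K" "0 < m x u"
proof -
  have "linked m (B - {y})" using assms unfolding biconnected_def cut_off_def by blast
  moreover have "K \<subseteq> B - {y}" "K \<noteq> {}" "x \<in> B - {y}" "x \<notin> K" using assms(3,4) unfolding cut_off_def by auto
  ultimately obtain u v where uv: "u \<in> K" "v \<in> B - {y} - K" "0 < m u v"
    using linkedD[of m "B - {y}" K] by blast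
  have "v = x" using uv assms(4) unfolding cut_off_def by auto
  then have "0 < m x u" using uv(3) assms(1) by (simp add: multiplicity_def)
  then show thesis using that uv(1) by blast
qed

text \<open>Choose two disjoint sets that \<open>x\<close> cuts off together with suitable second vertices, both minimal
  under inclusion. They play the role of two end blocks of \<open>B - {x}\<close>: each contains a neighbor
  of \<open>x\<close>, and deleting both neighbors leaves \<open>B - {x}\<close> connected.\<close>

lemma separating_pair_neighbors:
  assumes "finite B" "multiplicity m" "biconnected m B" "x \<in> B" "y \<in> B" "y \<noteq> x" "\<not> linked m (B - {x, y})"
  obtains u w z where "u \<in> B" "w \<in> B" "u \<noteq> w" "m u w = 0" "0 < m x u" "0 < m x w"
    "z \<in> B" "z \<noteq> x" "z \<noteq> u" "z \<noteq> w" "linked m (B - {x, u, w})"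
proof -
  have sym: "m a b = m b a" for a b using assms(2) by (simp add: multiplicity_def)
  have ex_min: "\<exists>z K. cut_off m B x z K \<and> K \<subseteq> N \<and> (\<forall>z' K'. cut_off m B x z' K' \<longrightarrow> \<not> K' \<subset> K)"
    if "cut_off m B x z0 N" for z0 N
  proof -
    let ?F = "{K. K \<subseteq> N \<and> (\<exists>z. cut_off m B x z K)}"
    have "N \<subseteq> B" using that unfolding cut_off_def by auto
    then have "finite N" using assms(1) finite_subset by blast
    then have "finite ?F" by simp
    moreover have "?F \<noteq> {}" using that by blast
    ultimately have "\<exists>K\<in>?F. \<forall>K'\<in>?F. K' \<subseteq> K \<longrightarrow> K = K'" by (rule finite_has_minimal)
    then obtain K where K: "K \<in> ?F" "\<forall>K'\<in>?F. K' \<subseteq> K \<longrightarrow> K = K'" by (rule bexE)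
    obtain z where z: "cut_off m B x z K" "K \<subseteq> N" using K(1) by auto
    have "\<not> K' \<subset> K" if K': "cut_off m B x z' K'" for z' K'
    proof
      assume lt: "K' \<subset> K"
      then have "K' \<in> ?F" using K' z(2) by auto
      then have "K = K'" using K(2) lt by (meson psubset_imp_subset)
      then show False using lt by simp
    qed
    then show ?thesis using z by (intro exI[of _ z] exI[of _ K]) simp
  qed
  obtain N where "cut_off m B x y N" using not_linked_cut_off[OF assms(5,6,7)] by blast
  then obtain x1 K1 where K1: "cut_off m B x x1 K1" and min1: "\<And>z K. cut_off m B x z K \<Longrightarrow> \<not> K \<subset> K1"
    using ex_min[of y N] by blast
  let ?M = "B - {x, x1} - K1"
  have "cut_off m B x x1 ?M" by (rule cut_off_complement[OF assms(2) K1])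
  then obtain x2 K2 where K2: "cut_off m B x x2 K2" "K2 \<subseteq> ?M"
    and min2: "\<And>z K. cut_off m B x z K \<Longrightarrow> \<not> K \<subset> K2"
    using ex_min[of x1 ?M] by blast
  obtain u where u: "u \<in> K1" "0 < m x u" using cut_off_neighbor[OF assms(2-4) K1] .
  obtain w where w: "w \<in> K2" "0 < m x w" using cut_off_neighbor[OF assms(2-4) K2(1)] .
  have lw: "linked m (B - {x, w})" by (rule minimal_cut_off_linked[OF assms(2-4) K2(1) min2 w(1)])
  have K1': "K1 \<subseteq> B - {x, x1}" "x1 \<in> B - {x}" "\<And>a b. a \<in> K1 \<Longrightarrow> b \<in> ?M \<Longrightarrow> m a b = 0"
    using K1 unfolding cut_off_def by blast+
  have wM: "w \<in> ?M" using w K2 by blast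
  have uw: "m u w = 0" using K1'(3) u wM by blast
  have "linked m (B - {x, u, w})"
  proof (rule ccontr)
    assume "\<not> linked m (B - {x, u, w})"
    then obtain Z0 where Z0: "Z0 \<subseteq> B - {x, u, w}" "Z0 \<noteq> {}" "Z0 \<noteq> B - {x, u, w}"
      and Z0_closed: "\<forall>a\<in>Z0. \<forall>b\<in>B - {x, u, w} - Z0. m a b = 0"
      by (rule not_linkedE)
    have Z0_no_edge: "m a b = 0" if "a \<in> Z0" "b \<in> B - {x, u, w} - Z0" for a b
      using Z0_closed that by blast
    obtain Z where Z: "Z \<subseteq> B - {x, u, w}" "Z \<noteq> {}" "x1 \<notin> Z"
      "\<And>a b. a \<in> Z \<Longrightarrow> b \<in> B - {x, u, w} - Z \<Longrightarrow> m a b = 0"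
    proof (cases "x1 \<in> Z0")
      case True
      show thesis
      proof (rule that[of "B - {x, u, w} - Z0"])
        fix a b assume "a \<in> B - {x, u, w} - Z0" "b \<in> B - {x, u, w} - (B - {x, u, w} - Z0)"
        then show "m a b = 0" using Z0_no_edge[of b a] sym[of a b] by auto
      qed (use Z0 True in auto)
    next
      case False
      show thesis by (rule that[OF Z0(1,2) False Z0_no_edge])
    qed
    have "u \<in> B - {x, w} - Z" using K1' u wM Z(1) by auto
    then have ZB: "Z \<subseteq> B - {x, w}" "Z \<noteq> B - {x, w}" using Z(1) by auto
    obtain a b where ab: "a \<in> Z" "b \<in> B - {x, w} - Z" "0 < m a b"
      using linkedD[OF lw ZB(1) Z(2) ZB(2)] .
    have "b = u" using ab Z(4)[of a b] by auto
    then have au: "0 < m u a" using ab sym by metis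
    have "a \<in> K1" using K1'(3)[OF u(1), of a] au ab(1) Z(1,3) by auto
    then have ne: "Z \<inter> K1 \<noteq> {}" using ab by blast
    have "cut_off m B x u (Z \<inter> K1)" unfolding cut_off_def
    proof (intro conjI ballI)
      fix c d assume c: "c \<in> Z \<inter> K1" and d: "d \<in> B - {x, u} - Z \<inter> K1"
      show "m c d = 0"
      proof (cases "d \<in> Z \<or> d = w")
        case True
        then have "d \<in> ?M" using d Z(3) wM by auto
        then show ?thesis using K1'(3) c by blast
      next
        case False then show ?thesis using Z(4) c d by auto
      qed
    next
      show "Z \<inter> K1 \<noteq> B - {x, u}" using K1' u Z(3) by auto
    qed (use u K1' ne Z in auto)
    moreover have "Z \<inter> K1 \<subset> K1" using u Z(1) by auto
    ultimately show False using min1 by blast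
  qed
  moreover have "u \<in> B" "w \<in> B" "u \<noteq> w" "x1 \<in> B" "x1 \<noteq> x" "x1 \<noteq> u" "x1 \<noteq> w"
    using K1'(1,2) u(1) wM by auto
  ultimately show thesis using that[of u w x1] u(2) w(2) uw by simp
qed

text \<open>The graph part of Brooks' theorem. If no two vertices separate \<open>B\<close>, then the ends of any induced
  path on three vertices violate the assumption. If \<open>x\<close> belongs to a separating pair and has a
  third neighbor, then the two neighbors from \<open>separating_pair_neighbors\<close> violate it. Otherwise
  \<open>x\<close> has just two neighbors, and they form a separating pair again; by connectedness all
  vertices have at most two neighbors, which is false for \<open>p\<close>.\<close>

lemma biconnected_without_fork_complete:
  assumes "finite B" "multiplicity m" "biconnected m B" "p \<in> B" "3 \<le> card {v \<in> B. 0 < m p v}"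
    and no_fork: "\<And>u w x. u \<in> B \<Longrightarrow> w \<in> B \<Longrightarrow> x \<in> B \<Longrightarrow> u \<noteq> w \<Longrightarrow> m u w = 0 \<Longrightarrow> 0 < m x u \<Longrightarrow> 0 < m x w \<Longrightarrow>
        \<not> linked m (B - {u, w})"
    and "a \<in> B" "b \<in> B" "a \<noteq> b"
  shows "0 < m a b"
proof (rule ccontr)
  assume nab: "\<not> 0 < m a b"
  have sym: "m c d = m d c" and irr: "m c c = 0" for c d using assms(2) by (auto simp: multiplicity_def)
  let ?X = "{x \<in> B. \<exists>y\<in>B. y \<noteq> x \<and> \<not> linked m (B - {x, y})}"
  have few: "card {v \<in> B. 0 < m x v} \<le> 2 \<and> {v \<in> B. 0 < m x v} \<subseteq> ?X" if x: "x \<in> ?X" for x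
  proof -
    obtain y where y: "x \<in> B" "y \<in> B" "y \<noteq> x" "\<not> linked m (B - {x, y})" using x by blast
    obtain u w z where uwz: "u \<in> B" "w \<in> B" "u \<noteq> w" "m u w = 0" "0 < m x u" "0 < m x w"
      "z \<in> B" "z \<noteq> x" "z \<noteq> u" "z \<noteq> w" "linked m (B - {x, u, w})"
      by (rule separating_pair_neighbors[OF assms(1-3) y])
    have nl: "\<not> linked m (B - {u, w})" using no_fork uwz y by blast
    have xuw: "x \<noteq> u" "x \<noteq> w" using uwz irr by force+
    have N: "{v \<in> B. 0 < m x v} = {u, w}"
    proof (rule ccontr)
      assume "{v \<in> B. 0 < m x v} \<noteq> {u, w}"
      then obtain v where v: "v \<in> B" "0 < m x v" "v \<noteq> u" "v \<noteq> w" using uwz by auto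
      then have "v \<in> B - {x, u, w}" using irr[of x] by auto
      then have "linked m (insert x (B - {x, u, w}))" using linked_insert[OF assms(2) uwz(11) _ v(2)] by blast
      moreover have "insert x (B - {x, u, w}) = B - {u, w}" using y xuw by auto
      ultimately show False using nl by simp
    qed
    have nl': "\<not> linked m (B - {w, u})" using nl by (simp only: insert_commute not_False_eq_True)
    have "u \<in> ?X" using nl uwz(1-3) by (intro CollectI conjI bexI[of _ w]) auto
    moreover have "w \<in> ?X" using nl' uwz(1-3) by (intro CollectI conjI bexI[of _ u]) auto
    moreover have "card {u, w} \<le> 2" by (simp add: card_insert_if)
    ultimately show ?thesis unfolding N by simp
  qed
  show False
  proof (cases "?X = {}")
    case True
    have fork_linked: "linked m (B - {u, w})" if "u \<in> B" "w \<in> B" "u \<noteq> w" for u w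
    proof (rule ccontr)
      assume "\<not> linked m (B - {u, w})"
      then have "u \<in> ?X" using that by (intro CollectI conjI bexI[of _ w]) auto
      then show False using True by simp
    qed
    define S where "S = {v \<in> B. v = a \<or> 0 < m a v}"
    have "linked m B" using assms(3) by (simp add: biconnected_def)
    moreover have "S \<subseteq> B" "a \<in> S" "b \<notin> S" using assms(7,9) nab by (auto simp: S_def)
    then have "S \<subseteq> B" "S \<noteq> {}" "S \<noteq> B" using assms(8) by auto
    ultimately obtain x w where xw: "x \<in> S" "w \<in> B - S" "0 < m x w" by (rule linkedD)
    have aw: "w \<noteq> a" "m a w = 0" "w \<in> B" "x \<in> B" using xw assms(7) by (auto simp: S_def)
    then have "x \<noteq> a" using xw(3) by auto
    then have "0 < m x a" using xw(1) sym[of x a] by (simp add: S_def)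
    then have "\<not> linked m (B - {a, w})" using no_fork[of a w x] xw(3) aw assms(7) by simp
    then show False using fork_linked[of a w] assms(7) aw by simp
  next
    case False
    have "?X = B"
    proof (rule ccontr)
      assume ne: "?X \<noteq> B"
      have "linked m B" using assms(3) by (simp add: biconnected_def)
      moreover have "?X \<subseteq> B" by blast
      ultimately obtain u v where uv: "u \<in> ?X" "v \<in> B - ?X" "0 < m u v" using False ne by (rule linkedD)
      then show False using few[OF uv(1)] by blast
    qed
    then have "p \<in> ?X" using assms(4) by simp
    then show False using few[of p] assms(5) by linarith
  qed
qed

text \<open>Among all pairs for which \<open>z\<close> separates \<open>Q\<close> from the remaining vertices, take one with \<open>Q\<close>
  smallest. Any separation of \<open>insert z Q\<close> would give a smaller one.\<close>

lemma exists_leaf_block: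
  assumes "finite A" "multiplicity m" "A \<noteq> {}" and deg_pos: "\<And>u. u \<in> A \<Longrightarrow> degree m A u \<noteq> 0"
  obtains z Q where "z \<in> A" "Q \<subseteq> A - {z}" "Q \<noteq> {}" "\<forall>u\<in>Q. \<forall>v\<in>A - insert z Q. m u v = 0"
    "biconnected m (insert z Q)"
proof -
  have sym: "m a b = m b a" and irr: "m a a = 0" for a b using assms(2) by (auto simp: multiplicity_def)
  define leaf where "leaf z Q \<longleftrightarrow> z \<in> A \<and> Q \<subseteq> A - {z} \<and> Q \<noteq> {} \<and> (\<forall>u\<in>Q. \<forall>v\<in>A - insert z Q. m u v = 0)" for z Q
  obtain z0 where z0: "z0 \<in> A" using assms(3) by blast
  have "A - {z0} \<noteq> {}"
  proof
    assume "A - {z0} = {}"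
    then have "A = {z0}" using z0 by blast
    then show False using deg_pos[OF z0] irr by (simp add: degree_def)
  qed
  then have "leaf z0 (A - {z0})" using z0 by (auto simp: leaf_def)
  then have "\<exists>p. leaf (fst p) (snd p)" by (intro exI[of _ "(z0, A - {z0})"]) simp
  then obtain p where p: "leaf (fst p) (snd p)" "\<forall>p'. leaf (fst p') (snd p') \<longrightarrow> card (snd p) \<le> card (snd p')"
    using ex_has_least_nat[of "\<lambda>p. leaf (fst p) (snd p)" _ "\<lambda>p. card (snd p)"] by metis
  define z Q where "z = fst p" "Q = snd p"
  have zQ: "leaf z Q" using p(1) by (simp add: z_Q_def)
  have Q: "z \<in> A" "Q \<subseteq> A - {z}" "Q \<noteq> {}" "\<And>u v. u \<in> Q \<Longrightarrow> v \<in> A \<Longrightarrow> v \<noteq> z \<Longrightarrow> v \<notin> Q \<Longrightarrow> m u v = 0"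
    using zQ unfolding leaf_def by auto
  have finQ: "finite Q" using Q(2) assms(1) by (meson finite_Diff finite_subset)
  have min: "\<not> leaf z' Q'" if "Q' \<subset> Q" for z' Q'
  proof
    assume "leaf z' Q'"
    then have "card Q \<le> card Q'" using p(2)[rule_format, of "(z', Q')"] by (simp add: z_Q_def)
    then show False using psubset_card_mono[OF finQ that] by simp
  qed
  let ?B = "insert z Q"
  have BA: "?B \<subseteq> A" "z \<notin> Q" using Q(1,2) by auto
  have side: "\<exists>Z. Z \<subseteq> S \<and> Z \<noteq> {} \<and> Z \<noteq> S \<and> z \<notin> Z \<and> (\<forall>a\<in>Z. \<forall>b\<in>S - Z. m a b = 0)"
    if nl: "\<not> linked m S" for S
  proof -
    obtain Z where Z: "Z \<subseteq> S" "Z \<noteq> {}" "Z \<noteq> S" "\<forall>a\<in>Z. \<forall>b\<in>S - Z. m a b = 0" by (rule not_linkedE[OF nl])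
    show ?thesis
    proof (cases "z \<in> Z")
      case False then show ?thesis using Z by blast
    next
      case True
      have "\<forall>a\<in>S - Z. \<forall>b\<in>S - (S - Z). m a b = 0"
      proof (intro ballI)
        fix a b assume h: "a \<in> S - Z" "b \<in> S - (S - Z)"
        then have "b \<in> Z" by auto
        then have "m b a = 0" using Z(4)[rule_format, of b a] h(1) by simp
        then show "m a b = 0" using sym[of a b] by simp
      qed
      moreover have "S - Z \<subseteq> S" "S - Z \<noteq> {}" "S - Z \<noteq> S" "z \<notin> S - Z" using Z(1-3) True by auto
      ultimately show ?thesis by (intro exI[of _ "S - Z"]) (intro conjI)
    qed
  qed
  have leafI: "leaf v Z"
    if h: "v \<in> ?B" "Z \<subseteq> Q - {v}" "Z \<noteq> {}" "\<And>a b. a \<in> Z \<Longrightarrow> b \<in> ?B - insert v Z \<Longrightarrow> m a b = 0" for v Z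
    unfolding leaf_def
  proof (intro conjI ballI)
    fix a b assume ab: "a \<in> Z" "b \<in> A - insert v Z"
    show "m a b = 0"
    proof (cases "b \<in> ?B")
      case True then show ?thesis using h(4)[of a b] ab by simp
    next
      case False then show ?thesis using Q(4)[of a b] ab h(2) by auto
    qed
  qed (use h(1-3) BA(1) in auto)
  have l0: "linked m ?B"
  proof (rule ccontr)
    assume "\<not> linked m ?B"
    from side[OF this] obtain Z where Z: "Z \<subseteq> ?B" "Z \<noteq> {}" "Z \<noteq> ?B" "z \<notin> Z" "\<forall>a\<in>Z. \<forall>b\<in>?B - Z. m a b = 0"
      by (elim exE conjE)
    have Zc: "m a b = 0" if "a \<in> Z" "b \<in> ?B" "b \<notin> Z" for a b using Z(5)[rule_format, of a b] that by simp
    have ZQ: "Z \<subseteq> Q" using Z(1,4) by auto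
    have "leaf z Z" by (rule leafI) (use ZQ Z(2,4) Zc in auto)
    then have "Z = Q" using min ZQ by blast
    then have zQ0: "m a z = 0" if "a \<in> Q" for a using Zc[of a z] that BA(2) by auto
    obtain u where u: "u \<in> Q" using Q(3) by blast
    show False
    proof (cases "Q = {u}")
      case True
      have "m u v = 0" if "v \<in> A" for v using that Q(4)[of u v] zQ0[of u] irr[of u] True by auto
      then have "degree m A u = 0" by (simp add: degree_def)
      then show False using deg_pos[of u] u Q(2) by auto
    next
      case False
      have "leaf u (Q - {u})" by (rule leafI) (use u zQ0 False in auto)
      then show False using min[of "Q - {u}" u] u by blast
    qed
  qed
  have l1: "linked m (?B - {v})" if v: "v \<in> ?B" for v
  proof (rule ccontr)
    assume "\<not> linked m (?B - {v})"
    from side[OF this] obtain Z where Z: "Z \<subseteq> ?B - {v}" "Z \<noteq> {}" "Z \<noteq> ?B - {v}" "z \<notin> Z"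
      "\<forall>a\<in>Z. \<forall>b\<in>?B - {v} - Z. m a b = 0" by (elim exE conjE)
    have Zc: "m a b = 0" if "a \<in> Z" "b \<in> ?B - insert v Z" for a b using Z(5)[rule_format, of a b] that by simp
    have ZQ: "Z \<subseteq> Q - {v}" using Z(1,4) by auto
    have "Z \<subset> Q" using ZQ Z(3) BA(2) v by (cases "v = z") auto
    moreover have "leaf v Z" by (rule leafI[OF v ZQ Z(2) Zc])
    ultimately show False using min by blast
  qed
  have "\<forall>u\<in>Q. \<forall>v\<in>A - insert z Q. m u v = 0" using Q(4) by auto
  moreover have "biconnected m ?B" using l0 l1 by (simp add: biconnected_def)
  ultimately show thesis by (rule that[OF Q(1-3)])
qed

section \<open>Lists that match the degrees\<close>

text \<open>The situation of a connected set of tight vertices once everything outside has been colored: as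
  many colors as neighbors at each vertex, but no coloring.\<close>

locale tight_cover =
  fixes B :: "'v set" and m L R
  assumes finite_B: "finite B" and mult: "multiplicity m" and cover: "conflict_cover B m L R"
    and connected: "linked m B" and size: "\<And>v. v \<in> B \<Longrightarrow> degree m B v \<le> card (L v)"
    and no_coloring: "\<nexists>\<phi>. proper_coloring B L R \<phi>"
begin

lemma card_list: "v \<in> B \<Longrightarrow> card (L v) = degree m B v"
  using linked_coloring[OF finite_B cover mult connected size] no_coloring size by (metis le_neq_implies_less)

text \<open>If a partial coloring leaves the uncolored part connected, a spare color anywhere would allow
  the coloring to be completed.\<close>

lemma partial_coloring_residual:
  assumes "C \<subseteq> B" "proper_coloring C L R \<phi>" "linked m (B - C)" "r \<in> B - C"
  shows "card (residual L R C \<phi> r) \<le> degree m (B - C) r"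
proof (rule ccontr)
  assume r: "\<not> card (residual L R C \<phi> r) \<le> degree m (B - C) r"
  have fC: "finite C" using assms(1) finite_B finite_subset by blast
  have "\<exists>\<psi>. proper_coloring (B - C) (residual L R C \<phi>) R \<psi>"
  proof (rule linked_coloring[OF _ _ mult assms(3) _ assms(4)])
    show "finite (B - C)" using finite_B by simp
    show "conflict_cover (B - C) m (residual L R C \<phi>) R"
      by (rule conflict_cover_subset[OF cover]) (auto simp: residual_def)
    show "degree m (B - C) r < card (residual L R C \<phi> r)" using r by simp
    fix v assume v: "v \<in> B - C"
    have "card (L v) \<le> card (residual L R C \<phi> v) + degree m C v"
      by (rule residual_card[OF cover mult assms(1) fC v assms(2)])
    moreover have "degree m B v = degree m C v + degree m (B - C) v"
      by (rule degree_Diff[OF finite_B assms(1)])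
    ultimately show "degree m (B - C) v \<le> card (residual L R C \<phi> v)" using size[of v] v by simp
  qed
  then show False using residual_uncolorable[OF cover assms(1,2) no_coloring] by blast
qed

text \<open>If \<open>a\<close> had fewer conflicts, coloring \<open>u\<close> with \<open>a\<close> would leave a spare color at \<open>x\<close>.\<close>

lemma kills_exact:
  assumes "linked m (B - {u})" "u \<in> B" "x \<in> B" "u \<noteq> x" "a \<in> L u"
  shows "card {b \<in> L x. R u a x b} = m u x"
proof (rule antisym)
  show "card {b \<in> L x. R u a x b} \<le> m u x" by (rule conflict_card[OF cover assms(2,3,4,5)])
  have "proper_coloring {u} L R (\<lambda>_. a)" using assms by (simp add: proper_coloring_def)
  then have "card (residual L R {u} (\<lambda>_. a) x) \<le> degree m (B - {u}) x"
    using partial_coloring_residual[of "{u}" "\<lambda>_. a" x] assms by simp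
  moreover have "card (L x) \<le> card (residual L R {u} (\<lambda>_. a) x) + card {b \<in> L x. R u a x b}"
    using residual_card_kills[OF cover, of "{u}" x "\<lambda>_. a"] assms by simp
  moreover have "degree m B x = m x u + degree m (B - {u}) x"
    by (rule degree_remove[OF finite_B assms(2)])
  moreover have "m x u = m u x" using mult by (simp add: multiplicity_def)
  ultimately show "m u x \<le> card {b \<in> L x. R u a x b}" using size[OF assms(3)] by linarith
qed

end

locale tight_block = tight_cover +
  assumes biconnected: "biconnected m B"
begin

lemma linked_remove: "v \<in> B \<Longrightarrow> linked m (B - {v})"
  using biconnected by (simp add: biconnected_def)

text \<open>By \<open>kills_exact\<close>, the conflicts between the two lists form a regular bipartite graph, so the
  lists have the same length.\<close>

lemma adjacent_same_degree:
  assumes "u \<in> B" "x \<in> B" "0 < m u x"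
  shows "degree m B u = degree m B x"
proof -
  have ux: "u \<noteq> x" using assms(3) mult by (auto simp: multiplicity_def)
  have sym: "m x u = m u x" using mult by (simp add: multiplicity_def)
  have Rsym: "R u a x b \<longleftrightarrow> R x b u a" for a b using conflict_cover_sym[OF cover] by blast
  have "(\<Sum>a\<in>L u. card {b \<in> L x. R u a x b}) = m u x * card (L x)"
  proof (rule sum_multicount)
    show "finite (L u)" "finite (L x)" using conflict_cover_finite[OF cover] assms by auto
    show "\<forall>b\<in>L x. card {a \<in> L u. R u a x b} = m u x"
      using kills_exact[OF linked_remove[OF assms(2)] assms(2,1)] ux sym by (simp add: Rsym)
  qed
  moreover have "(\<Sum>a\<in>L u. card {b \<in> L x. R u a x b}) = (\<Sum>a\<in>L u. m u x)"
    by (rule sum.cong[OF refl]) (rule kills_exact[OF linked_remove[OF assms(1)] assms(1,2) ux])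
  ultimately have "card (L u) * m u x = m u x * card (L x)" by simp
  then have "card (L u) = card (L x)" using assms(3) by (simp add: mult.commute)
  then show ?thesis using card_list assms by simp
qed

lemma regular:
  assumes "u \<in> B" "v \<in> B"
  shows "degree m B u = degree m B v"
proof (rule ccontr)
  assume ne: "degree m B u \<noteq> degree m B v"
  define X where "X = {w \<in> B. degree m B w = degree m B u}"
  have "v \<notin> X" "u \<in> X" "X \<subseteq> B" using assms ne by (auto simp: X_def)
  then have "X \<subseteq> B" "X \<noteq> {}" "X \<noteq> B" using assms(2) by auto
  with connected obtain a b where "a \<in> X" "b \<in> B - X" "0 < m a b" by (rule linkedD)
  then show False using adjacent_same_degree[of a b] by (auto simp: X_def)
qed

text \<open>Fix a color of \<open>x\<close>. The vertices \<open>u\<close> and \<open>w\<close> both have a color in conflict with it, and using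
  these two colors leaves \<open>x\<close> with a spare one.\<close>

lemma no_fork:
  assumes "u \<in> B" "w \<in> B" "x \<in> B" "u \<noteq> w" "m u w = 0" "0 < m x u" "0 < m x w"
  shows "\<not> linked m (B - {u, w})"
proof
  assume l: "linked m (B - {u, w})"
  have sym: "m c d = m d c" and irr: "m c c = 0" for c d using mult by (auto simp: multiplicity_def)
  have Rsym: "R c a d b \<longleftrightarrow> R d b c a" for c a d b using conflict_cover_sym[OF cover] by blast
  have xu: "x \<noteq> u" "x \<noteq> w" using assms irr by force+
  have "m x u \<le> degree m B x"
    using degree_remove[OF finite_B assms(1), of m x] by simp
  then have "card (L x) \<noteq> 0" using assms(6) card_list[OF assms(3)] by simp
  then obtain a where a: "a \<in> L x" by fastforce
  have "card {b \<in> L u. R x a u b} \<noteq> 0" "card {b \<in> L w. R x a w b} \<noteq> 0"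
    using kills_exact[OF linked_remove[OF assms(3)] assms(3) _ _ a] assms xu by auto
  then obtain bu bw where b: "bu \<in> L u" "R x a u bu" "bw \<in> L w" "R x a w bw"
    by (metis (mono_tags, lifting) Collect_empty_eq card.empty)
  define \<phi> where "\<phi> v = (if v = u then bu else bw)" for v
  have "\<not> R u bu w bw" by (rule no_conflict_if_nonadjacent[OF cover assms(1,2,4,5) b(1,3)])
  then have p: "proper_coloring {u, w} L R \<phi>"
    using b assms(4) Rsym by (auto simp: proper_coloring_def \<phi>_def)
  have res: "card (residual L R {u, w} \<phi> x) \<le> degree m (B - {u, w}) x"
    by (rule partial_coloring_residual[OF _ p l]) (use assms xu in auto)
  let ?A = "{b \<in> L x. R u bu x b}" and ?C = "{b \<in> L x. R w bw x b}"
  have fin: "finite (L x)" using conflict_cover_finite[OF cover assms(3)] .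
  have cA: "card ?A = m u x" "card ?C = m w x"
    using kills_exact[OF linked_remove[OF assms(1)] assms(1,3) _ b(1)]
      kills_exact[OF linked_remove[OF assms(2)] assms(2,3) _ b(3)] xu by auto
  have "a \<in> ?A \<inter> ?C" using a b Rsym by blast
  moreover have "finite (?A \<inter> ?C)" using fin by simp
  ultimately have "0 < card (?A \<inter> ?C)" using card_gt_0_iff by blast
  then have "card (?A \<union> ?C) < card ?A + card ?C" using card_Un_Int[of ?A ?C] fin by simp
  moreover have "L x \<subseteq> residual L R {u, w} \<phi> x \<union> (?A \<union> ?C)"
    using assms(4) by (auto simp: residual_def \<phi>_def)
  then have "card (L x) \<le> card (residual L R {u, w} \<phi> x \<union> (?A \<union> ?C))"
    by (rule card_mono[rotated]) (use fin in \<open>auto simp: residual_def\<close>)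
  moreover have "card (residual L R {u, w} \<phi> x \<union> (?A \<union> ?C)) \<le> card (residual L R {u, w} \<phi> x) + card (?A \<union> ?C)"
    by (rule card_Un_le)
  moreover have "degree m B x = degree m {u, w} x + degree m (B - {u, w}) x"
    by (rule degree_Diff[OF finite_B]) (use assms in auto)
  moreover have "degree m {u, w} x = m u x + m w x" using assms(4) sym by (simp add: degree_def)
  ultimately show False using res cA card_list[OF assms(3)] by linarith
qed

lemma complete:
  assumes "p \<in> B" "3 \<le> card {v \<in> B. 0 < m p v}" "a \<in> B" "b \<in> B" "a \<noteq> b"
  shows "0 < m a b"
  by (rule biconnected_without_fork_complete[OF finite_B mult biconnected assms(1,2) _ assms(3-5)])
    (rule no_fork, assumption+)

end

section \<open>The potential\<close>

text \<open>Half the weight of a bundle of \<open>n\<close> parallel edges: the sums below run over ordered pairs of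
  vertices and meet every bundle twice. For \<open>n = 0\<close> truncated subtraction gives \<open>0\<close>.\<close>

definition edge_cost :: "int \<Rightarrow> nat \<Rightarrow> int" where
  "edge_cost lam n = lam * int n + 3 * int (n - 1)"

text \<open>The potential of a vertex with \<open>n\<close> colors, where \<open>kap\<close> stands for \<open>k - 1\<close>.\<close>

definition vertex_value :: "nat \<Rightarrow> int \<Rightarrow> nat \<Rightarrow> int" where
  "vertex_value kap lam n = (if n = kap then int kap * lam + 1 else int n * (lam + 1) - int kap)"

definition potential :: "nat \<Rightarrow> int \<Rightarrow> ('v \<Rightarrow> 'v \<Rightarrow> nat) \<Rightarrow> ('v \<Rightarrow> nat) \<Rightarrow> 'v set \<Rightarrow> int" where
  "potential kap lam m l S =
     (\<Sum>v\<in>S. vertex_value kap lam (l v) - (\<Sum>u\<in>S. edge_cost lam (m v u)))"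

lemma edge_cost_ge: "lam * int n \<le> edge_cost lam n"
  by (simp add: edge_cost_def)

lemma edge_cost_mono: "0 \<le> lam \<Longrightarrow> n \<le> n' \<Longrightarrow> edge_cost lam n \<le> edge_cost lam n'"
  unfolding edge_cost_def by (intro add_mono mult_left_mono) auto

lemma edge_cost_add: "edge_cost lam (n + j) \<le> edge_cost lam n + (lam + 3) * int j"
proof -
  have "n + j - 1 \<le> n - 1 + j" by simp
  then have "int (n + j - 1) \<le> int (n - 1) + int j" by linarith
  then show ?thesis by (simp add: edge_cost_def distrib_left distrib_right)
qed

lemma potential_Un:
  assumes "finite S" "finite T" "S \<inter> T = {}" "multiplicity m"
  shows "potential kap lam m l (S \<union> T) = potential kap lam m l S + potential kap lam m l T
    - 2 * (\<Sum>s\<in>S. \<Sum>t\<in>T. edge_cost lam (m s t))"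
proof -
  have sym: "m a b = m b a" for a b using assms(4) by (simp add: multiplicity_def)
  have inner: "(\<Sum>u\<in>S \<union> T. edge_cost lam (m v u)) = (\<Sum>u\<in>S. edge_cost lam (m v u)) + (\<Sum>u\<in>T. edge_cost lam (m v u))" for v
    by (rule sum.union_disjoint[OF assms(1-3)])
  have "(\<Sum>v\<in>T. \<Sum>u\<in>S. edge_cost lam (m v u)) = (\<Sum>s\<in>S. \<Sum>t\<in>T. edge_cost lam (m s t))"
    by (subst sum.swap) (simp add: sym)
  then show ?thesis
    unfolding potential_def inner by (simp add: sum.union_disjoint[OF assms(1-3)] sum_subtractf sum.distrib)
qed

lemma potential_antimono:
  assumes "0 \<le> lam" "\<And>u v. u \<in> S \<Longrightarrow> v \<in> S \<Longrightarrow> m' u v \<le> m u v"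
  shows "potential kap lam m l S \<le> potential kap lam m' l S"
  unfolding potential_def
  by (intro sum_mono diff_left_mono edge_cost_mono assms)

text \<open>\<open>P\<close> bounds the number of edges that may leave a reducible clique at one vertex. \<open>P_gap\<close> says
  that \<open>kap + 1 + 2 * lam * P\<close> is below the gap of \<open>potential_ge_gap\<close>, and \<open>P_large\<close> lets a
  vertex with one more edge than colors pay \<open>2 / P\<close> along all its edges.\<close>

locale parameters =
  fixes kap :: nat and lam :: int and P :: nat
  assumes lam_ge: "24 \<le> lam" and P_ge: "4 \<le> P" and P_small: "10 * P \<le> kap + 1"
    and P_gap: "8 * lam * int P \<le> (lam - 6) * (int kap + 1) + 3"
    and P_large: "2 * (int kap + 1) \<le> int P * (lam - 2)"
begin

abbreviation val :: "nat \<Rightarrow> int" where "val \<equiv> vertex_value kap lam"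
abbreviation pot :: "('v \<Rightarrow> 'v \<Rightarrow> nat) \<Rightarrow> ('v \<Rightarrow> nat) \<Rightarrow> 'v set \<Rightarrow> int" where "pot \<equiv> potential kap lam"
abbreviation cost :: "nat \<Rightarrow> int" where "cost \<equiv> edge_cost lam"

lemma kap_ge: "39 \<le> kap" using P_ge P_small by linarith

text \<open>Each lost color costs \<open>lam + 1\<close>; leaving the full length \<open>kap\<close> costs \<open>1\<close> in addition.\<close>

lemma val_diff:
  assumes "n \<le> kap"
  shows "val n - val (n - j) \<le> (lam + 2) * int j"
proof (cases "j = 0")
  case False
  define i where "i = min j n"
  have i: "n - j = n - i" "i \<le> n" "i \<le> j" by (auto simp: i_def)
  have "val n - val (n - i) \<le> (lam + 2) * int i"
  proof (cases "i = 0")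
    case i0: False
    then have "n - i \<noteq> kap" using assms i by simp
    then show ?thesis using i i0 assms lam_ge by (auto simp: vertex_value_def of_nat_diff algebra_simps)
  qed simp
  also have "\<dots> \<le> (lam + 2) * int j" using i lam_ge by (intro mult_left_mono) auto
  finally show ?thesis using i by simp
qed simp

lemma val_le: "n \<le> kap \<Longrightarrow> val n \<le> int kap * lam + 1"
proof -
  assume "n \<le> kap"
  then have "int n * (lam + 1) \<le> int kap * (lam + 1)" using lam_ge by (intro mult_right_mono) auto
  then show ?thesis by (simp add: vertex_value_def algebra_simps)
qed

lemma potential_shrink:
  assumes "\<And>v. v \<in> W \<Longrightarrow> l v \<le> kap"
  shows "pot m l W \<le> pot m (\<lambda>v. l v - f v) W + (lam + 2) * int (\<Sum>v\<in>W. f v)"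
proof -
  have "(\<Sum>v\<in>W. val (l v)) \<le> (\<Sum>v\<in>W. val (l v - f v) + (lam + 2) * int (f v))"
    by (rule sum_mono) (use val_diff assms in \<open>simp add: diff_le_eq add.commute\<close>)
  also have "\<dots> = (\<Sum>v\<in>W. val (l v - f v)) + (lam + 2) * int (\<Sum>v\<in>W. f v)"
    by (simp add: sum.distrib sum_distrib_left)
  finally show ?thesis by (simp add: potential_def sum_subtractf)
qed

end

section \<open>Sets of small potential in a minimal counterexample\<close>

text \<open>A counterexample with the fewest vertices, and with more than \<open>kap\<close> of them.\<close>

locale counterexample = parameters kap lam P for kap lam P +
  fixes V :: "'v set" and m :: "'v \<Rightarrow> 'v \<Rightarrow> nat" and l :: "'v \<Rightarrow> nat"
  assumes finite_V: "finite V" and mult: "multiplicity m" and l_le: "\<And>v. v \<in> V \<Longrightarrow> l v \<le> kap"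
    and crit: "critical V m l"
    and smaller: "\<And>(V0 :: 'v set) m0 l0. finite V0 \<Longrightarrow> card V0 < card V \<Longrightarrow> multiplicity m0 \<Longrightarrow>
        (\<And>v. v \<in> V0 \<Longrightarrow> l0 v \<le> kap) \<Longrightarrow> critical V0 m0 l0 \<Longrightarrow>
        potential kap lam m0 l0 V0 \<le> - int kap \<or>
        (card V0 = kap + 1 \<and> (\<forall>u\<in>V0. \<forall>v\<in>V0. u \<noteq> v \<longrightarrow> m0 u v = 1))"
    and pot_V: "- int kap < potential kap lam m l V"
    and not_clique: "\<not> (card V = kap + 1 \<and> (\<forall>u\<in>V. \<forall>v\<in>V. u \<noteq> v \<longrightarrow> m u v = 1))"
    and many: "kap < card V"
begin

lemma sym: "m u v = m v u" and irrefl: "m v v = 0"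
  using mult by (simp_all add: multiplicity_def)

text \<open>The form in which minimality is used. Since \<open>m0\<close> may have edges that \<open>m\<close> lacks, a clique \<open>K_k\<close>
  has to be admitted.\<close>

lemma smaller_uncolorable:
  fixes V0 :: "'v set"
  assumes "finite V0" "card V0 < card V" "multiplicity m0" "\<And>v. v \<in> V0 \<Longrightarrow> l0 v \<le> kap" "uncolorable V0 m0 l0"
  obtains W where "W \<subseteq> V0" "W \<noteq> {}"
    "pot m0 l0 W \<le> - int kap \<or> (card W = kap + 1 \<and> (\<forall>u\<in>W. \<forall>v\<in>W. u \<noteq> v \<longrightarrow> 0 < m0 u v))"
proof -
  obtain W m' where W: "W \<subseteq> V0" "multiplicity m'" "\<forall>u v. m' u v \<le> m0 u v" "critical W m' l0"
    using uncolorable_contains_critical[OF assms(1,3,5)] by blast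
  have ne: "W \<noteq> {}"
    using W(4) unfolding critical_def uncolorable_def proper_coloring_def by auto
  have fin: "finite W" using W(1) assms(1) finite_subset by blast
  have "card W < card V" using card_mono[OF assms(1) W(1)] assms(2) by simp
  then have "pot m' l0 W \<le> - int kap \<or> (card W = kap + 1 \<and> (\<forall>u\<in>W. \<forall>v\<in>W. u \<noteq> v \<longrightarrow> m' u v = 1))"
    by (rule smaller[OF fin _ W(2) _ W(4)]) (use assms(4) W(1) in auto)
  moreover have "pot m0 l0 W \<le> pot m' l0 W"
    by (rule potential_antimono) (use lam_ge W(3) in auto)
  moreover have "0 < m0 u v" if "m' u v = 1" for u v using W(3) that by (metis less_numeral_extra(1) order_less_le_trans)
  ultimately have "pot m0 l0 W \<le> - int kap \<or> (card W = kap + 1 \<and> (\<forall>u\<in>W. \<forall>v\<in>W. u \<noteq> v \<longrightarrow> 0 < m0 u v))"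
    by (elim disjE) auto
  then show thesis by (rule that[OF W(1) ne])
qed

text \<open>By \<open>uncolorable_clique\<close>, a subgraph \<open>K_k\<close> would already be uncolorable, and so be the whole
  graph.\<close>

lemma no_clique:
  assumes "W \<subseteq> V" "card W = kap + 1"
  shows "\<exists>u\<in>W. \<exists>v\<in>W. u \<noteq> v \<and> m u v = 0"
proof (rule ccontr)
  assume n: "\<not> ?thesis"
  let ?m = "\<lambda>u v. if u \<in> W \<and> v \<in> W \<and> u \<noteq> v then 1 else (0::nat)"
  have fin: "finite W" using assms(1) finite_V finite_subset by blast
  have unc: "uncolorable W ?m l"
    by (rule uncolorable_clique[OF fin assms(2)]) (use l_le assms in auto)
  have m1: "multiplicity ?m" by (auto simp: multiplicity_def)
  have m2: "\<forall>u v. ?m u v \<le> m u v"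
  proof (intro allI)
    fix u v
    have "m u v \<noteq> 0" if "u \<in> W" "v \<in> W" "u \<noteq> v"
      using n that by (meson bexI)
    then show "?m u v \<le> m u v" by (simp add: Suc_leI)
  qed
  have "\<not> (W \<noteq> V \<or> (\<exists>u\<in>V. \<exists>v\<in>V. ?m u v \<noteq> m u v))"
    using critical_proper[OF crit assms(1) m1 m2] unc by (rule contrapos_pn[rotated])
  then have eq: "W = V" "\<And>u v. u \<in> V \<Longrightarrow> v \<in> V \<Longrightarrow> ?m u v = m u v" by simp_all
  have "m u v = 1" if "u \<in> V" "v \<in> V" "u \<noteq> v" for u v using eq(2)[OF that(1,2)] that by (simp add: eq(1))
  then show False using not_clique assms(2) eq(1) by simp
qed

lemma proper_subset_colorable:
  assumes "S \<subseteq> V" "S \<noteq> V" "conflict_cover V m L R" "\<forall>v\<in>V. card (L v) = l v"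
  obtains \<phi> where "proper_coloring S L R \<phi>"
proof -
  have "\<not> uncolorable S m l" by (rule critical_proper[OF crit]) (use assms(1,2) mult in auto)
  moreover have "conflict_cover S m L R" by (rule conflict_cover_subset[OF assms(3,1)]) auto
  moreover have "\<forall>v\<in>S. card (L v) = l v" using assms(1,4) by blast
  ultimately show thesis using that unfolding uncolorable_def by blast
qed

lemma bad_cover:
  obtains L R where "conflict_cover V m L R" "\<forall>v\<in>V. card (L v) = l v"
    "\<nexists>\<phi>. proper_coloring V L R \<phi>"
proof -
  have "uncolorable V m l" using crit by (simp add: critical_def)
  then obtain L R where "conflict_cover V m L R" "\<forall>v\<in>V. card (L v) = l v" "\<nexists>\<phi>. proper_coloring V L R \<phi>"
    unfolding uncolorable_def by (elim exE conjE)
  then show thesis using that[of L R] by simp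
qed

text \<open>Color \<open>S\<close>, and use that \<open>V\<close> is a smallest counterexample for the uncolorable remainder. A clique
  \<open>K_k\<close> cannot occur here, because no edges have been added.\<close>

lemma residual_witness:
  assumes "S \<subseteq> V" "S \<noteq> {}" "S \<noteq> V"
  obtains W where "W \<subseteq> V - S" "W \<noteq> {}" "pot m (\<lambda>v. l v - degree m S v) W \<le> - int kap"
proof -
  obtain L R where LR: "conflict_cover V m L R" "\<forall>v\<in>V. card (L v) = l v"
    "\<nexists>\<phi>. proper_coloring V L R \<phi>" by (rule bad_cover)
  obtain \<phi> where \<phi>: "proper_coloring S L R \<phi>" by (rule proper_subset_colorable[OF assms(1,3) LR(1,2)])
  have fS: "finite S" using assms(1) finite_V finite_subset by blast
  have unc: "uncolorable (V - S) m (\<lambda>v. l v - degree m S v)"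
  proof (rule uncolorable_trim)
    show "conflict_cover (V - S) m (residual L R S \<phi>) R"
      by (rule conflict_cover_subset[OF LR(1)]) (auto simp: residual_def)
    show "l v - degree m S v \<le> card (residual L R S \<phi> v)" if "v \<in> V - S" for v
      using residual_card[OF LR(1) mult assms(1) fS that \<phi>] LR(2) that by simp
  qed (rule residual_uncolorable[OF LR(1) assms(1) \<phi> LR(3)])
  have lt: "card (V - S) < card V"
    using assms finite_V by (intro psubset_card_mono) auto
  have le: "l v - degree m S v \<le> kap" if "v \<in> V - S" for v using l_le[of v] that by auto
  have fin: "finite (V - S)" using finite_V by simp
  obtain W where W: "W \<subseteq> V - S" "W \<noteq> {}"
    "pot m (\<lambda>v. l v - degree m S v) W \<le> - int kap \<or> (card W = kap + 1 \<and> (\<forall>u\<in>W. \<forall>v\<in>W. u \<noteq> v \<longrightarrow> 0 < m u v))"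
    by (rule smaller_uncolorable[OF fin lt mult le unc])
  have n: "\<not> (card W = kap + 1 \<and> (\<forall>u\<in>W. \<forall>v\<in>W. u \<noteq> v \<longrightarrow> 0 < m u v))"
    using no_clique[of W] W(1) by auto
  have "pot m (\<lambda>v. l v - degree m S v) W \<le> - int kap"
    by (rule disjE[OF W(3)], assumption, erule notE[OF n])
  then show thesis by (rule that[OF W(1,2)])
qed

text \<open>For a set \<open>T\<close> of least potential, \<open>residual_witness\<close> is used twice, for \<open>T\<close> and for its
  complement. The first use bounds the potential from below by \<open>1 + (lam - 2) * e\<close>, where \<open>e\<close> is
  the number of edges leaving \<open>T\<close>; the second bounds \<open>e\<close> from below in terms of the potential.\<close>

lemma potential_ge_gap:
  assumes "S \<subseteq> V" "S \<noteq> {}" "S \<noteq> V"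
  shows "(lam - 2) * int kap + lam + 2 \<le> 4 * pot m l S"
proof -
  let ?F = "{S. S \<subseteq> V \<and> S \<noteq> {} \<and> S \<noteq> V}"
  have "finite ?F" using finite_V by simp
  moreover have "?F \<noteq> {}" using assms by blast
  ultimately have "\<exists>T. is_arg_min (pot m l) (\<lambda>S. S \<in> ?F) T" by (rule ex_is_arg_min_if_finite)
  then obtain T where T: "is_arg_min (pot m l) (\<lambda>S. S \<in> ?F) T" ..
  have T': "T \<subseteq> V" "T \<noteq> {}" "T \<noteq> V" using T by (auto simp: is_arg_min_def)
  have min: "pot m l T \<le> pot m l U" if "U \<subseteq> V" "U \<noteq> {}" "U \<noteq> V" for U
    using T that by (auto simp: is_arg_min_linorder)
  have fin: "finite U" if "U \<subseteq> V" for U using that finite_V finite_subset by blast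
  obtain W where W: "W \<subseteq> V - T" "W \<noteq> {}" "pot m (\<lambda>v. l v - degree m T v) W \<le> - int kap"
    by (rule residual_witness[OF T'])
  let ?e = "int (\<Sum>v\<in>W. degree m T v)"
  have WV: "W \<subseteq> V" using W(1) by blast
  have "pot m l W \<le> pot m (\<lambda>v. l v - degree m T v) W + (lam + 2) * ?e"
    by (rule potential_shrink) (use l_le WV in auto)
  then have pW: "pot m l W \<le> - int kap + (lam + 2) * ?e" using W(3) by simp
  have "pot m l (T \<union> W) = pot m l T + pot m l W - 2 * (\<Sum>s\<in>T. \<Sum>t\<in>W. cost (m s t))"
    by (rule potential_Un[OF fin[OF T'(1)] fin[OF WV] _ mult]) (use W(1) in blast)
  moreover have "lam * ?e \<le> (\<Sum>s\<in>T. \<Sum>t\<in>W. cost (m s t))"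
  proof -
    have "lam * ?e = (\<Sum>t\<in>W. \<Sum>s\<in>T. lam * int (m t s))"
      by (simp add: degree_def sum_distrib_left)
    also have "\<dots> = (\<Sum>s\<in>T. \<Sum>t\<in>W. lam * int (m s t))" by (subst sum.swap) (simp add: sym)
    also have "\<dots> \<le> (\<Sum>s\<in>T. \<Sum>t\<in>W. cost (m s t))" by (intro sum_mono edge_cost_ge)
    finally show ?thesis .
  qed
  ultimately have pTW: "pot m l (T \<union> W) \<le> pot m l T - int kap - (lam - 2) * ?e"
    using pW by (simp add: algebra_simps)
  have nn: "0 \<le> (lam - 2) * ?e" using lam_ge by (intro mult_nonneg_nonneg of_nat_0_le_iff) simp
  have TW: "T \<union> W = V"
  proof (rule ccontr)
    assume "T \<union> W \<noteq> V"
    then have "pot m l T \<le> pot m l (T \<union> W)" using min[of "T \<union> W"] T' WV by blast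
    then show False using pTW nn kap_ge by linarith
  qed
  then have WT: "W = V - T" using W(1) by blast
  have g1: "1 + (lam - 2) * ?e \<le> pot m l T" using pTW TW pot_V by simp
  have VT: "V - T \<subseteq> V" "V - T \<noteq> {}" "V - T \<noteq> V" using T' by auto
  obtain X where X: "X \<subseteq> V - (V - T)" "X \<noteq> {}" "pot m (\<lambda>v. l v - degree m (V - T) v) X \<le> - int kap"
    by (rule residual_witness[OF VT])
  have XT: "X \<subseteq> T" using X(1) T'(1) by blast
  have "pot m l X \<le> pot m (\<lambda>v. l v - degree m (V - T) v) X + (lam + 2) * int (\<Sum>v\<in>X. degree m (V - T) v)"
    by (rule potential_shrink) (use l_le XT T' in auto)
  moreover have "(\<Sum>v\<in>X. degree m (V - T) v) \<le> (\<Sum>v\<in>W. degree m T v)"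
  proof -
    have "(\<Sum>v\<in>X. degree m (V - T) v) \<le> (\<Sum>v\<in>T. degree m (V - T) v)"
      by (rule sum_mono2) (use XT fin T' in auto)
    also have "\<dots> = (\<Sum>v\<in>W. degree m T v)"
      unfolding degree_def WT by (subst sum.swap) (simp add: sym)
    finally show ?thesis .
  qed
  then have "(lam + 2) * int (\<Sum>v\<in>X. degree m (V - T) v) \<le> (lam + 2) * ?e"
    using lam_ge by (intro mult_left_mono) (simp_all only: of_nat_le_iff)
  moreover have "pot m l T \<le> pot m l X" by (rule min) (use XT T' X(2) in auto)
  ultimately have g2: "int kap + pot m l T \<le> (lam + 2) * ?e" using X(3) by linarith
  have "(lam - 2) * (int kap + pot m l T) \<le> (lam - 2) * ((lam + 2) * ?e)"
    using g2 lam_ge by (intro mult_left_mono) auto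
  moreover have "(lam + 2) * (1 + (lam - 2) * ?e) \<le> (lam + 2) * pot m l T"
    using g1 lam_ge by (intro mult_left_mono) auto
  ultimately have "(lam - 2) * int kap + lam + 2 \<le> 4 * pot m l T" by (simp add: algebra_simps)
  then show ?thesis using min[OF assms] by linarith
qed

text \<open>Without edges between \<open>S\<close> and the rest, coloring \<open>S\<close> does not shorten any other list, so that
  \<open>residual_witness\<close> contradicts the gap.\<close>

lemma cut_positive:
  assumes "S \<subseteq> V" "S \<noteq> {}" "S \<noteq> V"
  shows "\<exists>u\<in>S. \<exists>v\<in>V - S. 0 < m u v"
proof (rule ccontr)
  assume n: "\<not> ?thesis"
  obtain W where W: "W \<subseteq> V - S" "W \<noteq> {}" "pot m (\<lambda>v. l v - degree m S v) W \<le> - int kap"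
    by (rule residual_witness[OF assms])
  have "degree m S v = 0" if "v \<in> W" for v
    using n W(1) that sym[of v] by (auto simp: degree_def)
  then have "pot m (\<lambda>v. l v - degree m S v) W = pot m l W" by (simp add: potential_def)
  moreover have "(lam - 2) * int kap + lam + 2 \<le> 4 * pot m l W"
    by (rule potential_ge_gap) (use W assms in auto)
  moreover have "0 \<le> (lam - 2) * int kap" using lam_ge by simp
  ultimately show False using W(3) lam_ge kap_ge by linarith
qed

section \<open>Tight vertices\<close>

definition deg :: "'v \<Rightarrow> nat" where "deg v = degree m V v"

definition tight :: "'v set" where "tight = {v \<in> V. deg v = l v}"

lemma deg_ge: "v \<in> V \<Longrightarrow> l v \<le> deg v"
  unfolding deg_def by (rule critical_degree[OF finite_V mult crit])

lemma residual_tight: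
  assumes "conflict_cover V m L R" "\<forall>v\<in>V. card (L v) = l v" "\<nexists>\<phi>. proper_coloring V L R \<phi>"
    "B \<subseteq> tight" "linked m B" "proper_coloring (V - B) L R \<phi>"
  shows "tight_cover B m (residual L R (V - B) \<phi>) R"
proof
  have BV: "B \<subseteq> V" using assms(4) by (auto simp: tight_def)
  show "finite B" using BV finite_V finite_subset by blast
  show "multiplicity m" by (rule mult)
  show "conflict_cover B m (residual L R (V - B) \<phi>) R"
    by (rule conflict_cover_subset[OF assms(1) BV]) (auto simp: residual_def)
  show "linked m B" by (rule assms(5))
  show "\<nexists>\<psi>. proper_coloring B (residual L R (V - B) \<phi>) R \<psi>"
    using residual_uncolorable[OF assms(1) Diff_subset assms(6,3)] unfolding double_diff[OF BV order_refl] .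
  fix v assume v: "v \<in> B"
  have "card (L v) \<le> card (residual L R (V - B) \<phi> v) + degree m (V - B) v"
    by (rule residual_card[OF assms(1) mult _ _ _ assms(6)]) (use v BV finite_V in auto)
  moreover have "deg v = degree m B v + degree m (V - B) v"
    unfolding deg_def by (rule degree_Diff[OF finite_V BV])
  moreover have "card (L v) = deg v" using assms(2,4) v by (auto simp: tight_def)
  ultimately show "degree m B v \<le> card (residual L R (V - B) \<phi> v)" by linarith
qed

lemma tight_block_exists:
  assumes "B \<subseteq> tight" "B \<noteq> {}" "biconnected m B"
  obtains L R where "tight_block B m L R"
proof -
  obtain L R where LR: "conflict_cover V m L R" "\<forall>v\<in>V. card (L v) = l v"
    "\<nexists>\<phi>. proper_coloring V L R \<phi>" by (rule bad_cover)
  have S: "V - B \<subseteq> V" "V - B \<noteq> V" using assms(1,2) by (auto simp: tight_def)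
  obtain \<phi> where \<phi>: "proper_coloring (V - B) L R \<phi>" by (rule proper_subset_colorable[OF S LR(1,2)])
  have "linked m B" using assms(3) by (simp add: biconnected_def)
  then have "tight_cover B m (residual L R (V - B) \<phi>) R" by (rule residual_tight[OF LR assms(1) _ \<phi>])
  then have "tight_block B m (residual L R (V - B) \<phi>) R"
    using assms(3) by (simp add: tight_block_def tight_block_axioms_def)
  then show thesis by (rule that)
qed

section \<open>Large cliques of tight vertices\<close>

definition simple_clique :: "'v set \<Rightarrow> bool" where
  "simple_clique B \<longleftrightarrow> (\<forall>u\<in>B. \<forall>v\<in>B. u \<noteq> v \<longrightarrow> m u v = 1)"

lemma simple_clique_linked: "simple_clique B \<Longrightarrow> linked m B"
  by (rule complete_linked) (simp add: simple_clique_def)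

lemma simple_clique_Diff: "simple_clique B \<Longrightarrow> simple_clique (B - C)"
  by (simp add: simple_clique_def)

lemma simple_clique_degree:
  assumes "simple_clique B" "B \<subseteq> V" "x \<in> B"
  shows "degree m B x = card B - 1"
proof -
  have fin: "finite B" using assms(2) finite_V finite_subset by blast
  have "degree m B x = m x x + degree m (B - {x}) x" by (rule degree_remove[OF fin assms(3)])
  also have "degree m (B - {x}) x = (\<Sum>u\<in>B - {x}. 1)"
    unfolding degree_def by (rule sum.cong[OF refl]) (use assms in \<open>auto simp: simple_clique_def\<close>)
  finally show ?thesis using assms(3) fin irrefl by simp
qed

lemma star_weight:
  assumes "finite W"
  shows "(\<Sum>v\<in>W. \<Sum>u\<in>W. (if v = y then f u else 0) + (if u = y then f v else 0)) \<le> 2 * (\<Sum>u\<in>W. (f u :: nat))"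
proof -
  have "(\<Sum>v\<in>W. \<Sum>u\<in>W. if v = y then f u else 0) = (\<Sum>u\<in>W. \<Sum>v\<in>W. if v = y then f u else 0)"
    by (rule sum.swap)
  moreover have "(\<Sum>u\<in>W. \<Sum>v\<in>W. if v = y then f u else 0) \<le> (\<Sum>u\<in>W. f u)"
    by (rule sum_mono) (use assms in simp)
  moreover have "(\<Sum>v\<in>W. \<Sum>u\<in>W. if u = y then f v else 0) \<le> (\<Sum>u\<in>W. f u)"
    by (rule sum_mono) (use assms in simp)
  ultimately show ?thesis by (simp add: sum.distrib)
qed

text \<open>Let \<open>y\<close> be adjacent to \<open>x1\<close> but not to \<open>x2\<close>. Identify the colors of \<open>x1\<close> and \<open>x2\<close> by a partial
  injection \<open>\<pi>\<close> that contains their conflicts. Delete \<open>B\<close> and join \<open>y\<close> to the outside neighbors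
  of \<open>x2\<close>, in such a way that the color \<open>\<pi> b\<close> remains available at \<open>x2\<close> whenever \<open>y\<close> blocks \<open>b\<close>
  at \<open>x1\<close>. Giving \<open>\<pi> b\<close> to \<open>x2\<close> then costs \<open>x1\<close> nothing, so a coloring of the reduced graph
  extends to \<open>B\<close>. Colors of \<open>y\<close> that block a color outside the domain of \<open>\<pi>\<close> are removed. The
  removed colors and new edges together number at most \<open>P\<close>, which the gap forbids.\<close>

lemma clique_same_neighbors:
  assumes B: "B \<subseteq> tight" "simple_clique B" "kap + 1 \<le> card B + P"
    and x: "x1 \<in> B" "x2 \<in> B" "x1 \<noteq> x2" and y: "y \<in> V - B" "0 < m x1 y"
  shows "0 < m x2 y"
proof (rule ccontr)
  assume "\<not> 0 < m x2 y"
  then have y0: "m x2 y = 0" by simp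
  define q where "q = card B - 1"
  have BV: "B \<subseteq> V" using B(1) by (auto simp: tight_def)
  have xV: "x1 \<in> V" "x2 \<in> V" using x BV by auto
  have yV: "y \<in> V" "y \<notin> B" using y by auto
  have finB: "finite B" using BV finite_V finite_subset by blast
  have cardB: "card B = q + 1" using card_gt_0_iff[of B] finB x(1) by (auto simp: q_def)
  have degB: "degree m B x = q" if "x \<in> B" for x
    using simple_clique_degree[OF B(2) BV that] by (simp add: q_def)
  have neq: "y \<noteq> x1" "y \<noteq> x2" using x yV by auto
  have lB: "linked m B" by (rule simple_clique_linked[OF B(2)])
  have lBx: "linked m (B - {x2})" by (rule simple_clique_linked[OF simple_clique_Diff[OF B(2)]])
  define V0 where "V0 = V - B"
  have V0: "V0 \<subseteq> V" "V0 \<noteq> V" "finite V0" "y \<in> V0" "x1 \<notin> V0" "x2 \<notin> V0"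
    using x xV yV finite_V by (auto simp: V0_def)
  obtain L R where LR: "conflict_cover V m L R" "\<forall>v\<in>V. card (L v) = l v"
    "\<nexists>\<phi>. proper_coloring V L R \<phi>" by (rule bad_cover)
  have finL: "finite (L v)" if "v \<in> V" for v by (rule conflict_cover_finite[OF LR(1) that])
  have Rsym: "R u a v b \<longleftrightarrow> R v b u a" for u a v b using conflict_cover_sym[OF LR(1)] by blast
  have m12: "m x1 x2 = 1" "m x2 x1 = 1" using B(2) x by (auto simp: simple_clique_def)
  define E where "E a b \<longleftrightarrow> a \<in> L x1 \<and> b \<in> L x2 \<and> R x1 a x2 b" for a b
  have "union_matchings 1 E"
    using conflict_cover_matchings[OF LR(1) xV x(3)] m12 by (simp add: E_def[abs_def])
  note E = union_matchings_1[OF this] E_def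
  obtain C \<pi> where C: "C \<subseteq> L x1" "card C = min (card (L x1)) (card (L x2))" "inj_on \<pi> C" "\<pi> ` C \<subseteq> L x2"
    "\<And>a b. E a b \<Longrightarrow> a \<in> C \<and> \<pi> a = b"
    by (rule extend_partial_matching[OF finL[OF xV(1)] finL[OF xV(2)] _ E(1,2)]) (auto simp: E_def)
  \<comment> \<open>The star concerns one of the matchings between \<open>y\<close> and \<open>x1\<close>. If the color of \<open>y\<close> is unmatched in it,
    \<open>y\<close> blocks fewer than \<open>m y x1\<close> colors of \<open>x1\<close>, and \<open>x1\<close> has a spare color anyway.\<close>
  have "0 < m y x1" using y(2) sym by simp
  from union_matchings_first[OF conflict_cover_matchings[OF LR(1) yV(1) xV(1) neq(1)] this]
  obtain F where F': "\<forall>a b c. F a b \<longrightarrow> F a c \<longrightarrow> b = c" "\<forall>a b c. F b a \<longrightarrow> F c a \<longrightarrow> b = c"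
    "\<forall>a b. F a b \<longrightarrow> a \<in> L y \<and> b \<in> L x1 \<and> R y a x1 b"
    "\<forall>a. (\<nexists>b. F a b) \<longrightarrow> card {b. a \<in> L y \<and> b \<in> L x1 \<and> R y a x1 b} < m y x1" .
  note F = F'[rule_format]
  define G where "G a c \<longleftrightarrow> (\<exists>b\<in>C. F a b \<and> c = \<pi> b)" for a c
  have G1: "c = c'" if "G a c" "G a c'" for a c c' using that F(1) unfolding G_def by metis
  have G2: "a = a'" if "G a c" "G a' c" for a a' c
    using that F(2) C(3) unfolding G_def inj_on_def by metis
  have G3: "c \<in> L x2" if "G a c" for a c using that C(4) unfolding G_def by auto
  define L0 where "L0 v = (if v = y then {a \<in> L y. \<forall>b. F a b \<longrightarrow> b \<in> C} else L v)" for v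
  define conf where "conf a v b \<longleftrightarrow> (\<exists>c. G a c \<and> R x2 c v b)" for a v b
  define R0 where "R0 u a v b \<longleftrightarrow> R u a v b \<or> u = y \<and> v \<noteq> y \<and> conf a v b \<or> v = y \<and> u \<noteq> y \<and> conf b u a" for u a v b
  define extra where "extra u v = (if u = y then m x2 v else 0) + (if v = y then m x2 u else 0)" for u v
  define m0 where "m0 u v = m u v + extra u v" for u v
  define r where "r = l x1 - l x2"
  define f where "f v = (if v = y then r else 0)" for v
  have L0sub: "L0 v \<subseteq> L v" for v by (auto simp: L0_def)
  have mult0: "multiplicity m0"
    unfolding multiplicity_def m0_def extra_def using sym irrefl y0 by auto
  have pair_y: "union_matchings (m y v + m x2 v) (\<lambda>a b. a \<in> L0 y \<and> b \<in> L0 v \<and> (R y a v b \<or> conf a v b))"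
    if v: "v \<in> V0" "v \<noteq> y" for v
  proof -
    have vV: "v \<in> V" "v \<noteq> x2" using v V0 by auto
    have M1: "union_matchings (m y v) (\<lambda>a b. a \<in> L y \<and> b \<in> L v \<and> R y a v b)"
      by (rule conflict_cover_matchings[OF LR(1) yV(1) vV(1)]) (use v in auto)
    have M2: "union_matchings (m x2 v) (\<lambda>a b. \<exists>c. G a c \<and> (c \<in> L x2 \<and> b \<in> L v \<and> R x2 c v b))"
      by (rule union_matchings_comp[OF conflict_cover_matchings[OF LR(1) xV(2) vV(1)] G1 G2])
        (use vV in auto)
    have imp: "(a \<in> L y \<and> b \<in> L v \<and> R y a v b) \<or> (\<exists>c. G a c \<and> (c \<in> L x2 \<and> b \<in> L v \<and> R x2 c v b))"
      if h: "a \<in> L0 y \<and> b \<in> L0 v \<and> (R y a v b \<or> conf a v b)" for a b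
      using h L0sub[of y] L0sub[of v] G3 unfolding conf_def by blast
    show ?thesis by (rule union_matchings_mono[OF union_matchings_add[OF M1 M2] imp order_refl])
  qed
  have cover0: "conflict_cover V0 m0 L0 R0"
    unfolding conflict_cover_def
  proof (intro conjI ballI impI allI)
    fix v assume "v \<in> V0" then show "finite (L0 v)" using finL[of v] L0sub[of v] V0(1) finite_subset by blast
  next
    fix u a v b assume "R0 u a v b" then show "R0 v b u a" unfolding R0_def using Rsym by blast
  next
    fix u v assume uv: "u \<in> V0" "v \<in> V0" "u \<noteq> v"
    consider "u = y" | "v = y" "u \<noteq> y" | "u \<noteq> y" "v \<noteq> y" by blast
    then show "union_matchings (m0 u v) (\<lambda>a b. a \<in> L0 u \<and> b \<in> L0 v \<and> R0 u a v b)"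
    proof cases
      case 1
      then show ?thesis using pair_y[of v] uv by (simp add: m0_def extra_def R0_def)
    next
      case 2
      have "union_matchings (m y u + m x2 u) (\<lambda>b a. a \<in> L0 y \<and> b \<in> L0 u \<and> (R y a u b \<or> conf a u b))"
        by (rule union_matchings_swap[OF pair_y]) (use uv 2 in auto)
      moreover have "(\<lambda>a b. a \<in> L0 u \<and> b \<in> L0 v \<and> R0 u a v b) = (\<lambda>b a. a \<in> L0 y \<and> b \<in> L0 u \<and> (R y a u b \<or> conf a u b))"
        using 2 Rsym by (auto simp: R0_def fun_eq_iff)
      moreover have "m0 u v = m y u + m x2 u" using 2 sym[of u y] by (simp add: m0_def extra_def)
      ultimately show ?thesis by simp
    next
      case 3
      have "union_matchings (m u v) (\<lambda>a b. a \<in> L u \<and> b \<in> L v \<and> R u a v b)"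
        by (rule conflict_cover_matchings[OF LR(1)]) (use uv V0 in auto)
      then show ?thesis using 3 by (simp add: m0_def extra_def R0_def L0_def)
    qed
  qed
  have size0: "l v - f v \<le> card (L0 v)" if v: "v \<in> V0" for v
  proof (cases "v = y")
    case False then show ?thesis using LR(2) v V0(1) by (auto simp: L0_def f_def)
  next
    case True
    let ?D = "L y - L0 y"
    have "\<exists>b. F a b \<and> b \<in> L x1 - C" if "a \<in> ?D" for a using that F(3) by (auto simp: L0_def)
    then obtain h where h: "\<And>a. a \<in> ?D \<Longrightarrow> F a (h a) \<and> h a \<in> L x1 - C" by metis
    have "inj_on h ?D" using h F(2) unfolding inj_on_def by metis
    moreover have "h ` ?D \<subseteq> L x1 - C" using h by blast
    ultimately have "card ?D \<le> card (L x1 - C)" using finL[OF xV(1)] by (intro card_inj_on_le) auto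
    also have "\<dots> = card (L x1) - card C"
      by (rule card_Diff_subset[OF finite_subset[OF C(1) finL[OF xV(1)]] C(1)])
    also have "\<dots> = r" using LR(2) xV C(2) by (auto simp: r_def)
    finally have "card ?D \<le> r" .
    moreover have "card ?D = card (L y) - card (L0 y)"
      by (rule card_Diff_subset[OF finite_subset[OF L0sub finL[OF yV(1)]] L0sub])
    ultimately show ?thesis using True LR(2) yV(1) by (simp add: f_def)
  qed
  have no0: "\<not> proper_coloring V0 L0 R0 \<phi>" for \<phi>
  proof
    assume p0: "proper_coloring V0 L0 R0 \<phi>"
    then have p: "proper_coloring V0 L R \<phi>"
      using L0sub unfolding proper_coloring_def R0_def by blast
    let ?L = "residual L R V0 \<phi>"
    have T: "tight_cover B m ?L R"
      using residual_tight[OF LR B(1) lB] p unfolding V0_def by blast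
    have py: "\<phi> y \<in> L0 y" using p0 V0(4) by (simp add: proper_coloring_def)
    then have pyL: "\<phi> y \<in> L y" using L0sub by blast
    have dsplit: "l x1 = degree m V0 x1 + q"
      using B(1) x(1) degree_Diff[OF finite_V BV, of m x1] degB[OF x(1)] by (auto simp: tight_def deg_def V0_def)
    show False
    proof (cases "\<exists>b. F (\<phi> y) b")
      case False
      have "card (L x1) \<le> card (?L x1) + (\<Sum>u\<in>V0. card {b \<in> L x1. R u (\<phi> u) x1 b})"
        by (rule residual_card_kills[OF LR(1) V0(1,3) xV(1)])
      moreover have "(\<Sum>u\<in>V0. card {b \<in> L x1. R u (\<phi> u) x1 b}) < (\<Sum>u\<in>V0. m x1 u)"
      proof (rule sum_strict_mono_ex1[OF V0(3)])
        show "\<forall>u\<in>V0. card {b \<in> L x1. R u (\<phi> u) x1 b} \<le> m x1 u"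
        proof
          fix u assume u: "u \<in> V0"
          have "card {b \<in> L x1. R u (\<phi> u) x1 b} \<le> m u x1"
            by (rule conflict_card[OF LR(1)]) (use u V0 xV p in \<open>auto simp: proper_coloring_def\<close>)
          then show "card {b \<in> L x1. R u (\<phi> u) x1 b} \<le> m x1 u" using sym by simp
        qed
        have "card {b. \<phi> y \<in> L y \<and> b \<in> L x1 \<and> R y (\<phi> y) x1 b} < m y x1" by (rule F(4)[OF False])
        then have "card {b \<in> L x1. R y (\<phi> y) x1 b} < m x1 y" using pyL sym[of y x1] by simp
        then show "\<exists>u\<in>V0. card {b \<in> L x1. R u (\<phi> u) x1 b} < m x1 u" using V0(4) by blast
      qed
      ultimately have "q < card (?L x1)" using dsplit LR(2) xV(1) by (simp add: degree_def)
      then show False using tight_cover.card_list[OF T x(1)] degB[OF x(1)] by simp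
    next
      case True
      then obtain b where b: "F (\<phi> y) b" by blast
      then have bC: "b \<in> C" using py by (auto simp: L0_def)
      let ?c = "\<pi> b"
      have G: "G (\<phi> y) ?c" using b bC by (auto simp: G_def)
      have cL: "?c \<in> L x2" by (rule G3[OF G])
      have cres: "?c \<in> ?L x2"
      proof -
        have "\<not> R u (\<phi> u) x2 ?c" if u: "u \<in> V0" for u
        proof (cases "u = y")
          case True
          show ?thesis unfolding True
            by (rule no_conflict_if_nonadjacent[OF LR(1) yV(1) xV(2) neq(2) _ pyL cL]) (use y0 sym in simp)
        next
          case False
          have "\<not> R0 y (\<phi> y) u (\<phi> u)" using p0 u V0(4) False unfolding proper_coloring_def by auto
          then have "\<not> conf (\<phi> y) u (\<phi> u)" using False by (simp add: R0_def)
          then show ?thesis using G Rsym unfolding conf_def by blast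
        qed
        then show ?thesis using cL by (simp add: residual_def)
      qed
      have "card {d \<in> ?L x1. R x2 ?c x1 d} = m x2 x1"
        by (rule tight_cover.kills_exact[OF T lBx x(2,1) x(3)[symmetric] cres])
      then have "card {d \<in> ?L x1. R x2 ?c x1 d} \<noteq> 0" using m12 by simp
      then obtain d where d: "d \<in> ?L x1" "R x2 ?c x1 d" by (metis (mono_tags, lifting) Collect_empty_eq card.empty)
      have "E d ?c" using d cL E(3) Rsym by (auto simp: residual_def)
      then have "d \<in> C" "\<pi> d = ?c" using C(5) by auto
      then have "d = b" using C(3) bC by (auto simp: inj_on_def)
      then have "R y (\<phi> y) x1 d" using F(3)[OF b] by simp
      then show False using d(1) V0(4) by (auto simp: residual_def)
    qed
  qed
  have unc: "uncolorable V0 m0 (\<lambda>v. l v - f v)"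
    by (rule uncolorable_trim[OF cover0 size0]) (use no0 in auto)
  have card0: "card V0 < card V" by (rule psubset_card_mono[OF finite_V]) (use V0 in auto)
  have le0: "l v - f v \<le> kap" if "v \<in> V0" for v using l_le[of v] that V0(1) by auto
  obtain W where W: "W \<subseteq> V0" "W \<noteq> {}"
    "pot m0 (\<lambda>v. l v - f v) W \<le> - int kap \<or> (card W = kap + 1 \<and> (\<forall>u\<in>W. \<forall>v\<in>W. u \<noteq> v \<longrightarrow> 0 < m0 u v))"
    by (rule smaller_uncolorable[OF V0(3) card0 mult0 le0 unc])
  have finW: "finite W" using W(1) V0(3) finite_subset by blast
  have WV: "W \<subseteq> V" "W \<noteq> V" using W(1) V0 by auto
  have lW: "l v \<le> kap" if "v \<in> W" for v using l_le WV(1) that by blast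
  have gap: "(lam - 2) * int kap + lam + 2 \<le> 4 * pot m l W" by (rule potential_ge_gap[OF WV(1) W(2) WV(2)])
  \<comment> \<open>\<open>s\<close> edges are new and \<open>r\<close> colors are removed. Since \<open>l x1 \<le> kap\<close> and \<open>l x2 = s + q\<close>, the removed colors
    make up for a short list at \<open>x2\<close>.\<close>
  define s where "s = degree m V0 x2"
  have sx2: "l x2 = s + q"
    using B(1) x(2) degree_Diff[OF finite_V BV, of m x2] degB[OF x(2)] by (auto simp: tight_def deg_def V0_def s_def)
  have rs: "r + s \<le> P" using l_le[OF xV(1)] l_le[OF xV(2)] sx2 B(3) cardB by (auto simp: r_def)
  have extra_sum: "(\<Sum>v\<in>W. \<Sum>u\<in>W. extra v u) \<le> 2 * s"
  proof -
    have "(\<Sum>v\<in>W. \<Sum>u\<in>W. extra v u) \<le> 2 * (\<Sum>u\<in>W. m x2 u)"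
      unfolding extra_def by (rule star_weight[OF finW])
    also have "(\<Sum>u\<in>W. m x2 u) \<le> (\<Sum>u\<in>V0. m x2 u)" by (rule sum_mono2[OF V0(3) W(1)]) simp
    finally show ?thesis by (simp add: s_def degree_def)
  qed
  have small: "24 * int P \<le> 3 * (int kap + 1)" "lam * int (r + s) \<le> lam * int P"
    using P_small rs lam_ge by (auto intro!: mult_left_mono)
  from W(3) show False
  proof
    assume pW: "pot m0 (\<lambda>v. l v - f v) W \<le> - int kap"
    have "pot m l W \<le> pot m (\<lambda>v. l v - f v) W + (lam + 2) * int (\<Sum>v\<in>W. f v)"
      by (rule potential_shrink) (rule lW)
    moreover have "(\<Sum>v\<in>W. f v) \<le> r" using finW by (simp add: f_def)
    then have "(lam + 2) * int (\<Sum>v\<in>W. f v) \<le> (lam + 2) * int r"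
      using lam_ge by (intro mult_left_mono) (simp_all only: of_nat_le_iff)
    moreover have "pot m (\<lambda>v. l v - f v) W \<le> pot m0 (\<lambda>v. l v - f v) W + (lam + 3) * int (\<Sum>v\<in>W. \<Sum>u\<in>W. extra v u)"
    proof -
      have "(\<Sum>v\<in>W. \<Sum>u\<in>W. cost (m0 v u)) \<le> (\<Sum>v\<in>W. \<Sum>u\<in>W. cost (m v u) + (lam + 3) * int (extra v u))"
        unfolding m0_def by (intro sum_mono edge_cost_add)
      also have "\<dots> = (\<Sum>v\<in>W. \<Sum>u\<in>W. cost (m v u)) + (lam + 3) * int (\<Sum>v\<in>W. \<Sum>u\<in>W. extra v u)"
        by (simp add: sum.distrib sum_distrib_left)
      finally show ?thesis by (simp add: potential_def sum_subtractf)
    qed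
    moreover have "(lam + 3) * int (\<Sum>v\<in>W. \<Sum>u\<in>W. extra v u) \<le> (lam + 3) * int (2 * s)"
      using lam_ge extra_sum by (intro mult_left_mono) (simp_all only: of_nat_le_iff)
    ultimately have "pot m l W \<le> - int kap + (lam + 2) * int r + (lam + 3) * int (2 * s)" using pW by linarith
    moreover have "int r + int s \<le> int P" "0 \<le> lam * int r" using rs lam_ge by auto
    then have "(lam + 2) * int r + (lam + 3) * int (2 * s) \<le> 2 * (lam * int (r + s)) + 6 * int P"
      by (simp add: algebra_simps)
    ultimately have "pot m l W \<le> - int kap + 2 * (lam * int P) + 6 * int P" using small by linarith
    then show False using gap P_gap small lam_ge by (simp add: algebra_simps)
  next
    \<comment> \<open>A clique \<open>K_k\<close> of the reduced graph lacks at most \<open>s\<close> edges in the original one.\<close>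
    assume cW: "card W = kap + 1 \<and> (\<forall>u\<in>W. \<forall>v\<in>W. u \<noteq> v \<longrightarrow> 0 < m0 u v)"
    have "(\<Sum>v\<in>W. \<Sum>u\<in>W. m v u + extra v u) \<ge> (\<Sum>v\<in>W. kap)"
    proof (rule sum_mono)
      fix v assume v: "v \<in> W"
      have "(\<Sum>u\<in>W - {v}. 1) \<le> (\<Sum>u\<in>W - {v}. m v u + extra v u)"
      proof (rule sum_mono)
        fix u assume "u \<in> W - {v}"
        then have u: "u \<in> W" "v \<noteq> u" by auto
        have "0 < m0 v u" by (rule cW[THEN conjunct2, rule_format, OF v u])
        then show "1 \<le> m v u + extra v u" unfolding m0_def by linarith
      qed
      also have "\<dots> \<le> (\<Sum>u\<in>W. m v u + extra v u)" by (rule sum_mono2[OF finW]) auto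
      finally show "kap \<le> (\<Sum>u\<in>W. m v u + extra v u)" using cW v finW by simp
    qed
    then have "(kap + 1) * kap \<le> (\<Sum>v\<in>W. \<Sum>u\<in>W. m v u) + (\<Sum>v\<in>W. \<Sum>u\<in>W. extra v u)"
      using cW by (simp add: sum.distrib)
    then have "(kap + 1) * kap \<le> (\<Sum>v\<in>W. \<Sum>u\<in>W. m v u) + 2 * s" using extra_sum by linarith
    then have "lam * int ((kap + 1) * kap) \<le> lam * int ((\<Sum>v\<in>W. \<Sum>u\<in>W. m v u) + 2 * s)"
      using lam_ge by (intro mult_left_mono) (simp_all only: of_nat_le_iff)
    moreover have "lam * int (\<Sum>v\<in>W. \<Sum>u\<in>W. m v u) \<le> (\<Sum>v\<in>W. \<Sum>u\<in>W. cost (m v u))"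
    proof -
      have "lam * int (\<Sum>v\<in>W. \<Sum>u\<in>W. m v u) = (\<Sum>v\<in>W. \<Sum>u\<in>W. lam * int (m v u))" by (simp add: sum_distrib_left)
      also have "\<dots> \<le> (\<Sum>v\<in>W. \<Sum>u\<in>W. cost (m v u))" by (intro sum_mono edge_cost_ge)
      finally show ?thesis .
    qed
    moreover have "(\<Sum>v\<in>W. val (l v)) \<le> (\<Sum>v\<in>W. int kap * lam + 1)" by (intro sum_mono val_le lW)
    then have "(\<Sum>v\<in>W. val (l v)) \<le> (int kap + 1) * (int kap * lam + 1)" using cW by (simp add: add.commute)
    moreover have "pot m l W = (\<Sum>v\<in>W. val (l v)) - (\<Sum>v\<in>W. \<Sum>u\<in>W. cost (m v u))"
      by (simp add: potential_def sum_subtractf)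
    ultimately have "pot m l W \<le> int kap + 1 + 2 * (lam * int s)" by (simp add: algebra_simps)
    moreover have "lam * int s \<le> lam * int P" using rs lam_ge by (intro mult_left_mono) auto
    ultimately have "4 * pot m l W \<le> 4 * int kap + 4 + 8 * (lam * int P)" by linarith
    then have "(lam - 2) * int kap + lam + 2 \<le> 4 * int kap + 4 + 8 * (lam * int P)" using gap by linarith
    then show False using P_gap by (simp add: algebra_simps)
  qed
qed

definition plain :: "'v \<Rightarrow> bool" where
  "plain x \<longleftrightarrow> x \<in> V \<and> l x = kap \<and> deg x = kap \<and> (\<forall>u\<in>V. m x u \<le> 1)"

text \<open>The threshold is chosen for \<open>clique_rich_neighbor\<close>: two common neighbors of a large clique that
  are not rich keep, between them, more than \<open>kap\<close> colors after everything outside has been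
  colored.\<close>

definition rich :: "'v \<Rightarrow> bool" where
  "rich u \<longleftrightarrow> u \<in> V \<and> 2 * l u + kap + 2 \<le> 2 * deg u + 2 * P"

text \<open>If every color of \<open>A1\<close> and \<open>A2\<close> blocks some color of \<open>p\<close>, then by the pigeonhole principle two
  of them block the same one.\<close>

lemma common_kill:
  assumes LR: "conflict_cover V m L R" "\<forall>v\<in>V. card (L v) = l v"
    and y: "y1 \<in> V" "y2 \<in> V" "y1 \<noteq> p" "y2 \<noteq> p" "m y1 p = 1" "m y2 p = 1" and p: "p \<in> V" "l p = kap"
    and A: "A1 \<subseteq> L y1" "A2 \<subseteq> L y2" "A1 \<noteq> {}" "A2 \<noteq> {}" "kap < card A1 + card A2"
  obtains a1 a2 where "a1 \<in> A1" "a2 \<in> A2" "card ({b \<in> L p. R y1 a1 p b} \<union> {b \<in> L p. R y2 a2 p b}) \<le> 1"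
proof -
  have finL: "finite (L v)" if "v \<in> V" for v by (rule conflict_cover_finite[OF LR(1) that])
  let ?K1 = "\<lambda>a. {b \<in> L p. R y1 a p b}" and ?K2 = "\<lambda>a. {b \<in> L p. R y2 a p b}"
  have K1: "card (?K1 a) \<le> 1" if "a \<in> A1" for a
    using conflict_card[OF LR(1) y(1) p(1) y(3), of a] y(5) A(1) that by auto
  have K2: "card (?K2 a) \<le> 1" if "a \<in> A2" for a
    using conflict_card[OF LR(1) y(2) p(1) y(4), of a] y(6) A(2) that by auto
  have fin: "finite (?K1 a)" "finite (?K2 a)" for a using finL[OF p(1)] by auto
  obtain a10 a20 where a0: "a10 \<in> A1" "a20 \<in> A2" using A(3,4) by blast
  consider (1) a where "a \<in> A1" "?K1 a = {}" | (2) a where "a \<in> A2" "?K2 a = {}"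
    | (3) "\<forall>a\<in>A1. ?K1 a \<noteq> {}" "\<forall>a\<in>A2. ?K2 a \<noteq> {}" by blast
  then show thesis
  proof cases
    case 1
    show ?thesis by (rule that[OF 1(1) a0(2)]) (use K2[OF a0(2)] 1(2) in \<open>simp only: Un_empty_left\<close>)
  next
    case 2
    show ?thesis by (rule that[OF a0(1) 2(1)]) (use K1[OF a0(1)] 2(2) in \<open>simp only: Un_empty_right\<close>)
  next
    case 3
    have "union_matchings 1 (\<lambda>a b. a \<in> L y1 \<and> b \<in> L p \<and> R y1 a p b)"
      using conflict_cover_matchings[OF LR(1) y(1) p(1) y(3)] y(5) by simp
    note inj1 = union_matchings_1(2)[OF this]
    have "union_matchings 1 (\<lambda>a b. a \<in> L y2 \<and> b \<in> L p \<and> R y2 a p b)"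
      using conflict_cover_matchings[OF LR(1) y(2) p(1) y(4)] y(6) by simp
    note inj2 = union_matchings_1(2)[OF this]
    define k1 where "k1 a = (SOME b. b \<in> ?K1 a)" for a
    define k2 where "k2 a = (SOME b. b \<in> ?K2 a)" for a
    have k1: "k1 a \<in> ?K1 a" if "a \<in> A1" for a unfolding k1_def by (rule someI_ex) (use 3 that in blast)
    have k2: "k2 a \<in> ?K2 a" if "a \<in> A2" for a unfolding k2_def by (rule someI_ex) (use 3 that in blast)
    have i1: "inj_on k1 A1"
    proof (rule inj_onI)
      fix a a' assume h: "a \<in> A1" "a' \<in> A1" "k1 a = k1 a'"
      show "a = a'" by (rule inj1[of a "k1 a"]) (use k1[OF h(1)] k1[OF h(2)] h A(1) in auto)
    qed
    have i2: "inj_on k2 A2"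
    proof (rule inj_onI)
      fix a a' assume h: "a \<in> A2" "a' \<in> A2" "k2 a = k2 a'"
      show "a = a'" by (rule inj2[of a "k2 a"]) (use k2[OF h(1)] k2[OF h(2)] h A(2) in auto)
    qed
    have im: "k1 ` A1 \<subseteq> L p" "k2 ` A2 \<subseteq> L p" using k1 k2 by auto
    have "k1 ` A1 \<inter> k2 ` A2 \<noteq> {}"
    proof
      assume e: "k1 ` A1 \<inter> k2 ` A2 = {}"
      have "card A1 + card A2 = card (k1 ` A1) + card (k2 ` A2)" by (simp add: card_image i1 i2)
      also have "\<dots> = card (k1 ` A1 \<union> k2 ` A2)"
        by (rule card_Un_disjoint[symmetric, OF finite_subset[OF im(1) finL[OF p(1)]] finite_subset[OF im(2) finL[OF p(1)]] e])
      also have "\<dots> \<le> card (L p)" by (rule card_mono[OF finL[OF p(1)]]) (use im in blast)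
      also have "\<dots> = kap" using LR(2) p by simp
      finally show False using A(5) by simp
    qed
    then obtain a1 a2 where a: "a1 \<in> A1" "a2 \<in> A2" "k1 a1 = k2 a2" by auto
    have "?K1 a1 = {k1 a1}" using card_seteq[OF fin(1)[of a1], of "{k1 a1}"] k1[OF a(1)] K1[OF a(1)] by auto
    moreover have "?K2 a2 = {k2 a2}" using card_seteq[OF fin(2)[of a2], of "{k2 a2}"] k2[OF a(2)] K2[OF a(2)] by auto
    ultimately have "?K1 a1 \<union> ?K2 a2 = {k1 a1}" using a(3) by simp
    then show ?thesis using that[OF a(1,2)] by simp
  qed
qed

text \<open>By \<open>clique_same_neighbors\<close>, \<open>B\<close> and the set \<open>U\<close> of its outside neighbors have \<open>k\<close> vertices in
  total, and no \<open>K_k\<close> exists, so \<open>U\<close> contains nonadjacent vertices \<open>y1\<close> and \<open>y2\<close>. If \<open>U\<close> has no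
  rich vertex, color everything outside \<open>B \<union> U\<close> first, then \<open>y1\<close> and \<open>y2\<close> so that together they
  block just one color of \<open>p\<close>, then the rest of \<open>U\<close>, and finally \<open>B\<close> with \<open>p\<close> at the end.\<close>

lemma clique_rich_neighbor:
  assumes B: "B \<subseteq> tight" "simple_clique B" "kap + 1 \<le> card B + P" and p: "p \<in> B" "plain p"
  shows "\<exists>u\<in>V - B. rich u \<and> (\<forall>x\<in>B. 0 < m x u)"
proof (rule ccontr)
  assume none: "\<not> ?thesis"
  have BV: "B \<subseteq> V" using B(1) by (auto simp: tight_def)
  have finB: "finite B" using BV finite_V finite_subset by blast
  define q where "q = card B - 1"
  have cardB: "card B = q + 1" using card_gt_0_iff[of B] finB p(1) by (auto simp: q_def)
  have degB: "degree m B x = q" if "x \<in> B" for x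
    using simple_clique_degree[OF B(2) BV that] by (simp add: q_def)
  have pp: "p \<in> V" "l p = kap" "deg p = kap" "\<And>u. u \<in> V \<Longrightarrow> m p u \<le> 1"
    using p(2) by (auto simp: plain_def)
  define U where "U = {u \<in> V - B. 0 < m p u}"
  have UV: "U \<subseteq> V" "U \<inter> B = {}" "finite U" using finite_V by (auto simp: U_def)
  have adj: "0 < m x u" if "x \<in> B" "u \<in> U" for x u
  proof (cases "x = p")
    case True then show ?thesis using that by (simp add: U_def)
  next
    case False
    show ?thesis
      by (rule clique_same_neighbors[OF B p(1) that(1) False[symmetric]]) (use that(2) in \<open>auto simp: U_def\<close>)
  qed
  have nonadj: "m x u = 0" if "x \<in> B" "u \<in> V - B - U" for x u
  proof (rule ccontr)
    assume "m x u \<noteq> 0"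
    then have x0: "0 < m x u" by simp
    have "0 < m p u"
    proof (cases "x = p")
      case False
      show ?thesis by (rule clique_same_neighbors[OF B that(1) p(1) False _ x0]) (use that(2) in auto)
    qed (use x0 in simp)
    then show False using that(2) by (auto simp: U_def)
  qed
  define X where "X = B \<union> U"
  have X: "X \<subseteq> V" "finite X" using BV UV finB by (auto simp: X_def)
  have mpU: "m p u = 1" if "u \<in> U" for u using pp(4)[of u] that by (auto simp: U_def)
  have degU: "degree m U p = card U" unfolding degree_def using mpU by simp
  have degX: "deg v = degree m X v + degree m (V - X) v" for v
    unfolding deg_def by (rule degree_Diff[OF finite_V X(1)])
  have degXBU: "degree m X v = degree m B v + degree m U v" for v
    unfolding X_def by (rule degree_Un[OF finB UV(3)]) (use UV(2) in blast)
  have outB: "degree m (V - X) x = 0" if "x \<in> B" for x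
    unfolding degree_def using nonadj[OF that] by (simp add: X_def)
  have cardU: "q + card U = kap" using degX[of p] degXBU[of p] degB[OF p(1)] degU outB[OF p(1)] pp(3) by simp
  have cardX: "card X = kap + 1"
    using card_Un_disjoint[OF finB UV(3)] UV(2) cardB cardU by (auto simp: X_def Int_commute)
  obtain y1 y2 where y12: "y1 \<in> X" "y2 \<in> X" "y1 \<noteq> y2" "m y1 y2 = 0" using no_clique[OF X(1) cardX] by blast
  have "y1 \<in> U \<and> y2 \<in> U"
  proof (rule ccontr)
    assume "\<not> (y1 \<in> U \<and> y2 \<in> U)"
    then have "0 < m y1 y2"
      using y12 adj[of y1 y2] adj[of y2 y1] sym[of y1 y2] B(2) by (auto simp: X_def simple_clique_def)
    then show False using y12(4) by simp
  qed
  then have y: "y1 \<in> U" "y2 \<in> U" "y1 \<noteq> y2" "m y1 y2 = 0" using y12 by auto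
  have yV: "y1 \<in> V" "y2 \<in> V" "y1 \<notin> B" "y2 \<notin> B" "y1 \<noteq> p" "y2 \<noteq> p" using y UV p(1) by auto
  have poor: "2 * deg u + 2 * P \<le> 2 * l u + kap + 1" if "u \<in> U" for u
  proof -
    have uVB: "u \<in> V - B" using that by (simp add: U_def)
    have all: "\<forall>x\<in>B. 0 < m x u" using adj that by (intro ballI)
    have "\<not> rich u"
    proof
      assume "rich u"
      then have "rich u \<and> (\<forall>x\<in>B. 0 < m x u)" using all by (rule conjI)
      then show False using none uVB by (meson bexI)
    qed
    then show ?thesis using that UV(1) by (auto simp: rich_def)
  qed
  have dB: "card B \<le> degree m B u" if "u \<in> U" for u
  proof -
    have "(\<Sum>x\<in>B. 1) \<le> (\<Sum>x\<in>B. m u x)"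
      by (rule sum_mono) (use adj[OF _ that] sym[of u] in \<open>simp add: Suc_leI\<close>)
    then show ?thesis by (simp add: degree_def)
  qed
  obtain L R where LR: "conflict_cover V m L R" "\<forall>v\<in>V. card (L v) = l v"
    "\<nexists>\<phi>. proper_coloring V L R \<phi>" by (rule bad_cover)
  have finL: "finite (L v)" if "v \<in> V" for v by (rule conflict_cover_finite[OF LR(1) that])
  have VX: "V - X \<subseteq> V" "V - X \<noteq> V" "finite (V - X)" using p(1) pp(1) finite_V by (auto simp: X_def)
  obtain \<phi> where \<phi>: "proper_coloring (V - X) L R \<phi>" by (rule proper_subset_colorable[OF VX(1,2) LR(1,2)])
  let ?L1 = "residual L R (V - X) \<phi>"
  have L1: "card B + l u \<le> card (?L1 u) + deg u" if u: "u \<in> U" for u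
  proof -
    have "card (L u) \<le> card (?L1 u) + degree m (V - X) u"
      by (rule residual_card[OF LR(1) mult VX(1,3) _ \<phi>]) (use u UV in \<open>auto simp: X_def\<close>)
    then show ?thesis using degX[of u] degXBU[of u] dB[OF u] LR(2) u UV by auto
  qed
  have big: "kap < card (?L1 y1) + card (?L1 y2)" "card (?L1 y1) \<noteq> 0" "card (?L1 y2) \<noteq> 0"
    using L1[OF y(1)] L1[OF y(2)] poor[OF y(1)] poor[OF y(2)] B(3) P_small by linarith+
  have ne: "?L1 y1 \<noteq> {}" "?L1 y2 \<noteq> {}" using big by auto
  have myp: "m y1 p = 1" "m y2 p = 1" using mpU[OF y(1)] mpU[OF y(2)] sym[of p y1] sym[of p y2] by simp_all
  obtain a1 a2 where a: "a1 \<in> ?L1 y1" "a2 \<in> ?L1 y2"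
    "card ({b \<in> L p. R y1 a1 p b} \<union> {b \<in> L p. R y2 a2 p b}) \<le> 1"
    by (rule common_kill[OF LR(1,2) yV(1,2,5,6) myp pp(1,2) residual_subset residual_subset ne big(1)])
  define \<psi> where "\<psi> v = (if v = y1 then a1 else a2)" for v
  have noR: "\<not> R y1 a1 y2 a2"
    by (rule no_conflict_if_nonadjacent[OF LR(1) yV(1,2) y(3,4)]) (use a in \<open>auto simp: residual_def\<close>)
  then have noR': "\<not> R y2 a2 y1 a1" using conflict_cover_sym[OF LR(1)] by blast
  have \<psi>: "proper_coloring {y1, y2} ?L1 R \<psi>"
    using a noR noR' y(3) by (auto simp: proper_coloring_def \<psi>_def)
  define S where "S = (V - X) \<union> {y1, y2}"
  define \<chi> where "\<chi> v = (if v \<in> V - X then \<phi> v else \<psi> v)" for v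
  have yX: "y1 \<in> X" "y2 \<in> X" using y by (auto simp: X_def)
  have \<chi>: "proper_coloring S L R \<chi>"
    unfolding S_def \<chi>_def by (rule extend_coloring[OF \<phi> \<psi> _ LR(1)]) (use yX in auto)
  have S: "S \<subseteq> V" "finite S" using X yX finite_V by (auto simp: S_def)
  let ?L2 = "residual L R S \<chi>"
  define T where "T = X - {y1, y2}"
  have T: "T \<subseteq> V" "finite T" "S \<inter> T = {}" "S \<union> T = V" using X yX by (auto simp: S_def T_def)
  have degS: "degree m S v = degree m (V - X) v + m v y1 + m v y2" for v
  proof -
    have "degree m S v = degree m (V - X) v + degree m {y1, y2} v"
      unfolding S_def by (rule degree_Un[OF VX(3)]) (use yX in auto)
    then show ?thesis using y(3) by (simp add: degree_def)
  qed
  have degST: "deg v = degree m S v + degree m T v" for v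
    using degree_Un[OF S(2) T(2,3), of m v] by (simp only: deg_def T(4))
  have L2: "l v \<le> card (?L2 v) + degree m S v" if v: "v \<in> T" for v
    using residual_card[OF LR(1) mult S _ \<chi>, of v] v T LR(2) by auto
  have tightB: "l x = deg x" if "x \<in> B" for x using B(1) that by (auto simp: tight_def)
  have pT: "p \<in> T" "B \<subseteq> T" using p(1) yV by (auto simp: T_def X_def)
  have L2p: "kap \<le> card (?L2 p) + 1"
  proof -
    let ?K = "{b \<in> L p. R y1 a1 p b} \<union> {b \<in> L p. R y2 a2 p b}"
    have "b \<in> ?L2 p \<union> ?K" if b: "b \<in> L p" for b
    proof (rule ccontr)
      assume nb: "b \<notin> ?L2 p \<union> ?K"
      then obtain u where u: "u \<in> S" "R u (\<chi> u) p b" using b by (auto simp: residual_def)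
      have "u \<in> V - X"
      proof (rule ccontr)
        assume "u \<notin> V - X"
        then have "u = y1 \<or> u = y2" using u(1) by (auto simp: S_def)
        then show False using u(2) nb b yX y(3) by (auto simp: \<chi>_def \<psi>_def)
      qed
      then have "m u p = 0" "\<chi> u \<in> L u" "u \<in> V" "u \<noteq> p"
        using nonadj[OF p(1), of u] sym[of u p] \<chi> u(1) p(1) by (auto simp: X_def proper_coloring_def)
      then show False using no_conflict_if_nonadjacent[OF LR(1) _ pp(1), of u "\<chi> u" b] u(2) b by blast
    qed
    then have "L p \<subseteq> ?L2 p \<union> ?K" by blast
    then have "card (L p) \<le> card (?L2 p \<union> ?K)"
      by (rule card_mono[rotated]) (use finL[OF pp(1)] in \<open>auto simp: residual_def\<close>)
    also have "\<dots> \<le> card (?L2 p) + card ?K" by (rule card_Un_le)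
    finally show ?thesis using a(3) LR(2) pp(1,2) by simp
  qed
  have "\<exists>\<theta>. proper_coloring T ?L2 R \<theta>"
  proof (rule greedy_coloring[OF T(2) _ mult])
    show "conflict_cover T m ?L2 R" by (rule conflict_cover_subset[OF LR(1) T(1)]) (rule residual_subset)
    fix Z assume Z: "Z \<subseteq> T" "Z \<noteq> {}"
    have degZ: "degree m T v = degree m Z v + degree m (T - Z) v" for v
      by (rule degree_Diff[OF T(2) Z(1)])
    \<comment> \<open>The vertex \<open>p\<close> has a spare color, vertices of \<open>B\<close> have one as long as \<open>p\<close> is uncolored, and a vertex
      of \<open>U\<close> that is not rich has one as long as \<open>B\<close> is uncolored.\<close>
    show "\<exists>v\<in>Z. degree m Z v < card (?L2 v)"
    proof (cases "p \<in> Z")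
      case True
      have "degree m S p = 2" using degS[of p] outB[OF p(1)] mpU[OF y(1)] mpU[OF y(2)] by simp
      then have "degree m Z p < card (?L2 p)"
        using degZ[of p] degST[of p] pp(3) L2p kap_ge by simp
      then show ?thesis using True by blast
    next
      case pZ: False
      show ?thesis
      proof (cases "Z \<inter> B = {}")
        case False
        then obtain x where x: "x \<in> Z" "x \<in> B" by blast
        have "m x p = 1" using x p(1) pZ B(2) by (auto simp: simple_clique_def)
        moreover have "degree m (T - Z) x = m x p + degree m (T - Z - {p}) x"
          by (rule degree_remove) (use T(2) pT pZ in auto)
        ultimately have "degree m Z x < card (?L2 x)"
          using L2[of x] tightB[OF x(2)] degST[of x] degZ[of x] x Z(1) by auto
        then show ?thesis using x by blast
      next
        case True
        obtain u where u: "u \<in> Z" using Z(2) by blast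
        then have uU: "u \<in> U" using True Z(1) by (auto simp: T_def X_def)
        have "degree m B u \<le> degree m (T - Z) u"
          by (rule degree_mono) (use T(2) pT True in auto)
        then have "card B \<le> degree m (T - Z) u" using dB[OF uU] by linarith
        moreover have "2 * deg u < 2 * l u + 2 * card B" using poor[OF uU] B(3) kap_ge by linarith
        ultimately have "degree m Z u < card (?L2 u)"
          using L2[of u] degST[of u] degZ[of u] u Z(1) by auto
        then show ?thesis using u by blast
      qed
    qed
  qed
  moreover have "T = V - S" using T(3,4) by blast
  ultimately show False using residual_uncolorable[OF LR(1) S(1) \<chi> LR(3)] by simp
qed

section \<open>Discharging\<close>

text \<open>Every edge gives half of its weight to either end, so the charges sum to the potential.\<close>

definition charge :: "'v \<Rightarrow> int" where "charge v = val (l v) - (\<Sum>u\<in>V. cost (m v u))"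

definition parallel :: "'v \<Rightarrow> nat" where "parallel v = (\<Sum>u\<in>V. m v u - 1)"

definition supported :: "'v \<Rightarrow> bool" where "supported x \<longleftrightarrow> plain x \<and> (\<exists>u\<in>V. rich u \<and> 0 < m x u)"

text \<open>Twice the degree that \<open>x\<close> may have among tight vertices. At this degree the remaining edges of
  \<open>x\<close>, which lower its charge by \<open>2 / P\<close> each, bring the charge to exactly \<open>- 1\<close>; for a
  supported vertex the rich neighbor contributes another \<open>2\<close>. A charge below \<open>- 1\<close> leaves room
  for degrees beyond \<open>l x\<close>, which pays for the ends of leaf blocks.\<close>

definition capacity :: "'v \<Rightarrow> int" where
  "capacity x = 2 * int (l x) - int P * (charge x + 1) + (if supported x then 2 * int P else 0)"

lemma charge_eq: "charge v = val (l v) - lam * int (deg v) - 3 * int (parallel v)"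
proof -
  have "(\<Sum>u\<in>V. cost (m v u)) = lam * int (deg v) + 3 * int (parallel v)"
    by (simp add: edge_cost_def deg_def degree_def parallel_def sum.distrib sum_distrib_left)
  then show ?thesis by (simp add: charge_def)
qed

lemma parallel_0: "parallel x = 0 \<longleftrightarrow> (\<forall>u\<in>V. m x u \<le> 1)"
  by (auto simp: parallel_def finite_V)

lemma charge_tight_full: "x \<in> tight \<Longrightarrow> l x = kap \<Longrightarrow> charge x = 1 - 3 * int (parallel x)"
  by (simp add: charge_eq tight_def vertex_value_def)

lemma charge_tight_less: "x \<in> tight \<Longrightarrow> l x \<noteq> kap \<Longrightarrow> charge x = int (l x) - int kap - 3 * int (parallel x)"
  by (simp add: charge_eq tight_def vertex_value_def algebra_simps)

lemma degree_le_parallel: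
  assumes "B \<subseteq> V" "x \<in> B"
  shows "degree m B x \<le> card B - 1 + parallel x"
proof -
  have fin: "finite B" using assms(1) finite_V finite_subset by blast
  have "degree m B x = degree m (B - {x}) x" using degree_remove[OF fin assms(2), of m x] irrefl by simp
  also have "\<dots> \<le> (\<Sum>u\<in>B - {x}. 1 + (m x u - 1))" unfolding degree_def by (rule sum_mono) simp
  also have "\<dots> = card B - 1 + (\<Sum>u\<in>B - {x}. m x u - 1)" using fin assms(2) by (simp only: sum.distrib) simp
  also have "(\<Sum>u\<in>B - {x}. m x u - 1) \<le> parallel x"
    unfolding parallel_def by (rule sum_mono2[OF finite_V]) (use assms in auto)
  finally show ?thesis by simp
qed

text \<open>A vertex without parallel edges and with three neighbors excludes the cycles among the blocks;
  since the block is regular, its edges are then all simple.\<close>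

lemma block_simple_clique:
  assumes B: "B \<subseteq> tight" "biconnected m B" and x: "x \<in> B" "parallel x = 0" "3 \<le> degree m B x"
  shows "simple_clique B" "degree m B x = card B - 1"
proof -
  have BV: "B \<subseteq> V" using B(1) by (auto simp: tight_def)
  have fin: "finite B" using BV finite_V finite_subset by blast
  have ne: "B \<noteq> {}" using x(1) by blast
  obtain L R where T: "tight_block B m L R" by (rule tight_block_exists[OF B(1) ne B(2)])
  have mx: "m x u \<le> 1" if "u \<in> B" for u using x(2) that BV by (auto simp: parallel_0)
  have "degree m B x = (\<Sum>u\<in>B. if 0 < m x u then 1 else 0)"
    unfolding degree_def by (rule sum.cong[OF refl]) (use mx in \<open>fastforce simp: le_Suc_eq\<close>)
  also have "\<dots> = card {u \<in> B. 0 < m x u}" using fin by (simp add: sum.If_cases Int_def)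
  finally have "3 \<le> card {u \<in> B. 0 < m x u}" using x(3) by simp
  note compl = tight_block.complete[OF T x(1) this]
  have "degree m B x = degree m (B - {x}) x" using degree_remove[OF fin x(1), of m x] irrefl by simp
  also have "\<dots> = (\<Sum>u\<in>B - {x}. 1)" unfolding degree_def
  proof (rule sum.cong[OF refl])
    fix u assume u: "u \<in> B - {x}"
    then have "0 < m x u" using compl[of x u] x(1) by auto
    then show "m x u = 1" using mx[of u] u by auto
  qed
  finally show dx: "degree m B x = card B - 1" using fin x(1) by simp
  show "simple_clique B" unfolding simple_clique_def
  proof (intro ballI impI)
    fix u v assume uv: "u \<in> B" "v \<in> B" "u \<noteq> v"
    have pos: "1 \<le> m u w" if "w \<in> B - {u}" for w using compl[of u w] uv(1) that by (auto simp: Suc_leI)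
    show "m u v = 1"
    proof (rule ccontr)
      assume "m u v \<noteq> 1"
      then have "1 < m u v" using pos[of v] uv by auto
      then have "(\<Sum>w\<in>B - {u}. 1) < (\<Sum>w\<in>B - {u}. m u w)"
        by (intro sum_strict_mono_ex1) (use fin pos uv in auto)
      then have "card B - 1 < degree m (B - {u}) u" using fin uv(1) by (simp add: degree_def)
      also have "\<dots> = degree m B u" using degree_remove[OF fin uv(1), of m u] irrefl by simp
      also have "\<dots> = degree m B x" by (rule tight_block.regular[OF T uv(1) x(1)])
      finally show False using dx by simp
    qed
  qed
qed

text \<open>A leaf block with \<open>q + 1\<close> vertices is regular of some degree \<open>d\<close>, so stripping \<open>q\<close> vertices off
  reduces the degree sum by \<open>(q + 1) * d\<close>; this is the share of one of them. Parallel edges have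
  lowered the charge of a vertex enough. Otherwise \<open>d \<le> q\<close>, and the critical case is a block
  that is a large simple clique, whose vertices are supported by \<open>clique_rich_neighbor\<close>.\<close>

lemma capacity_block:
  assumes B: "B \<subseteq> tight" "biconnected m B" "card B = q + 1" "1 \<le> q" and x: "x \<in> B"
  shows "2 * (int q + 1) * int (degree m B x) \<le> int q * capacity x"
proof -
  have BV: "B \<subseteq> V" using B(1) by (auto simp: tight_def)
  have xV: "x \<in> V" "x \<in> tight" "deg x = l x" "l x \<le> kap" using x B(1) l_le by (auto simp: tight_def)
  let ?d = "degree m B x"
  have dl: "?d \<le> l x" using degree_mono[OF finite_V BV, of m x] xV(3) by (simp add: deg_def)
  have dq: "?d \<le> q + parallel x" using degree_le_parallel[OF BV x] B(3) by simp
  show ?thesis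
  proof (cases "parallel x = 0")
    case False
    have "charge x + 1 \<le> - int (parallel x)"
    proof (cases "l x = kap")
      case True then show ?thesis using charge_tight_full[OF xV(2) True] False by simp
    next
      case less: False
      then show ?thesis using charge_tight_less[OF xV(2) less] xV(4) by simp
    qed
    then have "int P * (charge x + 1) \<le> int P * (- int (parallel x))" by (intro mult_left_mono) auto
    moreover have "4 * int (parallel x) \<le> int P * int (parallel x)" using P_ge by (intro mult_right_mono) auto
    ultimately have "2 * int ?d + 4 * int (parallel x) \<le> capacity x" using dl by (simp add: capacity_def)
    then have c: "int q * (2 * int ?d + 4 * int (parallel x)) \<le> int q * capacity x" by (intro mult_left_mono) auto
    have "int q + int (parallel x) \<le> 2 * (int q * int (parallel x))"
    proof -
      have "int q * 1 \<le> int q * int (parallel x)" using False by (intro mult_left_mono) auto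
      moreover have "1 * int (parallel x) \<le> int q * int (parallel x)" using B(4) by (intro mult_right_mono) auto
      ultimately show ?thesis by linarith
    qed
    then have "int ?d \<le> 2 * (int q * int (parallel x))" using dq by linarith
    then show ?thesis using c by (simp add: algebra_simps)
  next
    case par: True
    then have dq': "?d \<le> q" using dq by simp
    have "2 * int ?d + 2 \<le> capacity x"
    proof (cases "l x = kap")
      case True
      have pl: "plain x" using True xV par by (simp add: plain_def parallel_0)
      have cap: "capacity x = 2 * int kap - 2 * int P + (if supported x then 2 * int P else 0)"
        using charge_tight_full[OF xV(2) True] par True by (simp add: capacity_def)
      show ?thesis
      proof (cases "?d < 3")
        case True
        then show ?thesis using cap P_small kap_ge by simp
      next
        case False
        then have "3 \<le> ?d" by simp
        note cl = block_simple_clique[OF B(1,2) x par this]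
        have qk: "q < kap"
        proof (rule ccontr)
          assume "\<not> q < kap"
          then have "card B = kap + 1" using cl(2) dl xV(4) B(3) by simp
          from no_clique[OF BV this] show False using cl(1) unfolding simple_clique_def by fastforce
        qed
        show ?thesis
        proof (cases "supported x")
          case True then show ?thesis using cap cl(2) B(3) qk by simp
        next
          case ns: False
          have "q + 1 + P \<le> kap"
          proof (rule ccontr)
            assume "\<not> q + 1 + P \<le> kap"
            then have "kap + 1 \<le> card B + P" using B(3) by simp
            from clique_rich_neighbor[OF B(1) cl(1) this x pl] have "supported x"
              using pl x by (auto simp: supported_def)
            then show False using ns by simp
          qed
          then show ?thesis using cap cl(2) B(3) ns by simp
        qed
      qed
    next
      case less: False
      then have lk: "l x < kap" using xV(4) by simp
      have "\<not> supported x" using less by (simp add: supported_def plain_def)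
      then have cap: "capacity x = 2 * int (l x) + int P * (int kap - 1 - int (l x))"
        by (simp add: capacity_def charge_tight_less[OF xV(2) less] par algebra_simps)
      have nn: "0 \<le> int P * (int kap - 1 - int (l x))" using lk by simp
      show ?thesis
      proof (cases "?d < l x")
        case True then show ?thesis using cap nn by simp
      next
        case False
        then have dx: "?d = l x" using dl by simp
        show ?thesis
        proof (cases "l x + 2 \<le> kap")
          case True
          then have "int P * 1 \<le> int P * (int kap - 1 - int (l x))" by (intro mult_left_mono) auto
          then show ?thesis using cap dx P_ge by linarith
        next
          case False
          then have lx: "l x + 1 = kap" using lk by simp
          have "3 \<le> ?d" using dx lx kap_ge by simp
          note cl = block_simple_clique[OF B(1,2) x par this]
          \<comment> \<open>The clique \<open>B\<close> has \<open>kap\<close> vertices, and \<open>x\<close> has no neighbors outside. By \<open>clique_same_neighbors\<close> the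
            other vertices have none either, so \<open>B\<close> would be a component.\<close>
          have cB: "card B = kap" using cl(2) dx lx B(3) by simp
          have "B \<noteq> V" using cB many by auto
          then obtain u v where uv: "u \<in> B" "v \<in> V - B" "0 < m u v" using cut_positive[OF BV] x by blast
          have "0 < m x v"
          proof (cases "u = x")
            case True then show ?thesis using uv by simp
          next
            case False
            show ?thesis by (rule clique_same_neighbors[OF B(1) cl(1) _ uv(1) x False uv(2,3)]) (use cB P_ge in simp)
          qed
          moreover have "deg x = ?d + degree m (V - B) x" unfolding deg_def by (rule degree_Diff[OF finite_V BV])
          moreover have "degree m (V - B) x = m x v + degree m (V - B - {v}) x"
            by (rule degree_remove) (use finite_V uv in auto)
          ultimately have False using dx xV(3) by simp
          then show ?thesis ..
        qed
      qed
    qed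
    then have "int q * (2 * int ?d + 2) \<le> int q * capacity x" by (intro mult_left_mono) auto
    then show ?thesis using dq' by (simp add: algebra_simps)
  qed
qed

lemma capacity_nonneg:
  assumes "x \<in> tight"
  shows "0 \<le> capacity x"
proof (cases "l x = kap")
  case True
  have "int P * (charge x + 1) \<le> int P * 2"
    using charge_tight_full[OF assms True] by (intro mult_left_mono) auto
  then show ?thesis using True P_small by (simp add: capacity_def)
next
  case False
  then have "charge x + 1 \<le> 0" using charge_tight_less[OF assms False] l_le[of x] assms by (auto simp: tight_def)
  then have "int P * (charge x + 1) \<le> 0" by (simp add: mult_nonneg_nonpos)
  then show ?thesis by (simp add: capacity_def)
qed

lemma tight_degree_sum:
  "A \<subseteq> tight \<Longrightarrow> 2 * int (\<Sum>x\<in>A. degree m A x) \<le> (\<Sum>x\<in>A. capacity x)"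
proof (induction "card A" arbitrary: A rule: less_induct)
  case less
  have AV: "A \<subseteq> V" using less.prems by (auto simp: tight_def)
  have fin: "finite A" using AV finite_V finite_subset by blast
  show ?case
  proof (cases "A = {}")
    case nonempty: False
    show ?thesis
    proof (cases "\<exists>u\<in>A. degree m A u = 0")
      case True
      then obtain u where u: "u \<in> A" "degree m A u = 0" by blast
      let ?A = "A - {u}"
      have mu: "m x u = 0" if "x \<in> A" for x
        using u(2) fin that sym[of x u] by (simp add: degree_def)
      have "degree m A x = degree m ?A x" if "x \<in> A" for x
        using degree_remove[OF fin u(1), of m x] mu[OF that] by simp
      then have "(\<Sum>x\<in>?A. degree m A x) = (\<Sum>x\<in>?A. degree m ?A x)" by simp
      moreover have "(\<Sum>x\<in>A. degree m A x) = degree m A u + (\<Sum>x\<in>?A. degree m A x)"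
        by (rule sum.remove[OF fin u(1)])
      moreover have "(\<Sum>x\<in>A. capacity x) = capacity u + (\<Sum>x\<in>?A. capacity x)" by (rule sum.remove[OF fin u(1)])
      moreover have "2 * int (\<Sum>x\<in>?A. degree m ?A x) \<le> (\<Sum>x\<in>?A. capacity x)"
        by (rule less.hyps[OF card_Diff1_less[OF fin u(1)]]) (use less.prems in auto)
      moreover have "0 \<le> capacity u" using u(1) less.prems by (intro capacity_nonneg) blast
      ultimately show ?thesis using u(2) by simp
    next
      case False
      then have pos: "degree m A u \<noteq> 0" if "u \<in> A" for u using that by (meson bexI)
      obtain z Q where zQ: "z \<in> A" "Q \<subseteq> A - {z}" "Q \<noteq> {}" "\<forall>u\<in>Q. \<forall>v\<in>A - insert z Q. m u v = 0"
        "biconnected m (insert z Q)" by (rule exists_leaf_block[OF fin mult nonempty pos])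
      let ?B = "insert z Q" and ?A = "A - Q"
      have BA: "?B \<subseteq> A" "z \<notin> Q" "Q \<subseteq> A" using zQ(1,2) by auto
      have Bt: "?B \<subseteq> tight" using BA(1) less.prems by blast
      have finQ: "finite Q" using BA(3) fin finite_subset by blast
      define q where "q = card Q"
      have q: "card ?B = q + 1" "1 \<le> q" using finQ BA(2) zQ(3) card_gt_0_iff[of Q] by (auto simp: q_def)
      have outside: "m u v = 0" if "u \<in> Q" "v \<in> A" "v \<notin> ?B" for u v using zQ(4) that by auto
      have degQ: "degree m A x = degree m ?B x" if "x \<in> Q" for x
      proof -
        have "degree m (A - ?B) x = 0" unfolding degree_def using outside[OF that] by simp
        then show ?thesis using degree_Diff[OF fin BA(1), of m x] by simp
      qed
      obtain L R where T: "tight_block ?B m L R" by (rule tight_block_exists[OF Bt _ zQ(5)]) simp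
      define d where "d = degree m ?B z"
      have dB: "degree m ?B x = d" if "x \<in> ?B" for x
        unfolding d_def by (rule tight_block.regular[OF T that]) simp
      have sQ: "(\<Sum>x\<in>Q. degree m A x) = q * d" using degQ dB by (simp add: q_def)
      have sA: "(\<Sum>x\<in>?A. degree m A x) = (\<Sum>x\<in>?A. degree m ?A x) + d"
      proof -
        have "(\<Sum>x\<in>?A. degree m A x) = (\<Sum>x\<in>?A. degree m Q x + degree m ?A x)"
          using degree_Diff[OF fin BA(3)] by simp
        also have "\<dots> = (\<Sum>x\<in>?A. degree m Q x) + (\<Sum>x\<in>?A. degree m ?A x)" by (rule sum.distrib)
        also have "(\<Sum>x\<in>?A. degree m Q x) = degree m Q z + (\<Sum>x\<in>?A - {z}. degree m Q x)"
          by (rule sum.remove) (use fin zQ(1) BA(2) in auto)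
        also have "(\<Sum>x\<in>?A - {z}. degree m Q x) = 0"
        proof (rule sum.neutral, rule ballI)
          fix x assume "x \<in> ?A - {z}"
          then have "m x u = 0" if "u \<in> Q" for u using outside[OF that, of x] sym[of x u] by auto
          then show "degree m Q x = 0" by (simp add: degree_def)
        qed
        also have "degree m Q z = d"
          using degree_remove[of ?B z m z] finQ BA(2) irrefl by (simp add: d_def)
        finally show ?thesis by simp
      qed
      have split: "(\<Sum>x\<in>A. f x) = (\<Sum>x\<in>?A. f x) + (\<Sum>x\<in>Q. f x)" for f :: "'v \<Rightarrow> 'x::comm_monoid_add"
        by (rule sum.subset_diff[OF BA(3) fin])
      have "(\<Sum>x\<in>Q. 2 * (int q + 1) * int d) \<le> (\<Sum>x\<in>Q. int q * capacity x)"
      proof (rule sum_mono)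
        fix x assume x: "x \<in> Q"
        then show "2 * (int q + 1) * int d \<le> int q * capacity x"
          using capacity_block[OF Bt zQ(5) q, of x] dB[of x] by simp
      qed
      then have "int q * (2 * (int q + 1) * int d) \<le> int q * (\<Sum>x\<in>Q. capacity x)"
        by (simp add: q_def sum_distrib_left)
      then have cQ: "2 * (int q + 1) * int d \<le> (\<Sum>x\<in>Q. capacity x)" using q(2) by simp
      have "2 * int (\<Sum>x\<in>?A. degree m ?A x) \<le> (\<Sum>x\<in>?A. capacity x)"
        by (rule less.hyps) (use less.prems BA zQ fin in \<open>auto intro!: psubset_card_mono\<close>)
      then show ?thesis using cQ sQ sA split[of "degree m A"] split[of capacity] by (simp add: algebra_simps)
    qed
  qed simp
qed

lemma charge_not_tight:
  assumes "y \<in> V - tight"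
  shows "l y < deg y" "charge y \<le> 1 - lam * (int (deg y) - int (l y))"
proof -
  have y: "y \<in> V" "deg y \<noteq> l y" using assms by (auto simp: tight_def)
  show "l y < deg y" using deg_ge[OF y(1)] y(2) by simp
  show "charge y \<le> 1 - lam * (int (deg y) - int (l y))"
    using l_le[OF y(1)] by (auto simp: charge_eq vertex_value_def algebra_simps)
qed

text \<open>The worst case of a vertex that is not rich is one edge more than colors, where \<open>P_large\<close> is
  needed. For a rich vertex the excess of edges over colors is a fixed fraction of its degree,
  so it can afford \<open>2\<close> units on each edge in addition.\<close>

lemma not_tight_budget:
  assumes "y \<in> V - tight"
  shows "int P * (charge y + 1) + 2 * int (deg y) + (if rich y then 2 * int P * int (deg y) else 0) \<le> 0"
proof -
  define e where "e = int (deg y) - int (l y)"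
  have e: "1 \<le> e" "charge y + 1 \<le> 2 - lam * e" using charge_not_tight[OF assms] by (auto simp: e_def)
  have dk: "int (deg y) \<le> int kap + e" using l_le[of y] assms by (auto simp: e_def)
  have c: "int P * (charge y + 1) \<le> int P * (2 - lam * e)" using e by (intro mult_left_mono) auto
  have Pe: "int P * 1 \<le> int P * e" "4 * e \<le> int P * e"
    using e(1) P_ge by (auto intro: mult_left_mono mult_right_mono)
  have lPe: "24 * (int P * e) \<le> lam * (int P * e)" using e(1) lam_ge by (intro mult_right_mono) auto
  show ?thesis
  proof (cases "rich y")
    case False
    have "24 * int P \<le> lam * int P" using lam_ge by (intro mult_right_mono) auto
    then have "1 \<le> lam * int P - 2" using P_ge by linarith
    then have "0 \<le> (e - 1) * (lam * int P - 2)" using e(1) by (intro mult_nonneg_nonneg) auto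
    then show ?thesis using False c dk P_large by (simp add: algebra_simps)
  next
    case True
    then have "int kap + 2 \<le> 2 * e + 2 * int P" by (simp add: rich_def e_def)
    then have "2 * int (deg y) \<le> 7 * e" using dk P_small by linarith
    moreover have "2 * int (deg y) * int P \<le> 7 * e * int P" using calculation by (intro mult_right_mono) auto
    ultimately show ?thesis using True c Pe lPe by (simp add: algebra_simps)
  qed
qed

lemma contradiction: False
proof -
  let ?Y = "V - tight"
  have tV: "tight \<subseteq> V" by (auto simp: tight_def)
  have fin: "finite tight" "finite ?Y" using tV finite_V finite_subset by auto
  let ?S = "{x \<in> tight. supported x}" and ?Rich = "\<lambda>y. if rich y then deg y else 0"
  have cap: "(\<Sum>x\<in>tight. capacity x) =
      2 * int (\<Sum>x\<in>tight. l x) - int P * (\<Sum>x\<in>tight. charge x + 1) + 2 * int P * int (card ?S)"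
  proof -
    have "(\<Sum>x\<in>tight. if supported x then 2 * int P else 0) = 2 * int P * int (card ?S)"
      using fin(1) by (simp add: sum.If_cases Int_def)
    then show ?thesis
      unfolding capacity_def by (simp only: sum.distrib sum_subtractf sum_distrib_left[symmetric] of_nat_sum)
  qed
  have "(\<Sum>x\<in>tight. l x) = (\<Sum>x\<in>tight. degree m tight x) + (\<Sum>x\<in>tight. degree m ?Y x)"
  proof -
    have "l x = degree m tight x + degree m ?Y x" if "x \<in> tight" for x
      using degree_Diff[OF finite_V tV, of m x] that by (simp add: tight_def deg_def)
    then show ?thesis by (simp add: sum.distrib)
  qed
  moreover have "(\<Sum>x\<in>tight. degree m ?Y x) \<le> (\<Sum>y\<in>?Y. deg y)"
  proof -
    have "(\<Sum>x\<in>tight. degree m ?Y x) = (\<Sum>y\<in>?Y. degree m tight y)"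
      unfolding degree_def by (subst sum.swap) (simp add: sym)
    also have "\<dots> \<le> (\<Sum>y\<in>?Y. deg y)"
      unfolding deg_def by (intro sum_mono degree_mono[OF finite_V tV])
    finally show ?thesis .
  qed
  ultimately have A: "int P * (\<Sum>x\<in>tight. charge x + 1) \<le> 2 * int (\<Sum>y\<in>?Y. deg y) + 2 * int P * int (card ?S)"
    using tight_degree_sum[OF order_refl] cap by linarith
  have "card ?S \<le> (\<Sum>y\<in>?Y. ?Rich y)"
  proof -
    let ?N = "\<lambda>u. {x \<in> V. 0 < m x u}"
    let ?Z = "{y \<in> ?Y. rich y}"
    have "?S \<subseteq> (\<Union>u\<in>?Z. ?N u)"
    proof
      fix x assume x: "x \<in> ?S"
      then obtain u where u: "u \<in> V" "rich u" "0 < m x u" by (auto simp: supported_def)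
      have "l u < deg u" using u(2) P_small by (auto simp: rich_def)
      then have "u \<in> ?Z" using u by (auto simp: tight_def)
      moreover have "x \<in> ?N u" using x u(3) tV by auto
      ultimately show "x \<in> (\<Union>u\<in>?Z. ?N u)" by blast
    qed
    then have "card ?S \<le> card (\<Union>u\<in>?Z. ?N u)" by (rule card_mono[rotated]) (use finite_V in auto)
    also have "\<dots> \<le> (\<Sum>u\<in>?Z. card (?N u))" by (rule card_UN_le) (use finite_V in auto)
    also have "\<dots> \<le> (\<Sum>u\<in>?Z. deg u)"
    proof (rule sum_mono)
      fix u
      have "card (?N u) = (\<Sum>x\<in>V. if 0 < m x u then 1 else 0)" using finite_V by (simp add: sum.If_cases Int_def)
      also have "\<dots> \<le> (\<Sum>x\<in>V. m u x)" by (rule sum_mono) (simp add: sym Suc_leI)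
      finally show "card (?N u) \<le> deg u" by (simp add: deg_def degree_def)
    qed
    also have "\<dots> = (\<Sum>y\<in>?Y. ?Rich y)" by (rule sum.inter_filter[OF fin(2)])
    finally show ?thesis .
  qed
  then have "2 * int P * int (card ?S) \<le> 2 * int P * int (\<Sum>y\<in>?Y. ?Rich y)"
    by (intro mult_left_mono of_nat_mono) auto
  then have "int P * (\<Sum>x\<in>tight. charge x + 1) \<le> 2 * int (\<Sum>y\<in>?Y. deg y) + 2 * int P * int (\<Sum>y\<in>?Y. ?Rich y)"
    using A by linarith
  also have "\<dots> = (\<Sum>y\<in>?Y. 2 * int (deg y) + (if rich y then 2 * int P * int (deg y) else 0))"
    unfolding of_nat_sum sum_distrib_left sum.distrib[symmetric] by (rule sum.cong) auto
  finally have "int P * (\<Sum>x\<in>tight. charge x + 1) + (\<Sum>y\<in>?Y. int P * (charge y + 1)) \<le>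
      (\<Sum>y\<in>?Y. int P * (charge y + 1) + 2 * int (deg y) + (if rich y then 2 * int P * int (deg y) else 0))"
    by (simp add: sum.distrib)
  also have "\<dots> \<le> 0" by (rule sum_nonpos) (rule not_tight_budget)
  finally have "int P * (\<Sum>x\<in>tight. charge x + 1) + int P * (\<Sum>y\<in>?Y. charge y + 1) \<le> 0"
    by (simp only: sum_distrib_left)
  moreover have "(\<Sum>v\<in>V. charge v + 1) = (\<Sum>y\<in>?Y. charge y + 1) + (\<Sum>x\<in>tight. charge x + 1)"
    by (rule sum.subset_diff[OF tV finite_V])
  ultimately have "int P * (\<Sum>v\<in>V. charge v + 1) \<le> 0" by (simp add: algebra_simps)
  then have "(\<Sum>v\<in>V. charge v + 1) \<le> 0" using P_ge by (simp add: mult_le_0_iff)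
  then have "pot m l V + int (card V) \<le> 0" by (simp add: potential_def charge_def sum.distrib)
  then show False using pot_V many by linarith
qed

end

section \<open>The potential of critical pairs\<close>

context parameters
begin

text \<open>With \<open>n \<le> kap\<close> vertices, a vertex with at least as many edges as colors has either few colors or
  many parallel edges. In both cases its charge is at most \<open>- (kap - n + 1)\<close>, and
  \<open>n * (kap - n + 1) \<ge> kap\<close>.\<close>

lemma few_vertices:
  assumes "finite V" "card V \<le> kap" "V \<noteq> {}" "multiplicity m" "\<And>v. v \<in> V \<Longrightarrow> l v \<le> kap"
    "\<And>v. v \<in> V \<Longrightarrow> l v \<le> degree m V v"
  shows "pot m l V \<le> - int kap"
proof -
  define n where "n = int (card V)"
  have n: "1 \<le> n" "n \<le> int kap" using assms(1-3) card_gt_0_iff[of V] by (auto simp: n_def)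
  have "val (l v) - (\<Sum>u\<in>V. cost (m v u)) \<le> - (int kap - n + 1)" if v: "v \<in> V" for v
  proof -
    define p where "p = (\<Sum>u\<in>V. m v u - 1)"
    define d where "d = degree m V v"
    have c: "(\<Sum>u\<in>V. cost (m v u)) = lam * int d + 3 * int p"
      by (simp add: edge_cost_def d_def degree_def p_def sum.distrib sum_distrib_left)
    have "d = degree m (V - {v}) v" using degree_remove[OF assms(1) v, of m v] assms(4) by (simp add: d_def multiplicity_def)
    also have "\<dots> \<le> (\<Sum>u\<in>V - {v}. 1 + (m v u - 1))" unfolding degree_def by (rule sum_mono) simp
    also have "\<dots> = card V - 1 + (\<Sum>u\<in>V - {v}. m v u - 1)" using assms(1) v by (simp only: sum.distrib) simp
    also have "(\<Sum>u\<in>V - {v}. m v u - 1) \<le> p" unfolding p_def by (rule sum_mono2[OF assms(1)]) auto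
    finally have dp: "int d \<le> n - 1 + int p" using n by (simp add: n_def)
    have ld: "l v \<le> d" "l v \<le> kap" using assms(5,6) v by (auto simp: d_def)
    have "lam * int (l v) \<le> lam * int d" using ld lam_ge by (intro mult_left_mono) auto
    then show ?thesis using c dp ld n by (auto simp: vertex_value_def algebra_simps)
  qed
  then have "pot m l V \<le> (\<Sum>v\<in>V. - (int kap - n + 1))" unfolding potential_def by (rule sum_mono)
  also have "\<dots> = - (n * (int kap - n + 1))" by (simp add: n_def algebra_simps)
  also have "0 \<le> (n - 1) * (int kap - n)" using n by (intro mult_nonneg_nonneg) auto
  then have "- (n * (int kap - n + 1)) \<le> - int kap" by (simp add: algebra_simps)
  finally show ?thesis .
qed

theorem critical_potential:
  fixes V :: "'v set"
  assumes "finite V" "multiplicity m" "\<And>v. v \<in> V \<Longrightarrow> l v \<le> kap" "critical V m l"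
  shows "pot m l V \<le> - int kap \<or> (card V = kap + 1 \<and> (\<forall>u\<in>V. \<forall>v\<in>V. u \<noteq> v \<longrightarrow> m u v = 1))"
  using assms
proof (induction "card V" arbitrary: V m l rule: less_induct)
  case less
  show ?case
  proof (rule ccontr)
    assume n: "\<not> ?thesis"
    have ne: "V \<noteq> {}" using less.prems(4) unfolding critical_def uncolorable_def proper_coloring_def by auto
    have many: "kap < card V"
    proof (rule ccontr)
      assume "\<not> kap < card V"
      then have "pot m l V \<le> - int kap"
        by (intro few_vertices) (use less.prems ne critical_degree[OF less.prems(1,2,4)] in auto)
      then show False using n by blast
    qed
    have "counterexample kap lam P V m l"
    proof
      show "potential kap lam m0 l0 V0 \<le> - int kap \<or> (card V0 = kap + 1 \<and> (\<forall>u\<in>V0. \<forall>v\<in>V0. u \<noteq> v \<longrightarrow> m0 u v = 1))"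
        if "finite V0" "card V0 < card V" "multiplicity m0" "\<And>v. v \<in> V0 \<Longrightarrow> l0 v \<le> kap" "critical V0 m0 l0"
        for V0 :: "'v set" and m0 l0
        by (rule less.hyps[OF that(2,1,3,4,5)])
    qed (use less.prems n many in auto)
    then show False by (rule counterexample.contradiction)
  qed
qed

end

section \<open>From multigraphs to multiplicities\<close>

definition edge_count :: "('v, 'e) multigraph \<Rightarrow> 'v \<Rightarrow> 'v \<Rightarrow> nat" where
  "edge_count G u v = card (edges_between G u v)"

lemma multiplicity_edge_count:
  assumes "multigraph G"
  shows "multiplicity (edge_count G)"
proof -
  have "edges_between G v v = {}" for v using assms by (auto simp: edges_between_def multigraph_def)
  then have "edge_count G v v = 0" for v by (simp add: edge_count_def)
  moreover have "edge_count G u v = edge_count G v u" for u v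
    by (simp add: edge_count_def edges_between_def insert_commute)
  ultimately show ?thesis unfolding multiplicity_def by blast
qed

lemma uncolorable_if_no_cover_coloring:
  fixes H :: "(nat, nat) multigraph"
  assumes G: "multigraph G" and cov: "ell_cover G l H L" and no: "\<nexists>\<phi>. cover_coloring G H L \<phi>"
  shows "uncolorable (verts G) (edge_count G) l"
proof -
  have H: "multigraph H" and un: "(\<Union>v\<in>verts G. L v) = verts H"
    and size: "\<forall>v\<in>verts G. card (L v) = l v"
    and mat: "\<And>u v. u \<in> verts G \<Longrightarrow> v \<in> verts G \<Longrightarrow> u \<noteq> v \<Longrightarrow>
      union_of_matchings (induced_subgraph H (L u \<union> L v)) (card (edges_between G u v))"
    using cov unfolding ell_cover_def correspondence_cover_def by auto
  have LH: "L v \<subseteq> verts H" if "v \<in> verts G" for v using un that by auto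
  have finH: "finite (verts H)" and eH: "\<And>e. e \<in> edges H \<Longrightarrow> ends H e \<subseteq> verts H \<and> card (ends H e) = 2"
    using H by (auto simp: multigraph_def)
  define R :: "'a \<Rightarrow> nat \<Rightarrow> 'a \<Rightarrow> nat \<Rightarrow> bool" where "R u a v b \<longleftrightarrow> (\<exists>e\<in>edges H. ends H e = {a, b})" for u a v b
  have "conflict_cover (verts G) (edge_count G) L R"
    unfolding conflict_cover_def
  proof (intro conjI ballI allI impI)
    show "finite (L v)" if "v \<in> verts G" for v using LH[OF that] finH finite_subset by blast
    show "R v b u a" if "R u a v b" for u a v b using that by (simp add: R_def insert_commute)
    fix u v assume uv: "u \<in> verts G" "v \<in> verts G" "u \<noteq> v"
    let ?n = "edge_count G u v" and ?H = "induced_subgraph H (L u \<union> L v)"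
    obtain M where M: "\<forall>i<?n. matching ?H (M i)" "edges ?H = (\<Union>i<?n. M i)"
      using mat[OF uv] unfolding union_of_matchings_def edge_count_def by blast
    have edgesH: "edges ?H = {e \<in> edges H. ends H e \<subseteq> L u \<union> L v}" "ends ?H = ends H"
      by (simp_all add: induced_subgraph_def)
    have MH: "e \<in> edges H" if "i < ?n" "e \<in> M i" for i e using M(2) that edgesH(1) by blast
    have disj: "e = f" if "i < ?n" "e \<in> M i" "f \<in> M i" "a \<in> ends H e" "a \<in> ends H f" for i e f a
      using M(1) that unfolding matching_def edgesH(2) by blast
    have distinct: "a \<noteq> b" if "e \<in> edges H" "ends H e = {a, b}" for e a b using eH[OF that(1)] that(2) by auto
    show "union_matchings ?n (\<lambda>a b. a \<in> L u \<and> b \<in> L v \<and> R u a v b)"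
    proof (rule union_matchingsI[where M = "\<lambda>i a b. a \<in> L u \<and> b \<in> L v \<and> (\<exists>e\<in>M i. ends H e = {a, b})"])
      fix i a b c assume i: "i < ?n"
      show "b = c" if h: "a \<in> L u \<and> b \<in> L v \<and> (\<exists>e\<in>M i. ends H e = {a, b})"
        "a \<in> L u \<and> c \<in> L v \<and> (\<exists>e\<in>M i. ends H e = {a, c})"
      proof -
        obtain e f where ef: "e \<in> M i" "ends H e = {a, b}" "f \<in> M i" "ends H f = {a, c}" using h by blast
        have "e = f" using disj[OF i ef(1,3), of a] ef by simp
        then show ?thesis using ef distinct[OF MH[OF i ef(1)] ef(2)] by (auto simp: doubleton_eq_iff)
      qed
      show "b = c" if h: "b \<in> L u \<and> a \<in> L v \<and> (\<exists>e\<in>M i. ends H e = {b, a})"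
        "c \<in> L u \<and> a \<in> L v \<and> (\<exists>e\<in>M i. ends H e = {c, a})"
      proof -
        obtain e f where ef: "e \<in> M i" "ends H e = {b, a}" "f \<in> M i" "ends H f = {c, a}" using h by blast
        have "e = f" using disj[OF i ef(1,3), of a] ef by simp
        then show ?thesis using ef distinct[OF MH[OF i ef(1)] ef(2)] by (auto simp: doubleton_eq_iff)
      qed
    next
      fix a b
      show "a \<in> L u \<and> b \<in> L v \<and> R u a v b \<longleftrightarrow> (\<exists>i<?n. a \<in> L u \<and> b \<in> L v \<and> (\<exists>e\<in>M i. ends H e = {a, b}))"
      proof
        assume h: "a \<in> L u \<and> b \<in> L v \<and> R u a v b"
        then obtain e where e: "e \<in> edges H" "ends H e = {a, b}" by (auto simp: R_def)
        then have "e \<in> edges ?H" using h by (auto simp: edgesH)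
        then obtain i where "i < ?n" "e \<in> M i" using M(2) by auto
        then show "\<exists>i<?n. a \<in> L u \<and> b \<in> L v \<and> (\<exists>e\<in>M i. ends H e = {a, b})" using h e by blast
      next
        assume "\<exists>i<?n. a \<in> L u \<and> b \<in> L v \<and> (\<exists>e\<in>M i. ends H e = {a, b})"
        then show "a \<in> L u \<and> b \<in> L v \<and> R u a v b" using MH by (auto simp: R_def)
      qed
    qed
  qed
  moreover have "\<not> proper_coloring (verts G) L R \<phi>" for \<phi>
  proof
    assume p: "proper_coloring (verts G) L R \<phi>"
    then have pL: "\<phi> v \<in> L v" if "v \<in> verts G" for v using that by (simp add: proper_coloring_def)
    have "independent H (\<phi> ` verts G)" unfolding independent_def
    proof (intro conjI ballI notI)
      show "\<phi> ` verts G \<subseteq> verts H" using pL LH by auto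
      fix e assume e: "e \<in> edges H" "ends H e \<subseteq> \<phi> ` verts G"
      obtain a b where ab: "ends H e = {a, b}" "a \<noteq> b" using eH[OF e(1)] by (auto simp: card_2_iff)
      obtain u v where uv: "u \<in> verts G" "v \<in> verts G" "a = \<phi> u" "b = \<phi> v" using e(2) ab(1) by auto
      then have "u \<noteq> v" using ab(2) by auto
      then have "\<not> R u (\<phi> u) v (\<phi> v)" using p uv by (simp add: proper_coloring_def)
      then show False using e(1) ab(1) uv(3,4) by (auto simp: R_def)
    qed
    then have "cover_coloring G H L \<phi>" using pL by (simp add: cover_coloring_def)
    then show False using no by blast
  qed
  ultimately show ?thesis unfolding uncolorable_def using size by (intro exI[of _ L] exI[of _ R]) simp
qed

text \<open>Pairs of a vertex and a color become the vertices of the cover, and unordered pairs of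
  conflicting ones become its edges.\<close>

lemma no_cover_coloring_if_uncolorable:
  fixes G :: "('v, 'e) multigraph"
  assumes G: "multigraph G" and unc: "uncolorable (verts G) (edge_count G) l"
  shows "\<exists>(H :: (nat, nat) multigraph) L. ell_cover G l H L \<and> (\<nexists>\<phi>. cover_coloring G H L \<phi>)"
proof -
  let ?V = "verts G" and ?m = "edge_count G"
  obtain L R where LR: "conflict_cover ?V ?m L R" "\<forall>v\<in>?V. card (L v) = l v" "\<nexists>\<phi>. proper_coloring ?V L R \<phi>"
    using unc unfolding uncolorable_def by (elim exE conjE)
  have finV: "finite ?V" using G by (simp add: multigraph_def)
  have Rsym: "R v b u a" if "R u a v b" for u a v b by (rule conflict_cover_sym[OF LR(1) that])
  define L' where "L' v = {v} \<times> L v" for v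
  define E where "E = {{(u, a), (v, b)} | u a v b. u \<in> ?V \<and> v \<in> ?V \<and> u \<noteq> v \<and> a \<in> L u \<and> b \<in> L v \<and> R u a v b}"
  define H :: "('v \<times> nat, ('v \<times> nat) set) multigraph" where
    "H = \<lparr>verts = (\<Union>v\<in>?V. L' v), edges = E, ends = (\<lambda>e. e)\<rparr>"
  have H: "verts H = (\<Union>v\<in>?V. L' v)" "edges H = E" "ends H e = e" for e by (simp_all add: H_def)
  have E_I: "{(u, a), (v, b)} \<in> E" if "u \<in> ?V" "v \<in> ?V" "u \<noteq> v" "a \<in> L u" "b \<in> L v" "R u a v b" for u a v b
    unfolding E_def using that by blast
  have E_E: "\<exists>u a v b. e = {(u, a), (v, b)} \<and> u \<in> ?V \<and> v \<in> ?V \<and> u \<noteq> v \<and> a \<in> L u \<and> b \<in> L v \<and> R u a v b"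
    if "e \<in> E" for e using that unfolding E_def by simp
  have finL: "finite (L' v)" if "v \<in> ?V" for v using conflict_cover_finite[OF LR(1) that] by (simp add: L'_def)
  have finH: "finite (verts H)" using finV finL by (simp add: H)
  have EH: "e \<subseteq> verts H \<and> card e = 2" if "e \<in> E" for e
    using E_E[OF that] by (auto simp: H L'_def card_insert_if)
  have mH: "multigraph H" unfolding multigraph_def
  proof (intro conjI ballI)
    have "E \<subseteq> Pow (verts H)" using EH by blast
    then show "finite (edges H)" using finH by (simp add: H(2) finite_subset)
  qed (use finH EH in \<open>auto simp: H\<close>)
  have "ell_cover G l H L'"
    unfolding ell_cover_def correspondence_cover_def
  proof (intro conjI ballI impI)
    show "multigraph H" by (rule mH)
    show "independent H (L' v)" if v: "v \<in> ?V" for v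
      unfolding independent_def
    proof (intro conjI ballI notI)
      show "L' v \<subseteq> verts H" using v by (auto simp: H)
      fix e assume "e \<in> edges H" "ends H e \<subseteq> L' v"
      then show False using E_E[of e] by (auto simp: H L'_def)
    qed
    show "disjoint_family_on L' ?V" by (auto simp: disjoint_family_on_def L'_def)
    show "(\<Union>v\<in>?V. L' v) = verts H" by (simp add: H)
    show "card (L' v) = l v" if "v \<in> ?V" for v using LR(2) that
      by (simp add: L'_def card_cartesian_product_singleton)
    fix u v assume uv: "u \<in> ?V" "v \<in> ?V" "u \<noteq> v"
    have "union_matchings (?m u v) (\<lambda>a b. a \<in> L u \<and> b \<in> L v \<and> R u a v b)"
      by (rule conflict_cover_matchings[OF LR(1) uv])
    then obtain M where M: "\<forall>i<?m u v. partial_matching (M i)"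
      "\<forall>a b. (a \<in> L u \<and> b \<in> L v \<and> R u a v b) \<longleftrightarrow> (\<exists>i<?m u v. M i a b)"
      unfolding union_matchings_def by (elim exE conjE)
    let ?H = "induced_subgraph H (L' u \<union> L' v)"
    have ind: "edges ?H = {e \<in> E. e \<subseteq> L' u \<union> L' v}" "ends ?H e = e" for e
      by (simp_all add: induced_subgraph_def H)
    define N where "N i = {{(u, a), (v, b)} | a b. M i a b}" for i
    have MD: "a \<in> L u \<and> b \<in> L v \<and> R u a v b" if "i < ?m u v" "M i a b" for i a b using M(2) that by blast
    have "matching ?H (N i)" if i: "i < ?m u v" for i
      unfolding matching_def
    proof (intro conjI ballI impI)
      show "N i \<subseteq> edges ?H"
      proof
        fix e assume "e \<in> N i"
        then obtain a b where e: "e = {(u, a), (v, b)}" "M i a b" by (auto simp: N_def)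
        then have "e \<in> E" using MD[OF i e(2)] E_I[OF uv] by simp
        moreover have "e \<subseteq> L' u \<union> L' v" using MD[OF i e(2)] by (simp add: e(1) L'_def)
        ultimately show "e \<in> edges ?H" by (simp only: ind mem_Collect_eq)
      qed
      fix e f assume ef: "e \<in> N i" "f \<in> N i" "e \<noteq> f"
      obtain a b c d where h: "e = {(u, a), (v, b)}" "M i a b" "f = {(u, c), (v, d)}" "M i c d"
        using ef(1,2) by (auto simp: N_def)
      have "a = c \<longleftrightarrow> b = d" using M(1)[rule_format, OF i] h(2,4) by metis
      then have "a \<noteq> c" "b \<noteq> d" using ef(3) h(1,3) by auto
      then show "ends ?H e \<inter> ends ?H f = {}" using uv(3) by (simp add: ind h)
    qed
    moreover have "edges ?H = (\<Union>i<?m u v. N i)"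
    proof
      show "(\<Union>i<?m u v. N i) \<subseteq> edges ?H" using calculation by (auto simp: matching_def)
      show "edges ?H \<subseteq> (\<Union>i<?m u v. N i)"
      proof
        fix e assume "e \<in> edges ?H"
        then have e: "e \<in> E" "e \<subseteq> L' u \<union> L' v" by (auto simp: ind)
        obtain u' a v' b where h: "e = {(u', a), (v', b)}" "u' \<noteq> v'" "a \<in> L u'" "b \<in> L v'" "R u' a v' b"
          using E_E[OF e(1)] by blast
        have "u' \<in> {u, v}" "v' \<in> {u, v}" using e(2) h(1) by (auto simp: L'_def)
        then consider "u' = u" "v' = v" | "u' = v" "v' = u" using h(2) by auto
        then have "\<exists>a b. e = {(u, a), (v, b)} \<and> a \<in> L u \<and> b \<in> L v \<and> R u a v b"
        proof cases
          case 1 then show ?thesis using h by blast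
        next
          case 2
          then have "e = {(u, b), (v, a)}" "b \<in> L u" "a \<in> L v" "R u b v a" using h Rsym by (auto simp: insert_commute)
          then show ?thesis by blast
        qed
        then obtain a b where ab: "e = {(u, a), (v, b)}" "a \<in> L u \<and> b \<in> L v \<and> R u a v b" by blast
        then obtain i where i: "i < ?m u v" "M i a b" using M(2) by blast
        then have "e \<in> N i" using ab(1) by (auto simp: N_def)
        then show "e \<in> (\<Union>i<?m u v. N i)" using i(1) by blast
      qed
    qed
    ultimately show "union_of_matchings ?H (card (edges_between G u v))"
      unfolding union_of_matchings_def edge_count_def by blast
  qed
  moreover have "\<not> cover_coloring G H L' \<phi>" for \<phi>
  proof
    assume c: "cover_coloring G H L' \<phi>"
    then have cL: "\<phi> v \<in> L' v" if "v \<in> ?V" for v using that by (simp add: cover_coloring_def)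
    have \<phi>: "\<phi> v = (v, snd (\<phi> v))" "snd (\<phi> v) \<in> L v" if "v \<in> ?V" for v
      using cL[OF that] by (auto simp: L'_def)
    have "proper_coloring ?V L R (\<lambda>v. snd (\<phi> v))" unfolding proper_coloring_def
    proof (intro conjI ballI impI notI)
      fix u v assume uv: "u \<in> ?V" "v \<in> ?V" "u \<noteq> v" "R u (snd (\<phi> u)) v (snd (\<phi> v))"
      have "{(u, snd (\<phi> u)), (v, snd (\<phi> v))} \<in> E" by (rule E_I[OF uv(1-3) \<phi>(2)[OF uv(1)] \<phi>(2)[OF uv(2)] uv(4)])
      then have "{\<phi> u, \<phi> v} \<in> E" using \<phi>(1)[OF uv(1)] \<phi>(1)[OF uv(2)] by simp
      moreover have "independent H (\<phi> ` ?V)" using c by (simp add: cover_coloring_def)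
      ultimately show False using uv(1,2) by (auto simp: independent_def H)
    qed (use \<phi> in auto)
    then show False using LR(3) by blast
  qed
  ultimately show ?thesis using ell_cover_nat[of G l H L'] by blast
qed

text \<open>Edges are chosen for unordered pairs, so that both orders of the ends give the same edges.\<close>

lemma subgraph_with_multiplicity:
  fixes G :: "('v, 'e) multigraph"
  assumes G: "multigraph G" and V': "V' \<subseteq> verts G" and m': "multiplicity m'"
    and le: "\<forall>u v. m' u v \<le> edge_count G u v"
  obtains G' :: "('v, 'e) multigraph" where "subgraph G' G" "verts G' = V'"
    "\<And>u v. u \<in> V' \<Longrightarrow> v \<in> V' \<Longrightarrow> edge_count G' u v = m' u v"
proof -
  have "\<exists>F. \<forall>u v. p = {u, v} \<longrightarrow> F \<subseteq> edges_between G u v \<and> card F = m' u v" for p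
  proof (cases "\<exists>u v. p = {u, v}")
    case True
    then obtain u v where p: "p = {u, v}" by blast
    obtain F where F: "F \<subseteq> edges_between G u v" "card F = m' u v"
      using obtain_subset_with_card_n[of "m' u v" "edges_between G u v"] le by (metis edge_count_def)
    have "F \<subseteq> edges_between G a b \<and> card F = m' a b" if "p = {a, b}" for a b
    proof -
      have "{a, b} = {u, v}" "m' a b = m' u v"
        using that p m' by (auto simp: doubleton_eq_iff multiplicity_def)
      then show ?thesis using F by (simp add: edges_between_def)
    qed
    then show ?thesis by blast
  qed simp
  then obtain F where F: "\<And>p u v. p = {u, v} \<Longrightarrow> F p \<subseteq> edges_between G u v \<and> card (F p) = m' u v" by metis
  define G' where "G' = \<lparr>verts = V', edges = (\<Union>u\<in>V'. \<Union>v\<in>V'. F {u, v}), ends = ends G\<rparr>"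
  have G': "verts G' = V'" "edges G' = (\<Union>u\<in>V'. \<Union>v\<in>V'. F {u, v})" "ends G' = ends G" by (simp_all add: G'_def)
  have FE: "e \<in> edges G \<and> ends G e = {u, v}" if "e \<in> F {u, v}" for e u v
    using F[of "{u, v}" u v] that by (auto simp: edges_between_def)
  have sub: "edges G' \<subseteq> edges G" using FE by (auto simp: G')
  have "multigraph G'" unfolding multigraph_def
  proof (intro conjI ballI)
    show "finite (verts G')" using V' G finite_subset by (auto simp: G' multigraph_def)
    show "finite (edges G')" using sub G finite_subset by (auto simp: multigraph_def)
    fix e assume e: "e \<in> edges G'"
    then show "ends G' e \<subseteq> verts G'" using FE by (auto simp: G')
    show "card (ends G' e) = 2" using e sub G by (auto simp: G'(3) multigraph_def)
  qed
  then have "subgraph G' G" using sub V' by (simp add: subgraph_def G'(1,3))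
  moreover have "edge_count G' u v = m' u v" if uv: "u \<in> V'" "v \<in> V'" for u v
  proof -
    have "edges_between G' u v = F {u, v}"
    proof
      show "F {u, v} \<subseteq> edges_between G' u v" using FE uv by (auto simp: edges_between_def G')
      show "edges_between G' u v \<subseteq> F {u, v}"
      proof
        fix e assume "e \<in> edges_between G' u v"
        then obtain a b where "e \<in> F {a, b}" "ends G e = {u, v}" by (auto simp: edges_between_def G')
        moreover from this have "{a, b} = {u, v}" using FE by auto
        ultimately show "e \<in> F {u, v}" by simp
      qed
    qed
    then show ?thesis using F[of "{u, v}" u v] by (simp add: edge_count_def)
  qed
  ultimately show thesis using that G'(1) by blast
qed

lemma minimal_critical:
  assumes G: "multigraph G" and min: "minimal G l"
  shows "critical (verts G) (edge_count G) l"
  unfolding critical_def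
proof (intro conjI allI impI)
  obtain H :: "(nat, nat) multigraph" and L where "ell_cover G l H L" "\<nexists>\<phi>. cover_coloring G H L \<phi>"
    using min unfolding minimal_def by blast
  then show "uncolorable (verts G) (edge_count G) l" by (rule uncolorable_if_no_cover_coloring[OF G])
next
  fix V' m'
  assume h: "V' \<subseteq> verts G \<and> multiplicity m' \<and> (\<forall>u v. m' u v \<le> edge_count G u v) \<and>
    (V' \<noteq> verts G \<or> (\<exists>u\<in>verts G. \<exists>v\<in>verts G. m' u v \<noteq> edge_count G u v))"
  obtain G' where G': "subgraph G' G" "verts G' = V'"
    "\<And>u v. u \<in> V' \<Longrightarrow> v \<in> V' \<Longrightarrow> edge_count G' u v = m' u v"
    using subgraph_with_multiplicity[OF G, of V' m'] h by metis
  have "proper_subgraph G' G"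
  proof (cases "V' = verts G")
    case True
    then obtain u v where "u \<in> verts G" "v \<in> verts G" "edge_count G' u v \<noteq> edge_count G u v"
      using h G'(3) by metis
    then have "edges_between G' u v \<noteq> edges_between G u v" by (auto simp: edge_count_def)
    then have "edges G' \<noteq> edges G" using G'(1) by (auto simp: edges_between_def subgraph_def)
    then show ?thesis using G'(1) by (simp add: proper_subgraph_def)
  next
    case False then show ?thesis using G' by (simp add: proper_subgraph_def)
  qed
  then have col: "\<exists>\<phi>. cover_coloring G' H' L' \<phi>" if "ell_cover G' l H' L'" for H' :: "(nat, nat) multigraph" and L'
    using min that unfolding minimal_def by blast
  have mG': "multigraph G'" using G'(1) by (simp add: subgraph_def)
  show "\<not> uncolorable V' m' l"
  proof
    assume "uncolorable V' m' l"
    then have "uncolorable (verts G') (edge_count G') l"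
      using uncolorable_cong[of V' m' l "edge_count G'"] G'(2,3) by simp
    from no_cover_coloring_if_uncolorable[OF mG' this] show False using col by blast
  qed
qed

text \<open>By antisymmetry, the edges between two given vertices have at most one first member; and each
  edge occurs for two ordered pairs of ends.\<close>

lemma rho_le_potential:
  assumes G: "multigraph G" and r: "linear_order_on (edges G) r" and lam: "0 \<le> lam"
    and l: "\<forall>v\<in>verts G. int (l v) \<le> k - 1" and k: "k = int kap + 1"
  shows "rho k lam G l r \<le> potential kap lam (edge_count G) l (verts G)"
proof -
  let ?V = "verts G" and ?E = "edges G" and ?m = "edge_count G"
  have fin: "finite ?V" "finite ?E" and en: "\<And>e. e \<in> ?E \<Longrightarrow> ends G e \<subseteq> ?V \<and> card (ends G e) = 2"
    using G by (auto simp: multigraph_def)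
  let ?w = "\<lambda>e. - rho_edge lam G r e"
  have pair: "2 * edge_cost lam (?m u v) \<le> (\<Sum>e\<in>edges_between G u v. ?w e)" for u v
  proof -
    let ?F = "edges_between G u v"
    let ?first = "\<lambda>e. \<forall>f\<in>?E. ends G f = ends G e \<longrightarrow> (e, f) \<in> r"
    have finF: "finite ?F" using fin(2) by (simp add: edges_between_def)
    have anti: "antisym r" using r by (simp add: linear_order_on_def partial_order_on_def)
    have one: "e = f" if "e \<in> ?F" "?first e" "f \<in> ?F" "?first f" for e f
    proof -
      have "(e, f) \<in> r" "(f, e) \<in> r" using that by (auto simp: edges_between_def)
      then show ?thesis using anti by (simp add: antisym_def)
    qed
    have "card {e \<in> ?F. ?first e} \<le> 1"
      using one finF by (intro card_le_Suc0_iff_eq[THEN iffD2, unfolded One_nat_def[symmetric]]) auto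
    moreover have "(\<Sum>e\<in>?F. ?w e) = (\<Sum>e\<in>?F. 2 * lam + 6 - (if ?first e then 6 else 0))"
      by (rule sum.cong[OF refl]) (simp add: rho_edge_def mu_def)
    moreover have "(\<Sum>e\<in>?F. if ?first e then 6 else (0::int)) = 6 * int (card {e \<in> ?F. ?first e})"
      using finF by (simp add: sum.If_cases Int_def)
    ultimately have "(2 * lam + 6) * int (card ?F) - 6 \<le> (\<Sum>e\<in>?F. ?w e)"
      by (simp add: sum_subtractf algebra_simps)
    moreover have "?F = {} \<or> 1 \<le> card ?F" using finF by (simp add: Suc_le_eq card_gt_0_iff)
    ultimately show ?thesis
      by (auto simp: edge_cost_def edge_count_def of_nat_diff algebra_simps)
  qed
  have "(\<Sum>u\<in>?V. \<Sum>v\<in>?V. \<Sum>e\<in>edges_between G u v. ?w e) = (\<Sum>u\<in>?V. \<Sum>v\<in>?V. \<Sum>e\<in>?E. if ends G e = {u, v} then ?w e else 0)"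
    unfolding edges_between_def using fin(2) by (simp add: sum.inter_filter)
  also have "\<dots> = (\<Sum>u\<in>?V. \<Sum>e\<in>?E. \<Sum>v\<in>?V. if ends G e = {u, v} then ?w e else 0)"
    by (rule sum.cong[OF refl], rule sum.swap)
  also have "\<dots> = (\<Sum>e\<in>?E. \<Sum>u\<in>?V. \<Sum>v\<in>?V. if ends G e = {u, v} then ?w e else 0)"
    by (rule sum.swap)
  also have "\<dots> = (\<Sum>e\<in>?E. 2 * ?w e)"
  proof (rule sum.cong[OF refl])
    fix e assume e: "e \<in> ?E"
    obtain a b where ab: "ends G e = {a, b}" "a \<noteq> b" using en[OF e] by (auto simp: card_2_iff)
    have abV: "a \<in> ?V" "b \<in> ?V" using en[OF e] ab by auto
    have "(\<Sum>u\<in>?V. \<Sum>v\<in>?V. if ends G e = {u, v} then ?w e else 0) =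
        (\<Sum>(u, v)\<in>?V \<times> ?V. if ends G e = {u, v} then ?w e else 0)"
      by (rule sum.cartesian_product)
    also have "\<dots> = (\<Sum>(u, v)\<in>{(a, b), (b, a)}. if ends G e = {u, v} then ?w e else 0)"
    proof (rule sum.mono_neutral_right)
      show "\<forall>p\<in>?V \<times> ?V - {(a, b), (b, a)}. (case p of (u, v) \<Rightarrow> if ends G e = {u, v} then ?w e else 0) = 0"
      proof
        fix p assume p: "p \<in> ?V \<times> ?V - {(a, b), (b, a)}"
        obtain u v where uv: "p = (u, v)" by (cases p)
        have "{a, b} \<noteq> {u, v}" using p uv by (auto simp: doubleton_eq_iff)
        then show "(case p of (u, v) \<Rightarrow> if ends G e = {u, v} then ?w e else 0) = 0" using ab(1) uv by simp
      qed
    qed (use fin(1) abV in auto)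
    also have "\<dots> = 2 * ?w e" using ab by (simp add: doubleton_eq_iff)
    finally show "(\<Sum>u\<in>?V. \<Sum>v\<in>?V. if ends G e = {u, v} then ?w e else 0) = 2 * ?w e" .
  qed
  also have "\<dots> = - 2 * (\<Sum>e\<in>?E. rho_edge lam G r e)" by (simp add: sum_distrib_left sum_negf)
  finally have total: "(\<Sum>u\<in>?V. \<Sum>v\<in>?V. \<Sum>e\<in>edges_between G u v. ?w e) = - 2 * (\<Sum>e\<in>?E. rho_edge lam G r e)" .
  have "2 * (\<Sum>u\<in>?V. \<Sum>v\<in>?V. edge_cost lam (?m u v)) \<le> (\<Sum>u\<in>?V. \<Sum>v\<in>?V. \<Sum>e\<in>edges_between G u v. ?w e)"
    unfolding sum_distrib_left by (intro sum_mono pair)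
  then have "(\<Sum>e\<in>?E. rho_edge lam G r e) \<le> - (\<Sum>u\<in>?V. \<Sum>v\<in>?V. edge_cost lam (?m u v))" using total by linarith
  moreover have "(\<Sum>v\<in>?V. rho_vertex k lam l v) = (\<Sum>v\<in>?V. vertex_value kap lam (l v))"
    using k by (intro sum.cong) (auto simp: rho_vertex_def vertex_value_def)
  ultimately show ?thesis by (simp add: rho_def potential_def sum_subtractf)
qed

theorem theorem2p1:
  fixes k lam :: int
    and G :: "('v, 'e) multigraph"
    and l :: "'v \<Rightarrow> nat"
    and r :: "'e rel"
  assumes "k \<ge> 47" and "lam \<in> {24, 28}" and "lam = 24 \<longrightarrow> k \<ge> 352"
    and "multigraph G"
    and "\<forall>v\<in>verts G. int (l v) \<le> k - 1"
    and "linear_order_on (edges G) r"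
    and "minimal G l"
  shows "rho k lam G l r \<le> - k + 1 \<or> complete_graph (nat k) G"
proof -
  define kap where "kap = nat (k - 1)"
  have k: "k = int kap + 1" using assms(1) by (simp add: kap_def)
  \<comment> \<open>The largest \<open>P\<close> that satisfies \<open>P_gap\<close>.\<close>
  define P where "P = nat (((lam - 6) * k + 3) div (8 * lam))"
  have "parameters kap lam P"
  proof (cases "lam = 24")
    case True
    then have "352 \<le> k" using assms(3) by simp
    then have "parameters kap 24 (nat ((18 * k + 3) div 192))"
      unfolding parameters_def k by simp linarith
    then show ?thesis using True by (simp add: P_def)
  next
    case False
    then have lam: "lam = 28" using assms(2) by simp
    have "parameters kap 28 (nat ((22 * k + 3) div 224))"
      using assms(1) unfolding parameters_def k by simp linarith
    then show ?thesis using lam by (simp add: P_def)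
  qed
  then interpret parameters kap lam P .
  have fin: "finite (verts G)" using assms(4) by (simp add: multigraph_def)
  have l: "l v \<le> kap" if "v \<in> verts G" for v using assms(5) that k by auto
  let ?m = "edge_count G"
  have "pot ?m l (verts G) \<le> - int kap \<or>
      (card (verts G) = kap + 1 \<and> (\<forall>u\<in>verts G. \<forall>v\<in>verts G. u \<noteq> v \<longrightarrow> ?m u v = 1))"
    by (rule critical_potential[OF fin multiplicity_edge_count[OF assms(4)] l minimal_critical[OF assms(4,7)]])
  moreover have "rho k lam G l r \<le> pot ?m l (verts G)"
    by (rule rho_le_potential[OF assms(4,6) _ assms(5) k]) (use lam_ge in simp)
  moreover have "nat k = kap + 1" using k by simp
  ultimately show ?thesis using k by (auto simp: complete_graph_def edge_count_def)
qed

end
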